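(* Let $\mathcal{C}$ be a small category and $D\colon\mathcal{F}\mathcal{C}\to\mathbf{Ab}$ a natural system. Then the cochain complex $\mathrm{Nat}(\tilde P_\bullet,D)$ is identified with the reduced cochain complex $\tilde F^\bullet(\mathcal{C};D)$ of non-degenerate cochains (those taking nonzero values only on non-degenerate chains), and its cohomology is the Baues--Wirsching cohomology of $\mathcal{C}$ with coefficients in $D$: for every $n\ge0$, $$\mathrm{H}^n(\tilde F^\bullet(\mathcal{C};D))\cong \mathrm{H}^n(\mathcal{C};D).$$
   Context: Factorization category. $\mathcal{F}\mathcal{C}$ has as objects the morphisms of $\mathcal{C}$; a morphism $(\alpha,\beta)\colon\lambda\to\mu$ from $\lambda\colon A\to B$ to $\mu\colon C\to D$ is a pair $\alpha\colon B\to D$, $\beta\colon C\to A$ with $\mu=\alpha\circ\lambda\circ\beta$; composition is $(\alpha',\beta')\circ(\alpha,\beta)=(\alpha'\circ\alpha,\beta\circ\beta')$. A natural system in $\mathcal{C}$ is a functor $D\colon\mathcal{FC}\to\mathbf{Ab}$; write $D_\lambda=D(\lambda)$, $D_A=D(\mathrm{id}_A)$. For $\lambda\colon A\to B$, $\alpha\colon B\to B'$, $\beta\colon A'\to A$ write $\alpha_*=D(\alpha,\mathrm{id}_A)\colon D_\lambda\to D_{\alpha\lambda}$ and $\beta^*=D(\mathrm{id}_B,\beta)\colon D_\lambda\to D_{\lambda\beta}$. $\mathrm{Nat}$ denotes the abelian group of natural transformations between functors $\mathcal{FC}\to\mathbf{Ab}$. Cohomology. For $n\ge1$, $N_n(\mathcal{C})$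 is the set of $n$-chains, i.e. sequences $(\lambda_1,\dots,\lambda_n)$ of composable morphisms $\lambda_i\colon A_i\to A_{i-1}$; $N_0(\mathcal{C})$ is the set of objects (identified with their identities). $F^n(\mathcal{C};D)$ is the abelian group of functions $f$ with $f(\lambda_1,\dots,\lambda_n)\in D_{\lambda_1\circ\cdots\circ\lambda_n}$ for each $n$-chain (for $n=0$: $f(A)\in D_A$). The coboundary is $$\delta f(\lambda_1,\dots,\lambda_n)=\lambda_{1*}f(\lambda_2,\dots,\lambda_n)+\sum_{i=1}^{n-1}(-1)^if(\lambda_1,\dots,\lambda_i\circ\lambda_{i+1},\dots,\lambda_n)+(-1)^n\lambda_n^*f(\lambda_1,\dots,\lambda_{n-1})$$ for $f\in F^{n-1}$, and for $f\in F^0$, $\lambda\colon A\to B$, $\delta f(\lambda)=\lambda_*f(A)-\lambda^*f(B)$. $\mathrm{H}^n(\mathcal{C};D)$ is the cohomology of $(F^\bullet(\mathcal{C};D),\delta)$. Reduced complex. For $n\ge1$ an $n$-chain is degenerate if some $\lambda_i$ is an identity; $0$-chains are non-degenerate. $\tilde F^n(\mathcal{C};D)\subseteq F^n(\mathcal{C};D)$ is the subgroup of cochains vanishing on all degenerate $n$-chains, with the restriction of $\delta$. The functors $\tilde P_n$. Let $P_n=\bigoplus_{(\lambda_1,\dots,\lambda_n)\in N_n(\mathcal{C})}\mathbb{Z}\,\mathrm{Hom}_{\mathcal{FC}}(\lambda_1\circ\cdots\circ\lambda_n,-)\colon\mathcal{FC}\to\mathbf{Ab}$, where $\mathbb{Z}S$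 is the free abelian group on $S$; thus $P_n(\mu)$ is free on the $(n+2)$-chains $(\lambda_0,\dots,\lambda_{n+1})$ with composite $\mu$, and $\delta_n\colon P_n\to P_{n-1}$ is $\delta_n^\mu(\lambda_0,\dots,\lambda_{n+1})=\sum_{i=0}^n(-1)^i(\lambda_0,\dots,\lambda_i\circ\lambda_{i+1},\dots,\lambda_{n+1})$. Let $P_0'=0$ and for $n\ge1$ let $P_n'\subseteq P_n$ be the sum over degenerate $n$-chains $(\lambda_1,\dots,\lambda_n)$ only. Then $\tilde P_n=P_n/P_n'$, with differential induced by $\delta_n$. *)

theory Defs
  imports "HOL-Algebra.Free_Abelian_Groups"
begin

section \<open>Small categories and functors to abelian groups\<close>

record ('o, 'm) cat =
  obj :: "'o set"
  arr :: "'m set"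
  src :: "'m \<Rightarrow> 'o"
  tgt :: "'m \<Rightarrow> 'o"
  ide :: "'o \<Rightarrow> 'm"
  cmp :: "'m \<Rightarrow> 'm \<Rightarrow> 'm"

text \<open>The term \<open>cmp C g f\<close> is \<open>g\<close> after \<open>f\<close>; its value is only meaningful if \<open>src C g = tgt C f\<close>.\<close>

locale small_category =
  fixes C :: "('o, 'm) cat"
  assumes src_obj: "f \<in> arr C \<Longrightarrow> src C f \<in> obj C"
    and tgt_obj: "f \<in> arr C \<Longrightarrow> tgt C f \<in> obj C"
    and ide_arr: "A \<in> obj C \<Longrightarrow> ide C A \<in> arr C"
    and src_ide: "A \<in> obj C \<Longrightarrow> src C (ide C A) = A"
    and tgt_ide: "A \<in> obj C \<Longrightarrow> tgt C (ide C A) = A"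
    and cmp_arr: "\<lbrakk>g \<in> arr C; f \<in> arr C; src C g = tgt C f\<rbrakk> \<Longrightarrow> cmp C g f \<in> arr C"
    and src_cmp: "\<lbrakk>g \<in> arr C; f \<in> arr C; src C g = tgt C f\<rbrakk> \<Longrightarrow> src C (cmp C g f) = src C f"
    and tgt_cmp: "\<lbrakk>g \<in> arr C; f \<in> arr C; src C g = tgt C f\<rbrakk> \<Longrightarrow> tgt C (cmp C g f) = tgt C g"
    and cmp_ide_left: "f \<in> arr C \<Longrightarrow> cmp C (ide C (tgt C f)) f = f"
    and cmp_ide_right: "f \<in> arr C \<Longrightarrow> cmp C f (ide C (src C f)) = f"
    and cmp_assoc: "\<lbrakk>h \<in> arr C; g \<in> arr C; f \<in> arr C; src C h = tgt C g; src C g = tgt C f\<rbrakk>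
      \<Longrightarrow> cmp C (cmp C h g) f = cmp C h (cmp C g f)"

text \<open>Abelian groups are (multiplicatively written) structures of HOL-Algebra, so the
  sums, differences and zeros of the mathematics appear below as products, inverses and units.\<close>

record ('o, 'm, 'a) ab_diagram =
  on_obj :: "'o \<Rightarrow> 'a monoid"
  on_arr :: "'m \<Rightarrow> 'a \<Rightarrow> 'a"

locale ab_functor =
  fixes C :: "('o, 'm) cat" and F :: "('o, 'm, 'a) ab_diagram"
  assumes ab: "A \<in> obj C \<Longrightarrow> comm_group (on_obj F A)"
    and hom: "f \<in> arr C \<Longrightarrow> on_arr F f \<in> hom (on_obj F (src C f)) (on_obj F (tgt C f))"
    and map_ide: "\<lbrakk>A \<in> obj C; x \<in> carrier (on_obj F A)\<rbrakk> \<Longrightarrow> on_arr F (ide C A) x = x"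
    and map_cmp: "\<lbrakk>g \<in> arr C; f \<in> arr C; src C g = tgt C f; x \<in> carrier (on_obj F (src C f))\<rbrakk>
      \<Longrightarrow> on_arr F (cmp C g f) x = on_arr F g (on_arr F f x)"

text \<open>The group of natural transformations. Families and components are normalised to be
  \<open>undefined\<close> outside their domains, so that equality is equality of natural transformations.\<close>

definition Nat_group ::
  "('o, 'm) cat \<Rightarrow> ('o, 'm, 'a) ab_diagram \<Rightarrow> ('o, 'm, 'b) ab_diagram \<Rightarrow> ('o \<Rightarrow> 'a \<Rightarrow> 'b) monoid"
  where "Nat_group C F G =
    \<lparr>carrier = {\<eta> \<in> (\<Pi>\<^sub>E A \<in> obj C. hom (on_obj F A) (on_obj G A) \<inter> extensional (carrier (on_obj F A))).
        \<forall>f \<in> arr C. \<forall>x \<in> carrier (on_obj F (src C f)).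
          \<eta> (tgt C f) (on_arr F f x) = on_arr G f (\<eta> (src C f) x)},
     monoid.mult = (\<lambda>\<eta> \<theta>. \<lambda>A \<in> obj C. \<lambda>x \<in> carrier (on_obj F A). \<eta> A x \<otimes>\<^bsub>on_obj G A\<^esub> \<theta> A x),
     one = (\<lambda>A \<in> obj C. \<lambda>x \<in> carrier (on_obj F A). \<one>\<^bsub>on_obj G A\<^esub>)\<rparr>"


section \<open>The factorization category and natural systems\<close>

text \<open>The arrow \<open>(\<lambda>, \<alpha>, \<beta>, \<mu>)\<close> is \<open>(\<alpha>, \<beta>) : \<lambda> \<rightarrow> \<mu>\<close>.\<close>

definition FC :: "('o, 'm) cat \<Rightarrow> ('m, 'm \<times> 'm \<times> 'm \<times> 'm) cat"
  where "FC C =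
    \<lparr>obj = arr C,
     arr = {(l, a, b, m). l \<in> arr C \<and> a \<in> arr C \<and> b \<in> arr C \<and> m \<in> arr C \<and>
              src C a = tgt C l \<and> tgt C a = tgt C m \<and> tgt C b = src C l \<and> src C b = src C m \<and>
              m = cmp C (cmp C a l) b},
     src = (\<lambda>(l, a, b, m). l),
     tgt = (\<lambda>(l, a, b, m). m),
     ide = (\<lambda>l. (l, ide C (tgt C l), ide C (src C l), l)),
     cmp = (\<lambda>(m, a', b', n) (l, a, b, m'). (l, cmp C a' a, cmp C b b', n))\<rparr>"

type_synonym ('m, 'a) nat_system = "('m, 'm \<times> 'm \<times> 'm \<times> 'm, 'a) ab_diagram"

definition natural_system :: "('o, 'm) cat \<Rightarrow> ('m, 'a) nat_system \<Rightarrow> bool"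
  where "natural_system C D \<longleftrightarrow> ab_functor (FC C) D"

text \<open>\<open>push C D \<alpha> \<lambda>\<close> and \<open>pull C D \<beta> \<lambda>\<close> are the maps \<open>\<alpha>\<^sub>*\<close> and \<open>\<beta>\<^sup>*\<close> defined on \<open>D\<^sub>\<lambda>\<close>.\<close>

definition push :: "('o, 'm) cat \<Rightarrow> ('m, 'a) nat_system \<Rightarrow> 'm \<Rightarrow> 'm \<Rightarrow> 'a \<Rightarrow> 'a"
  where "push C D a l = on_arr D (l, a, ide C (src C l), cmp C a l)"

definition pull :: "('o, 'm) cat \<Rightarrow> ('m, 'a) nat_system \<Rightarrow> 'm \<Rightarrow> 'm \<Rightarrow> 'a \<Rightarrow> 'a"
  where "pull C D b l = on_arr D (l, ide C (tgt C l), b, cmp C l b)"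


section \<open>Chains\<close>

text \<open>A chain \<open>A\<^sub>0 \<leftarrow> A\<^sub>1 \<leftarrow> \<dots> \<leftarrow> A\<^sub>n\<close> is encoded as the pair
  \<open>(A\<^sub>0, [\<lambda>\<^sub>1, \<dots>, \<lambda>\<^sub>n])\<close>. The object is determined by the list if \<open>n \<ge> 1\<close>;
  for \<open>n = 0\<close> the chain \<open>(A, [])\<close> is the object \<open>A\<close>.\<close>

type_synonym ('o, 'm) chain = "'o \<times> 'm list"

fun is_path :: "('o, 'm) cat \<Rightarrow> 'o \<Rightarrow> 'm list \<Rightarrow> bool"
  where "is_path C A [] \<longleftrightarrow> A \<in> obj C"
  | "is_path C A (l # ls) \<longleftrightarrow> l \<in> arr C \<and> tgt C l = A \<and> is_path C (src C l) ls"

definition nchains :: "('o, 'm) cat \<Rightarrow> nat \<Rightarrow> ('o, 'm) chain set"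
  where "nchains C n = {(A, ls). length ls = n \<and> is_path C A ls}"

fun composite :: "('o, 'm) cat \<Rightarrow> ('o, 'm) chain \<Rightarrow> 'm"
  where "composite C (A, []) = ide C A"
  | "composite C (A, [l]) = l"
  | "composite C (A, l # k # ls) = cmp C l (composite C (src C l, k # ls))"

definition degenerate :: "('o, 'm) cat \<Rightarrow> ('o, 'm) chain \<Rightarrow> bool"
  where "degenerate C s \<longleftrightarrow> (\<exists>l \<in> set (snd s). \<exists>A \<in> obj C. l = ide C A)"

text \<open>Composes the entries at the positions \<open>i\<close> and \<open>i + 1\<close> of the list, counted from \<open>0\<close>.\<close>

definition merge :: "('o, 'm) cat \<Rightarrow> nat \<Rightarrow> ('o, 'm) chain \<Rightarrow> ('o, 'm) chain"
  where "merge C i s = (case s of (A, ls) \<Rightarrow>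
    (A, take i ls @ [cmp C (ls ! i) (ls ! Suc i)] @ drop (i + 2) ls))"


section \<open>Cochain complexes\<close>

definition cochain_complex :: "(nat \<Rightarrow> 'a monoid) \<Rightarrow> (nat \<Rightarrow> 'a \<Rightarrow> 'a) \<Rightarrow> bool"
  where "cochain_complex K d \<longleftrightarrow> (\<forall>n. comm_group (K n) \<and> d n \<in> hom (K n) (K (Suc n)) \<and>
    (\<forall>x \<in> carrier (K n). d (Suc n) (d n x) = \<one>\<^bsub>K (Suc (Suc n))\<^esub>))"

definition cochain_iso ::
  "(nat \<Rightarrow> 'a monoid) \<Rightarrow> (nat \<Rightarrow> 'a \<Rightarrow> 'a) \<Rightarrow> (nat \<Rightarrow> 'b monoid) \<Rightarrow> (nat \<Rightarrow> 'b \<Rightarrow> 'b)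
    \<Rightarrow> (nat \<Rightarrow> 'a \<Rightarrow> 'b) \<Rightarrow> bool"
  where "cochain_iso K d L e h \<longleftrightarrow> (\<forall>n. h n \<in> iso (K n) (L n) \<and>
    (\<forall>x \<in> carrier (K n). h (Suc n) (d n x) = e n (h n x)))"

fun coboundaries :: "(nat \<Rightarrow> 'a monoid) \<Rightarrow> (nat \<Rightarrow> 'a \<Rightarrow> 'a) \<Rightarrow> nat \<Rightarrow> 'a set"
  where "coboundaries K d 0 = {\<one>\<^bsub>K 0\<^esub>}"
  | "coboundaries K d (Suc n) = d n ` carrier (K n)"

definition cohomology :: "(nat \<Rightarrow> 'a monoid) \<Rightarrow> (nat \<Rightarrow> 'a \<Rightarrow> 'a) \<Rightarrow> nat \<Rightarrow> 'a set monoid"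
  where "cohomology K d n =
    (K n)\<lparr>carrier := kernel (K n) (K (Suc n)) (d n)\<rparr> Mod coboundaries K d n"


section \<open>The Baues--Wirsching complex and the reduced complex\<close>

definition BW :: "('o, 'm) cat \<Rightarrow> ('m, 'a) nat_system \<Rightarrow> nat \<Rightarrow> (('o, 'm) chain \<Rightarrow> 'a) monoid"
  where "BW C D n = product_group (nchains C n) (\<lambda>s. on_obj D (composite C s))"

text \<open>The coboundary from degree \<open>n\<close> to degree \<open>n + 1\<close>, evaluated on \<open>(\<lambda>\<^sub>1, \<dots>, \<lambda>\<^bsub>n+1\<^esub>)\<close>.
  For \<open>n = 0\<close> and \<open>\<lambda> : A \<rightarrow> B\<close> the chain is \<open>(B, [\<lambda>])\<close>, and the formula reads
  \<open>\<lambda>\<^sub>* f(A) - \<lambda>\<^sup>* f(B)\<close>.\<close>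

definition BW_d :: "('o, 'm) cat \<Rightarrow> ('m, 'a) nat_system \<Rightarrow> nat
    \<Rightarrow> (('o, 'm) chain \<Rightarrow> 'a) \<Rightarrow> (('o, 'm) chain \<Rightarrow> 'a)"
  where "BW_d C D n f = (\<lambda>(A, ls) \<in> nchains C (Suc n).
    let G = on_obj D (composite C (A, ls));
        front = (src C (hd ls), tl ls);
        back = (A, butlast ls)
    in push C D (hd ls) (composite C front) (f front)
       \<otimes>\<^bsub>G\<^esub> finprod G (\<lambda>i. f (merge C (i - 1) (A, ls)) [^]\<^bsub>G\<^esub> ((-1) ^ i :: int)) {1..n}
       \<otimes>\<^bsub>G\<^esub> pull C D (last ls) (composite C back) (f back) [^]\<^bsub>G\<^esub> ((-1) ^ Suc n :: int))"

definition reduced :: "('o, 'm) cat \<Rightarrow> ('m, 'a) nat_system \<Rightarrow> nat \<Rightarrow> (('o, 'm) chain \<Rightarrow> 'a) monoid"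
  where "reduced C D n = (BW C D n)\<lparr>carrier :=
    {f \<in> carrier (BW C D n). \<forall>s \<in> nchains C n. degenerate C s \<longrightarrow> f s = \<one>\<^bsub>on_obj D (composite C s)\<^esub>}\<rparr>"


section \<open>The functors \<open>P\<^sub>n\<close>, their degenerate parts and the quotients\<close>

text \<open>The summand \<open>\<int> Hom(\<lambda>\<^sub>1 \<circ> \<dots> \<circ> \<lambda>\<^sub>n, \<mu>)\<close> of \<open>P\<^sub>n(\<mu>)\<close> is free on the pairs \<open>(\<alpha>, \<beta>)\<close> with
  \<open>\<alpha> \<circ> \<lambda>\<^sub>1 \<circ> \<dots> \<circ> \<lambda>\<^sub>n \<circ> \<beta> = \<mu>\<close>. Such a pair is encoded by the \<open>(n+2)\<close>-chain
  \<open>(\<alpha>, \<lambda>\<^sub>1, \<dots>, \<lambda>\<^sub>n, \<beta>)\<close> with composite \<open>\<mu>\<close>, from which \<open>middle\<close> recovers the index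
  \<open>(\<lambda>\<^sub>1, \<dots>, \<lambda>\<^sub>n)\<close>.\<close>

definition middle :: "('o, 'm) cat \<Rightarrow> ('o, 'm) chain \<Rightarrow> ('o, 'm) chain"
  where "middle C s = (src C (hd (snd s)), butlast (tl (snd s)))"

definition P_grp :: "('o, 'm) cat \<Rightarrow> nat \<Rightarrow> 'm \<Rightarrow> (('o, 'm) chain \<Rightarrow>\<^sub>0 int) monoid"
  where "P_grp C n m = free_Abelian_group {s \<in> nchains C (n + 2). composite C s = m}"

text \<open>Postcomposition with \<open>(\<alpha>, \<beta>)\<close> on the hom-sets of the factorization category.\<close>

definition P_act :: "('o, 'm) cat \<Rightarrow> 'm \<times> 'm \<times> 'm \<times> 'm
    \<Rightarrow> (('o, 'm) chain \<Rightarrow>\<^sub>0 int) \<Rightarrow> (('o, 'm) chain \<Rightarrow>\<^sub>0 int)"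
  where "P_act C f = (case f of (l, a, b, m) \<Rightarrow> frag_extend (\<lambda>(A, ls).
    frag_of (tgt C a, cmp C a (hd ls) # butlast (tl ls) @ [cmp C (last ls) b])))"

definition P_d :: "('o, 'm) cat \<Rightarrow> nat \<Rightarrow> (('o, 'm) chain \<Rightarrow>\<^sub>0 int) \<Rightarrow> (('o, 'm) chain \<Rightarrow>\<^sub>0 int)"
  where "P_d C n = frag_extend (\<lambda>s. \<Sum>i = 0..n. frag_cmul ((-1) ^ i) (frag_of (merge C i s)))"

text \<open>For \<open>n = 0\<close> this is the zero subgroup, because no \<open>0\<close>-chain is degenerate.\<close>

definition P_deg :: "('o, 'm) cat \<Rightarrow> nat \<Rightarrow> 'm \<Rightarrow> (('o, 'm) chain \<Rightarrow>\<^sub>0 int) set"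
  where "P_deg C n m =
    carrier (free_Abelian_group {s \<in> nchains C (n + 2). composite C s = m \<and> degenerate C (middle C s)})"

text \<open>The map on cosets induced by a homomorphism \<open>h\<close> into \<open>G\<close> that maps the subgroup divided out
  in its domain into \<open>N\<close>: the coset of \<open>x\<close> goes to the coset of \<open>h x\<close>.\<close>

definition quot_map :: "'b monoid \<Rightarrow> 'b set \<Rightarrow> ('a \<Rightarrow> 'b) \<Rightarrow> 'a set \<Rightarrow> 'b set"
  where "quot_map G N h X = (\<Union>x \<in> X. N #>\<^bsub>G\<^esub> h x)"

definition Pt :: "('o, 'm) cat \<Rightarrow> nat
    \<Rightarrow> ('m, 'm \<times> 'm \<times> 'm \<times> 'm, (('o, 'm) chain \<Rightarrow>\<^sub>0 int) set) ab_diagram"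
  where "Pt C n =
    \<lparr>on_obj = (\<lambda>m. P_grp C n m Mod P_deg C n m),
     on_arr = (\<lambda>f. quot_map (P_grp C n (tgt (FC C) f)) (P_deg C n (tgt (FC C) f)) (P_act C f))\<rparr>"

text \<open>The component at \<open>\<mu>\<close> of the differential from degree \<open>n + 1\<close> to degree \<open>n\<close>.\<close>

definition Pt_d :: "('o, 'm) cat \<Rightarrow> nat \<Rightarrow> 'm
    \<Rightarrow> (('o, 'm) chain \<Rightarrow>\<^sub>0 int) set \<Rightarrow> (('o, 'm) chain \<Rightarrow>\<^sub>0 int) set"
  where "Pt_d C n m = quot_map (P_grp C n m) (P_deg C n m) (P_d C (Suc n))"


section \<open>The cochain complex of natural transformations and its comparison map\<close>

type_synonym ('o, 'm, 'a) Pt_nat = "'m \<Rightarrow> (('o, 'm) chain \<Rightarrow>\<^sub>0 int) set \<Rightarrow> 'a"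

definition NatP :: "('o, 'm) cat \<Rightarrow> ('m, 'a) nat_system \<Rightarrow> nat \<Rightarrow> ('o, 'm, 'a) Pt_nat monoid"
  where "NatP C D n = Nat_group (FC C) (Pt C n) D"

definition NatP_d :: "('o, 'm) cat \<Rightarrow> nat \<Rightarrow> ('o, 'm, 'a) Pt_nat \<Rightarrow> ('o, 'm, 'a) Pt_nat"
  where "NatP_d C n \<eta> =
    (\<lambda>m \<in> obj (FC C). \<lambda>X \<in> carrier (on_obj (Pt C (Suc n)) m). \<eta> m (Pt_d C n m X))"

text \<open>The identification given by the Yoneda lemma: evaluate at the class of the identity of
  \<open>\<lambda>\<^sub>1 \<circ> \<dots> \<circ> \<lambda>\<^sub>n\<close> in the summand indexed by \<open>(\<lambda>\<^sub>1, \<dots>, \<lambda>\<^sub>n)\<close>, that is, of the chain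
  \<open>(id, \<lambda>\<^sub>1, \<dots>, \<lambda>\<^sub>n, id)\<close>.\<close>

definition yoneda :: "('o, 'm) cat \<Rightarrow> nat \<Rightarrow> ('o, 'm, 'a) Pt_nat \<Rightarrow> (('o, 'm) chain \<Rightarrow> 'a)"
  where "yoneda C n \<eta> = (\<lambda>(A, ls) \<in> nchains C n.
    let m = composite C (A, ls)
    in \<eta> m (P_deg C n m #>\<^bsub>P_grp C n m\<^esub> frag_of (A, ide C A # ls @ [ide C (src C m)])))"

end

theory Submission
  imports Defs
begin

text \<open>
  By the Yoneda lemma, an \<open>n\<close>-cochain extends uniquely to a natural transformation \<open>P\<^sub>n \<rightarrow> D\<close>, and the
  coboundary is precomposition with the differential \<open>\<partial>\<close> of \<open>P\<close>. Identities for cochains therefore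
  follow from identities between chains in free abelian groups, and the reduced cochains are those
  whose extension vanishes on \<open>P\<^sub>n'\<close>.

  For the comparison of cohomologies it is enough that every cochain \<open>f\<close> with reduced coboundary becomes
  reduced after adding a coboundary. Suppose that \<open>f\<close> vanishes on chains with an identity among the
  first \<open>p\<close> positions, and let \<open>\<sigma>\<close> insert an identity after position \<open>p\<close>. Modulo such chains,
  \<open>\<partial>\<sigma> + \<sigma>\<partial>\<close> is \<open>(-1)\<^sup>p\<close> on chains with an identity at position \<open>p + 1\<close>, while \<open>f \<circ> \<partial> \<circ> \<sigma>\<close>
  vanishes because the coboundary of \<open>f\<close> is reduced.
  Hence \<open>f - (-1)\<^sup>p \<delta>(f\<sigma>)\<close> vanishes on chains with an identity among the first \<open>p + 1\<close> positions.
\<close>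

section \<open>Free abelian groups\<close>

text \<open>Adding an identity at both ends turns an n-chain into a basis element of
  \<open>P\<^sub>n\<close>. After this padding the two outer terms of the coboundary are faces like
  all the others, and a natural transformation is determined by its values on padded chains. Hence
  the computations take place on lists of length n + 2 whose first and last positions hold the
  arrows on which the factorization category acts. The insertion \<sigma> has to commute with that
  action in order to operate on cochains. Its identity therefore always lands strictly between the
  two outer entries. Insertion directly after the first entry is allowed, because composing that
  entry with an arrow on its left does not change its source. Positions are treated from left to
  right because a face moves an identity by at most one place, and only to the left: the chains with
  an identity among the first p positions are stable under \<partial>. A correction by a coboundary
  leaves the coboundary of f unchanged, so the hypothesis that it is reduced is available again at
  the next position.\<close>

lemma hom_free_eqI:
  assumes "group G" "h \<in> hom (free_Abelian_group S) G" "k \<in> hom (free_Abelian_group S) G"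
    and "\<And>s. s \<in> S \<Longrightarrow> h (frag_of s) = k (frag_of s)" and "Poly_Mapping.keys x \<subseteq> S"
  shows "h x = k x"
proof -
  interpret h: group_hom "free_Abelian_group S" G h
    using assms by (simp add: group_hom_def group_hom_axioms_def)
  interpret k: group_hom "free_Abelian_group S" G k
    using assms by (simp add: group_hom_def group_hom_axioms_def)
  show ?thesis
  proof (rule free_Abelian_group_induct[OF assms(5)])
    show "h 0 = k 0" using h.hom_one k.hom_one by simp
  next
    fix x y assume xy: "Poly_Mapping.keys x \<subseteq> S" "Poly_Mapping.keys y \<subseteq> S" "h x = k x" "h y = k y"
    have "h (x - y) = h x \<otimes>\<^bsub>G\<^esub> inv\<^bsub>G\<^esub> h y"
      using h.hom_mult[of x "- y"] h.hom_inv[of y] xy by simp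
    also have "\<dots> = k (x - y)"
      using k.hom_mult[of x "- y"] k.hom_inv[of y] xy by simp
    finally show "h (x - y) = k (x - y)" .
  qed (use assms in auto)
qed

text \<open>The comparison with the trivial map takes place on the free group on T, to which h
  restricts. Vanishing on a span of degenerate chains can thus be tested on single chains.\<close>

lemma hom_free_trivial:
  assumes "group G" "h \<in> hom (free_Abelian_group S) G" "T \<subseteq> S"
    and "\<And>s. s \<in> T \<Longrightarrow> h (frag_of s) = \<one>\<^bsub>G\<^esub>" and "Poly_Mapping.keys x \<subseteq> T"
  shows "h x = \<one>\<^bsub>G\<^esub>"
proof (rule hom_free_eqI[where S = T and k = "\<lambda>_. \<one>\<^bsub>G\<^esub>"])
  show "h \<in> hom (free_Abelian_group T) G"
    using assms(2,3) by (auto simp: hom_def)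
  show "(\<lambda>_. \<one>\<^bsub>G\<^esub>) \<in> hom (free_Abelian_group T) G"
    using assms(1) by (auto simp: hom_def group.is_monoid)
qed (use assms in auto)

lemma hom_free_cmul:
  assumes "group G" "h \<in> hom (free_Abelian_group S) G" "Poly_Mapping.keys x \<subseteq> S"
  shows "h (frag_cmul k x) = h x [^]\<^bsub>G\<^esub> k"
  using hom_int_pow[OF assms(2), of x k] assms by simp

lemma hom_free_sum:
  assumes "comm_group G" "h \<in> hom (free_Abelian_group S) G" "finite I"
    and "\<And>i. i \<in> I \<Longrightarrow> Poly_Mapping.keys (x i) \<subseteq> S"
  shows "h (\<Sum>i\<in>I. x i) = finprod G (\<lambda>i. h (x i)) I"
  using assms(3,4)
proof (induction I rule: finite_induct)
  case empty
  interpret comm_group G by fact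
  show ?case
    using hom_one[OF assms(2)] assms(1) by (simp add: is_group)
next
  case (insert i I)
  interpret comm_group G by fact
  have h: "h y \<in> carrier G" if "Poly_Mapping.keys y \<subseteq> S" for y
    using that assms(2) by (auto simp: hom_def)
  have "Poly_Mapping.keys (\<Sum>i\<in>I. x i) \<subseteq> S"
    using sum_closed_free_Abelian_group[of I x S] insert by auto
  then have "h (x i + (\<Sum>i\<in>I. x i)) = h (x i) \<otimes>\<^bsub>G\<^esub> h (\<Sum>i\<in>I. x i)"
    using assms(2) insert by (simp add: hom_def)
  also have "\<dots> = finprod G (\<lambda>i. h (x i)) (insert i I)"
    using insert h by (subst finprod_insert) auto
  finally show ?case using insert by simp
qed

lemma frag_extend_hom:
  assumes "\<And>s. s \<in> S \<Longrightarrow> Poly_Mapping.keys (\<phi> s) \<subseteq> T"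
  shows "frag_extend \<phi> \<in> hom (free_Abelian_group S) (free_Abelian_group T)"
  using assms keys_frag_extend[of \<phi>] by (fastforce simp: hom_def frag_extend_add)

lemma keys_frag_extend_subset:
  assumes "\<And>s. s \<in> S \<Longrightarrow> Poly_Mapping.keys (\<phi> s) \<subseteq> T" "Poly_Mapping.keys x \<subseteq> S"
  shows "Poly_Mapping.keys (frag_extend \<phi> x) \<subseteq> T"
  using assms keys_frag_extend[of \<phi> x] by blast

lemma sum_split_at:
  fixes U :: "nat \<Rightarrow> 'a::ab_group_add"
  assumes "p \<le> n"
  shows "(\<Sum>i=0..n. U i) = (\<Sum>i<p. U i) + (U p + (\<Sum>i=Suc p..n. U i))"
proof -
  have "{0..n} = {..<p} \<union> insert p {Suc p..n}" using assms by auto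
  moreover have "sum U ({..<p} \<union> insert p {Suc p..n}) = sum U {..<p} + sum U (insert p {Suc p..n})"
    by (rule sum.union_disjoint) auto
  ultimately show ?thesis by simp
qed

lemma frag_cmul_add_neg: "frag_cmul k x + frag_cmul (- k) x = 0"
  by (simp flip: frag_cmul_distrib)

lemma keys_cmul_subset: "Poly_Mapping.keys x \<subseteq> S \<Longrightarrow> Poly_Mapping.keys (frag_cmul c x) \<subseteq> S"
  using keys_cmul[of c x] by blast

lemma keys_sum_subset:
  "(\<And>i. i \<in> I \<Longrightarrow> Poly_Mapping.keys (x i) \<subseteq> S) \<Longrightarrow> Poly_Mapping.keys (\<Sum>i\<in>I. x i) \<subseteq> S"
  using keys_sum[of x I] by blast

lemma keys_add_subset:
  "Poly_Mapping.keys x \<subseteq> S \<Longrightarrow> Poly_Mapping.keys y \<subseteq> S \<Longrightarrow> Poly_Mapping.keys (x + y) \<subseteq> S"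
  using keys_add[of x y] by blast

lemma keys_cmul_of: "s \<in> S \<Longrightarrow> Poly_Mapping.keys (frag_cmul c (frag_of s)) \<subseteq> S"
  by (rule keys_cmul_subset) simp

lemma hom_pointwise_mult:
  assumes "comm_group G" "h \<in> hom H G" "k \<in> hom H G"
  shows "(\<lambda>x. h x \<otimes>\<^bsub>G\<^esub> k x) \<in> hom H G"
proof (rule homI)
  interpret G: comm_group G by fact
  have c: "h x \<in> carrier G" "k x \<in> carrier G" if "x \<in> carrier H" for x
    using that assms(2,3) by (simp_all add: hom_in_carrier)
  fix x assume "x \<in> carrier H"
  then show "h x \<otimes>\<^bsub>G\<^esub> k x \<in> carrier G" using c by simp
next
  interpret G: comm_group G by fact
  have c: "h x \<in> carrier G" "k x \<in> carrier G" if "x \<in> carrier H" for x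
    using that assms(2,3) by (simp_all add: hom_in_carrier)
  fix x y assume "x \<in> carrier H" "y \<in> carrier H"
  then show "h (x \<otimes>\<^bsub>H\<^esub> y) \<otimes>\<^bsub>G\<^esub> k (x \<otimes>\<^bsub>H\<^esub> y) = (h x \<otimes>\<^bsub>G\<^esub> k x) \<otimes>\<^bsub>G\<^esub> (h y \<otimes>\<^bsub>G\<^esub> k y)"
    using c by (simp add: hom_mult[OF assms(2)] hom_mult[OF assms(3)] G.m_ac)
qed

text \<open>\<open>quot_map\<close> is a union over all representatives of a coset. Since h maps K
  into N, they all contribute the same coset, and x itself is one of them.\<close>

lemma quot_map_coset:
  assumes "group H" "group G" "subgroup K H" "subgroup N G" "h \<in> hom H G" "h ` K \<subseteq> N" "x \<in> carrier H"
  shows "quot_map G N h (K #>\<^bsub>H\<^esub> x) = N #>\<^bsub>G\<^esub> h x"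
proof -
  have *: "N #>\<^bsub>G\<^esub> h y = N #>\<^bsub>G\<^esub> h x" if y: "y \<in> K #>\<^bsub>H\<^esub> x" for y
  proof -
    obtain k where k: "k \<in> K" "y = k \<otimes>\<^bsub>H\<^esub> x" using y by (auto simp: r_coset_def)
    have "h y = h k \<otimes>\<^bsub>G\<^esub> h x"
      using hom_mult[OF assms(5) _ assms(7)] subgroup.mem_carrier[OF assms(3) k(1)] k(2) by simp
    then have "h y \<in> N #>\<^bsub>G\<^esub> h x" using k(1) assms(6) by (auto simp: r_coset_def)
    then show ?thesis
      by (rule group.repr_independence[OF assms(2) _ hom_in_carrier[OF assms(5,7)] assms(4), symmetric])
  qed
  have "x \<in> K #>\<^bsub>H\<^esub> x" by (rule group.rcos_self[OF assms(1,7,3)])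
  then show ?thesis unfolding quot_map_def using * by blast
qed

text \<open>Read \<open>g i j\<close> as face i after face j. The assumption is then the simplicial
  identity, and it matches the terms with j \<le> i one to one with those with i < j.\<close>

lemma simplicial_alternating_sum:
  fixes g :: "nat \<Rightarrow> nat \<Rightarrow> 'a \<Rightarrow>\<^sub>0 int"
  assumes "\<And>i j. j \<le> i \<Longrightarrow> i \<le> N \<Longrightarrow> g i j = g j (Suc i)"
  shows "(\<Sum>j=0..Suc N. \<Sum>i=0..N. frag_cmul ((-1) ^ (i + j)) (g i j)) = 0"
proof -
  let ?t = "\<lambda>(j, i). frag_cmul ((-1) ^ (i + j)) (g i j)"
  let ?L = "{(j, i). j \<le> i \<and> i \<le> N}" and ?U = "{(j, i). i < j \<and> j \<le> Suc N}"
  have fin: "finite ?L" "finite ?U"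
    by (rule finite_subset[of _ "{0..Suc N} \<times> {0..Suc N}"]; auto)+
  \<comment> \<open>The pair (j, i) goes to (i + 1, j). The exponent i + j grows by one, so matched
    terms have opposite signs.\<close>
  let ?\<sigma> = "\<lambda>p::nat \<times> nat. (Suc (snd p), fst p)"
  have Uf: "?U = ?\<sigma> ` ?L"
  proof 
    show "?U \<subseteq> ?\<sigma> ` ?L"
    proof
      fix p assume p: "p \<in> ?U"
      then have "p = ?\<sigma> (snd p, fst p - 1)" "(snd p, fst p - 1) \<in> ?L"
        by (auto simp: case_prod_unfold prod_eq_iff)
      then show "p \<in> ?\<sigma> ` ?L" by (rule image_eqI)
    qed
  qed auto
  have inj: "inj_on ?\<sigma> ?L" by (auto simp: inj_on_def)
  have U: "sum ?t ?U = sum (\<lambda>p. - ?t p) ?L" unfolding Uf sum.reindex[OF inj]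
  proof (rule sum.cong)
    fix p assume p: "p \<in> ?L"
    then have "g (snd p) (fst p) = g (fst p) (Suc (snd p))" by (intro assms) auto
    then show "((\<lambda>(j, i). frag_cmul ((- 1) ^ (i + j)) (g i j)) \<circ> ?\<sigma>) p =
      - (case p of (j, i) \<Rightarrow> frag_cmul ((- 1) ^ (i + j)) (g i j))"
      by (simp add: case_prod_unfold add.commute)
  qed simp
  have set: "{0..Suc N} \<times> {0..N} = ?L \<union> ?U" by auto
  have "(\<Sum>j=0..Suc N. \<Sum>i=0..N. frag_cmul ((-1) ^ (i + j)) (g i j)) = sum ?t ({0..Suc N} \<times> {0..N})"
    by (rule sum.cartesian_product)
  also have "\<dots> = sum ?t ?L + sum ?t ?U"
    unfolding set by (intro sum.union_disjoint fin) auto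
  finally show ?thesis unfolding U sum_negf by simp
qed

section \<open>Cohomology\<close>

lemma subgroup_coboundaries:
  assumes "cochain_complex K d"
  shows "subgroup (coboundaries K d n) ((K n)\<lparr>carrier := kernel (K n) (K (Suc n)) (d n)\<rparr>)"
proof -
  have K: "comm_group (K i)" and d: "d i \<in> hom (K i) (K (Suc i))" for i
    using assms by (auto simp: cochain_complex_def)
  have g: "group (K i)" for i using K by (simp add: comm_group.axioms)
  have gh: "group_hom (K i) (K (Suc i)) (d i)" for i
    using g d by (simp add: group_hom_def group_hom_axioms_def)
  have ker: "subgroup (kernel (K n) (K (Suc n)) (d n)) (K n)"
    by (rule group_hom.subgroup_kernel[OF gh])
  show ?thesis
  proof (rule group.subgroup_incl[OF g _ ker])
    show "subgroup (coboundaries K d n) (K n)"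
      using group.triv_subgroup[OF g] group_hom.img_is_subgroup[OF gh] by (cases n) auto
    show "coboundaries K d n \<subseteq> kernel (K n) (K (Suc n)) (d n)"
    proof (cases n)
      case 0
      then show ?thesis using subgroup.one_closed[OF ker] by simp
    next
      case (Suc k)
      then show ?thesis
        using assms hom_in_carrier[OF d] by (auto simp: kernel_def cochain_complex_def)
    qed
  qed
qed

text \<open>First isomorphism theorem for the map from the cocycles of K to the cohomology of L:
  \<open>inj\<close> bounds the kernel by the coboundaries, and \<open>surj\<close> asks for a
  preimage only up to a coboundary. This form covers an isomorphism of complexes as well as the
  inclusion of the reduced complex, which need not be surjective on cochains.\<close>

lemma cohomology_isoI:
  assumes K: "cochain_complex K d" and L: "cochain_complex L e"
    and h: "\<And>n. h n \<in> hom (K n) (L n)"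
    and comm: "\<And>n x. x \<in> carrier (K n) \<Longrightarrow> h (Suc n) (d n x) = e n (h n x)"
    and surj: "\<And>z. z \<in> carrier (L n) \<Longrightarrow> e n z = \<one>\<^bsub>L (Suc n)\<^esub> \<Longrightarrow>
      \<exists>x \<in> carrier (K n). \<exists>c \<in> coboundaries L e n. d n x = \<one>\<^bsub>K (Suc n)\<^esub> \<and> z = c \<otimes>\<^bsub>L n\<^esub> h n x"
    and inj: "\<And>x. x \<in> carrier (K n) \<Longrightarrow> d n x = \<one>\<^bsub>K (Suc n)\<^esub> \<Longrightarrow>
      h n x \<in> coboundaries L e n \<Longrightarrow> x \<in> coboundaries K d n"
  shows "cohomology K d n \<cong> cohomology L e n"
proof -
  define ZK where "ZK = (K n)\<lparr>carrier := kernel (K n) (K (Suc n)) (d n)\<rparr>"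
  define ZL where "ZL = (L n)\<lparr>carrier := kernel (L n) (L (Suc n)) (e n)\<rparr>"
  define BK where "BK = coboundaries K d n"
  define BL where "BL = coboundaries L e n"
  have gK: "group (K i)" and gL: "group (L i)" for i
    using K L by (auto simp: cochain_complex_def comm_group.axioms)
  have d: "d i \<in> hom (K i) (K (Suc i))" and e: "e i \<in> hom (L i) (L (Suc i))" for i
    using K L by (auto simp: cochain_complex_def)
  have kerK: "subgroup (kernel (K n) (K (Suc n)) (d n)) (K n)"
    using gK d by (intro group_hom.subgroup_kernel) (simp add: group_hom_def group_hom_axioms_def)
  have kerL: "subgroup (kernel (L n) (L (Suc n)) (e n)) (L n)"
    using gL e by (intro group_hom.subgroup_kernel) (simp add: group_hom_def group_hom_axioms_def)
  have ZK: "group ZK"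
    unfolding ZK_def by (rule subgroup.subgroup_is_group[OF kerK gK])
  interpret ZL: group ZL
    unfolding ZL_def by (rule subgroup.subgroup_is_group[OF kerL gL])
  have cZL: "comm_group ZL"
  proof (rule ZL.group_comm_groupI)
    have "comm_group (L n)" using L by (simp add: cochain_complex_def)
    then show "x \<otimes>\<^bsub>ZL\<^esub> y = y \<otimes>\<^bsub>ZL\<^esub> x" if "x \<in> carrier ZL" "y \<in> carrier ZL" for x y
      using that by (auto simp: ZL_def kernel_def comm_monoid.m_comm comm_group.axioms)
  qed
  have BL: "subgroup BL ZL" unfolding BL_def ZL_def by (rule subgroup_coboundaries[OF L])
  have BK: "subgroup BK ZK" unfolding BK_def ZK_def by (rule subgroup_coboundaries[OF K])
  have nBL: "BL \<lhd> ZL" using comm_group.normal_iff_subgroup[OF cZL] BL by simp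
  have HL: "group (ZL Mod BL)" by (rule normal.factorgroup_is_group[OF nBL])
  have hZ: "h n x \<in> carrier ZL" if "x \<in> carrier ZK" for x
    using that hom_in_carrier[OF h] comm[of x n] hom_one[OF h gK gL]
    by (auto simp: ZK_def ZL_def kernel_def)
  let ?f = "\<lambda>x. BL #>\<^bsub>ZL\<^esub> h n x"
  interpret f: group_hom ZK "ZL Mod BL" ?f
  proof (simp add: group_hom_def group_hom_axioms_def ZK HL, rule homI)
    fix x assume "x \<in> carrier ZK"
    then show "?f x \<in> carrier (ZL Mod BL)"
      using hZ by (auto simp: carrier_FactGroup)
  next
    fix x y assume xy: "x \<in> carrier ZK" "y \<in> carrier ZK"
    then have "h n (x \<otimes>\<^bsub>ZK\<^esub> y) = h n x \<otimes>\<^bsub>ZL\<^esub> h n y"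
      using hom_mult[OF h] by (auto simp: ZK_def ZL_def kernel_def)
    then show "?f (x \<otimes>\<^bsub>ZK\<^esub> y) = ?f x \<otimes>\<^bsub>ZL Mod BL\<^esub> ?f y"
      using normal.rcos_sum[OF nBL] hZ xy by simp
  qed
  have "kernel ZK (ZL Mod BL) ?f = BK"
  proof
    show "kernel ZK (ZL Mod BL) ?f \<subseteq> BK"
    proof
      fix x assume x: "x \<in> kernel ZK (ZL Mod BL) ?f"
      then have "?f x = BL" "x \<in> carrier ZK" by (auto simp: kernel_def)
      then have "h n x \<in> BL" using ZL.rcos_self[OF hZ BL] by auto
      then show "x \<in> BK"
        using inj \<open>x \<in> carrier ZK\<close> by (auto simp: BK_def BL_def ZK_def kernel_def)
    qed
    show "BK \<subseteq> kernel ZK (ZL Mod BL) ?f"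
    proof
      fix x assume x: "x \<in> BK"
      have xZ: "x \<in> carrier ZK" using x subgroup.subset[OF BK] by auto
      have "h n x \<in> BL"
      proof (cases n)
        case 0
        then show ?thesis using x hom_one[OF h gK gL] by (simp add: BK_def BL_def)
      next
        case (Suc k)
        then show ?thesis
          using x comm hom_in_carrier[OF h] by (auto simp: BK_def BL_def)
      qed
      then have "?f x = BL" using ZL.coset_join2[OF hZ[OF xZ] BL] by simp
      then show "x \<in> kernel ZK (ZL Mod BL) ?f" using xZ by (simp add: kernel_def)
    qed
  qed
  moreover have "?f ` carrier ZK = carrier (ZL Mod BL)"
  proof
    show "carrier (ZL Mod BL) \<subseteq> ?f ` carrier ZK"
    proof
      fix X assume "X \<in> carrier (ZL Mod BL)"
      then obtain z where z: "z \<in> carrier ZL" "X = BL #>\<^bsub>ZL\<^esub> z" by (auto simp: carrier_FactGroup)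
      then obtain x c where x: "x \<in> carrier (K n)" "c \<in> BL" "d n x = \<one>\<^bsub>K (Suc n)\<^esub>"
        "z = c \<otimes>\<^bsub>L n\<^esub> h n x"
        using surj[of z] by (auto simp: ZL_def kernel_def BL_def)
      have xZ: "x \<in> carrier ZK" using x by (simp add: ZK_def kernel_def)
      have "z \<in> ?f x" using x(2,4) by (auto simp: r_coset_def ZL_def)
      then have "X = ?f x" using ZL.repr_independence[OF _ hZ[OF xZ] BL] z by simp
      then show "X \<in> ?f ` carrier ZK" using xZ by blast
    qed
  qed (use f.hom_closed in auto)
  ultimately have "ZK Mod BK \<cong> ZL Mod BL"
    using f.FactGroup_iso by simp
  then show ?thesis by (simp add: cohomology_def ZK_def ZL_def BK_def BL_def)
qed

lemma cohomology_cochain_iso: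
  assumes K: "cochain_complex K d" and L: "cochain_complex L e" and iso: "cochain_iso K d L e h"
  shows "cohomology K d n \<cong> cohomology L e n"
proof -
  have hom: "h n \<in> hom (K n) (L n)" and bij: "bij_betw (h n) (carrier (K n)) (carrier (L n))"
    and comm: "x \<in> carrier (K n) \<Longrightarrow> h (Suc n) (d n x) = e n (h n x)" for n x
    using iso by (auto simp: cochain_iso_def iso_def)
  have gK: "group (K n)" and gL: "group (L n)" and d: "d n \<in> hom (K n) (K (Suc n))" for n
    using K L by (auto simp: cochain_complex_def comm_group.axioms)
  have one: "h n \<one>\<^bsub>K n\<^esub> = \<one>\<^bsub>L n\<^esub>" for n by (rule hom_one[OF hom gK gL])
  have oneK: "\<one>\<^bsub>K n\<^esub> \<in> carrier (K n)" for n
    by (rule monoid.one_closed[OF group.is_monoid[OF gK]])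
  have inj: "x = y" if "h n x = h n y" "x \<in> carrier (K n)" "y \<in> carrier (K n)" for n x y
    by (rule inj_onD[OF bij_betw_imp_inj_on[OF bij[of n]] that])
  have surj: "\<exists>x \<in> carrier (K n). h n x = z" if "z \<in> carrier (L n)" for n z
  proof -
    have "z \<in> h n ` carrier (K n)" unfolding bij_betw_imp_surj_on[OF bij] by (rule that)
    then show ?thesis by blast
  qed
  show ?thesis
  proof (rule cohomology_isoI[where h = h, OF K L hom comm])
    fix z assume z: "z \<in> carrier (L n)" "e n z = \<one>\<^bsub>L (Suc n)\<^esub>"
    then obtain x where x: "x \<in> carrier (K n)" "h n x = z" using surj by blast
    have "h (Suc n) (d n x) = h (Suc n) \<one>\<^bsub>K (Suc n)\<^esub>" using comm[OF x(1)] x(2) z(2) one by simp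
    then have "d n x = \<one>\<^bsub>K (Suc n)\<^esub>"
      by (rule inj[of "Suc n" "d n x" "\<one>\<^bsub>K (Suc n)\<^esub>", OF _ hom_in_carrier[OF d x(1)] oneK])
    moreover have "z = \<one>\<^bsub>L n\<^esub> \<otimes>\<^bsub>L n\<^esub> h n x"
      using monoid.l_one[OF group.is_monoid[OF gL] z(1)] x(2) by simp
    moreover have "\<one>\<^bsub>L n\<^esub> \<in> coboundaries L e n"
      using subgroup.one_closed[OF subgroup_coboundaries[OF L]] by simp
    ultimately show "\<exists>x \<in> carrier (K n). \<exists>c \<in> coboundaries L e n. d n x = \<one>\<^bsub>K (Suc n)\<^esub> \<and> z = c \<otimes>\<^bsub>L n\<^esub> h n x"
      using x(1) by blast
  next
    fix x assume x: "x \<in> carrier (K n)" "h n x \<in> coboundaries L e n"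
    show "x \<in> coboundaries K d n"
    proof (cases n)
      case 0
      then have "h n x = h n \<one>\<^bsub>K n\<^esub>" using x(2) one by simp
      then have "x = \<one>\<^bsub>K n\<^esub>" by (rule inj[of n x "\<one>\<^bsub>K n\<^esub>", OF _ x(1) oneK])
      then show ?thesis using 0 by simp
    next
      case (Suc k)
      then obtain y where y: "y \<in> carrier (L k)" "h n x = e k y" using x(2) by auto
      obtain w where w: "w \<in> carrier (K k)" "h k w = y" using surj[OF y(1)] by blast
      have "h n (d k w) = h n x" using comm[OF w(1)] w(2) y(2) Suc by simp
      then have "d k w = x" using inj[of n "d k w" x] hom_in_carrier[OF d w(1)] x(1) Suc by simp
      then show ?thesis using w(1) Suc by auto
    qed
  qed
qed

section \<open>Faces and degeneracies of chains\<close>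

definition merge_list :: "('o, 'm) cat \<Rightarrow> nat \<Rightarrow> 'm list \<Rightarrow> 'm list"
  where "merge_list C i ls = take i ls @ [cmp C (ls ! i) (ls ! Suc i)] @ drop (i + 2) ls"

text \<open>The degeneracy \<sigma>. The object of the identity is read off the entry to its left,
  so p has to be a valid index; for p = 0 that entry is the left outer arrow of a basis element of
  \<open>P\<^sub>n\<close>.\<close>

definition insert_ide :: "('o, 'm) cat \<Rightarrow> nat \<Rightarrow> 'm list \<Rightarrow> 'm list"
  where "insert_ide C p ls = take (Suc p) ls @ [ide C (src C (ls ! p))] @ drop (Suc p) ls"

definition act_list :: "('o, 'm) cat \<Rightarrow> 'm \<Rightarrow> 'm \<Rightarrow> 'm list \<Rightarrow> 'm list"
  where "act_list C a b ls = cmp C a (hd ls) # butlast (tl ls) @ [cmp C (last ls) b]"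

lemma merge_eq: "merge C i (A, ls) = (A, merge_list C i ls)"
  by (simp add: merge_def merge_list_def)

lemma length_merge_list [simp]: "Suc i < length ls \<Longrightarrow> length (merge_list C i ls) = length ls - 1"
  by (auto simp: merge_list_def)

lemma length_insert_ide [simp]: "p < length ls \<Longrightarrow> length (insert_ide C p ls) = Suc (length ls)"
  by (auto simp: insert_ide_def)

lemma length_act_list [simp]: "2 \<le> length ls \<Longrightarrow> length (act_list C a b ls) = length ls"
  by (auto simp: act_list_def)

text \<open>Faces, insertions and the outer action are all given entry by entry, so that the
  identities between them reduce to a comparison of positions in which the category laws enter only
  at the composed entries.\<close>

lemma nth_merge_list:
  assumes "Suc i < length ls" "k < length ls - 1"
  shows "merge_list C i ls ! k =
    (if k < i then ls ! k else if k = i then cmp C (ls ! i) (ls ! Suc i) else ls ! Suc k)"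
  using assms by (auto simp: merge_list_def nth_append nth_Cons' min_def)

lemma nth_insert_ide:
  assumes "p < length ls" "k \<le> length ls"
  shows "insert_ide C p ls ! k =
    (if k \<le> p then ls ! k else if k = Suc p then ide C (src C (ls ! p)) else ls ! (k - 1))"
  using assms by (cases k) (auto simp: insert_ide_def nth_append nth_Cons' min_def numeral_2_eq_2 Suc_diff_Suc)

lemma nth_act_list:
  assumes "2 \<le> length ls" "k < length ls"
  shows "act_list C a b ls ! k =
    (if k = 0 then cmp C a (ls ! 0) else if k = length ls - 1 then cmp C (ls ! k) b else ls ! k)"
proof -
  have "ls \<noteq> []" using assms by auto
  then show ?thesis
    using assms by (auto simp: act_list_def nth_append nth_Cons' nth_butlast nth_tl hd_conv_nth last_conv_nth)
qed

lemma merge_list_append: "Suc k < length ls \<Longrightarrow> merge_list C k (ls @ zs) = merge_list C k ls @ zs"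
  by (simp add: merge_list_def nth_append)

lemma merge_list_at_length: "merge_list C (length xs) (xs @ l # k # zs) = xs @ cmp C l k # zs"
  by (simp add: merge_list_def nth_append)

lemma merge_list_Cons_Suc: "merge_list C (Suc i) (l # ls) = l # merge_list C i ls"
  by (simp add: merge_list_def)

lemma insert_ide_Cons_Suc: "insert_ide C (Suc i) (l # ls) = l # insert_ide C i ls"
  by (simp add: insert_ide_def)

text \<open>The face composes entries to the right of position p, so the source that determines the
  inserted identity is unaffected. This needs no law of a category.\<close>

lemma merge_list_insert_ide_higher:
  assumes "p < i" "Suc i < length ls"
  shows "merge_list C (Suc i) (insert_ide C p ls) = insert_ide C p (merge_list C i ls)"
proof (rule nth_equalityI)
  show "length (merge_list C (Suc i) (insert_ide C p ls)) = length (insert_ide C p (merge_list C i ls))"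
    using assms by simp
next
  fix k assume "k < length (merge_list C (Suc i) (insert_ide C p ls))"
  then have k: "k < length ls" using assms by simp
  consider "k \<le> p" | "k = Suc p" | "Suc p < k" "k \<le> i" | "k = Suc i" | "Suc i < k" by linarith
  then show "merge_list C (Suc i) (insert_ide C p ls) ! k = insert_ide C p (merge_list C i ls) ! k"
    by cases (use k assms in \<open>cases k; simp add: nth_merge_list nth_insert_ide\<close>)+
qed

context small_category
begin

lemma path_obj: "is_path C A ls \<Longrightarrow> A \<in> obj C"
  by (cases ls) (auto simp: tgt_obj)

text \<open>The definition treats singletons separately to avoid a trailing identity. The right unit
  law gives back a uniform recursion, which replaces the defining equations from here on.\<close>

lemma composite_Cons:
  "is_path C A (l # ls) \<Longrightarrow> composite C (A, l # ls) = cmp C l (composite C (src C l, ls))"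
  by (cases ls) (auto simp: cmp_ide_right)

lemma composite_arr: "is_path C A ls \<Longrightarrow> composite C (A, ls) \<in> arr C"
  and tgt_composite: "is_path C A ls \<Longrightarrow> tgt C (composite C (A, ls)) = A"
proof (induction ls arbitrary: A)
  case Nil
  { case 1 then show ?case by (simp add: ide_arr) }
  { case 2 then show ?case by (simp add: tgt_ide) }
next
  case (Cons l ls)
  { case 1 then show ?case
      using Cons composite_Cons[OF 1] by (auto simp: cmp_arr simp del: composite.simps) }
  { case 2 then show ?case
      using Cons composite_Cons[OF 2] by (auto simp: tgt_cmp simp del: composite.simps) }
qed

lemma src_composite_Cons:
  "is_path C A (l # ls) \<Longrightarrow> src C (composite C (A, l # ls)) = src C (composite C (src C l, ls))"
  using composite_Cons[of A l ls]
  by (simp add: src_cmp composite_arr tgt_composite del: composite.simps)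

lemma path_append1:
  "is_path C A (ls @ [z]) \<longleftrightarrow> is_path C A ls \<and> z \<in> arr C \<and> tgt C z = src C (composite C (A, ls))"
proof (induction ls arbitrary: A)
  case Nil
  have "tgt C z = A \<Longrightarrow> z \<in> arr C \<Longrightarrow> A \<in> obj C"
    using tgt_obj by blast
  then show ?case using src_obj by (auto simp: src_ide)
next
  case (Cons l ls)
  show ?case
  proof (cases "is_path C A (l # ls)")
    case True
    then show ?thesis
      unfolding src_composite_Cons[OF True] append_Cons is_path.simps(2) Cons.IH by blast
  next
    case False
    then show ?thesis
      unfolding append_Cons is_path.simps(2) Cons.IH by blast
  qed
qed

text \<open>Chains recurse from the left, but the last face and the right half of the action work at
  the other end; associativity moves the splitting point there.\<close>

lemma composite_append1:
  "is_path C A (ls @ [z]) \<Longrightarrow> composite C (A, ls @ [z]) = cmp C (composite C (A, ls)) z"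
proof (induction ls arbitrary: A)
  case Nil
  then show ?case using cmp_ide_left[of z] by auto
next
  case (Cons l ls)
  then have p: "is_path C A (l # (ls @ [z]))" "is_path C (src C l) ls" "l \<in> arr C" "z \<in> arr C"
    "tgt C z = src C (composite C (src C l, ls))" "is_path C A (l # ls)"
    using path_append1[of A "l # ls" z] path_append1[of "src C l" ls z] by auto
  have "composite C (A, l # (ls @ [z])) = cmp C l (composite C (src C l, ls @ [z]))"
    by (rule composite_Cons[OF p(1)])
  also have "composite C (src C l, ls @ [z]) = cmp C (composite C (src C l, ls)) z"
    using p by (intro Cons.IH) auto
  also have "cmp C l \<dots> = cmp C (cmp C l (composite C (src C l, ls))) z"
    by (rule cmp_assoc[symmetric]) (use p in \<open>simp_all add: composite_arr tgt_composite\<close>)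
  also have "cmp C l (composite C (src C l, ls)) = composite C (A, l # ls)"
    by (rule composite_Cons[OF p(6), symmetric])
  finally show ?case by simp
qed

lemma path_nth_arr: "is_path C A ls \<Longrightarrow> i < length ls \<Longrightarrow> ls ! i \<in> arr C"
proof (induction ls arbitrary: A i)
  case Nil
  then show ?case by simp
next
  case (Cons l ls)
  from Cons.prems have "l \<in> arr C" "is_path C (src C l) ls" by simp_all
  with Cons show ?case by (cases i) auto
qed

lemma path_nth_src_tgt:
  "is_path C A ls \<Longrightarrow> Suc i < length ls \<Longrightarrow> src C (ls ! i) = tgt C (ls ! Suc i)"
proof (induction ls arbitrary: A i)
  case Nil
  then show ?case by simp
next
  case (Cons l ls)
  from Cons.prems have p: "is_path C (src C l) ls" by simp
  show ?case
  proof (cases i)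
    case 0
    then show ?thesis using p Cons.prems by (cases ls) auto
  next
    case (Suc k)
    then show ?thesis using Cons.IH[OF p, of k] Cons.prems by simp
  qed
qed

text \<open>Preservation of the composite, by associativity at the merged entries, is what makes
  \<partial> an endomap of each component over a fixed \<mu>, lowering only the degree.\<close>

lemma merge_list_path:
  assumes "is_path C A ls" "Suc i < length ls"
  shows "is_path C A (merge_list C i ls) \<and> composite C (A, merge_list C i ls) = composite C (A, ls)"
  using assms
proof (induction i arbitrary: A ls)
  case 0
  then obtain x y zs where ls: "ls = x # y # zs"
    by (cases ls; cases "tl ls") auto
  have 1: "is_path C A (cmp C x y # zs)" using 0 by (auto simp: ls cmp_arr src_cmp tgt_cmp)
  have 2: "is_path C A (x # y # zs)" "is_path C (src C x) (y # zs)" using 0 ls by auto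
  have 3: "merge_list C 0 ls = cmp C x y # zs" by (simp add: ls merge_list_def)
  show ?case
    using 1 2 composite_Cons[OF 1] composite_Cons[OF 2(1)] composite_Cons[OF 2(2)]
    unfolding 3 unfolding ls
    by (simp add: cmp_assoc composite_arr tgt_composite src_cmp del: composite.simps)
next
  case (Suc i)
  then obtain l ks where ls: "ls = l # ks" by (cases ls) auto
  have p: "is_path C A (l # ks)" "is_path C (src C l) ks" "Suc i < length ks"
    using Suc.prems by (auto simp: ls)
  have q: "is_path C A (l # merge_list C i ks)" using Suc.IH[OF p(2,3)] p by simp
  show ?case
    using q p Suc.IH[OF p(2,3)] composite_Cons[OF p(1)] composite_Cons[OF q]
    by (simp add: ls merge_list_Cons_Suc del: composite.simps)
qed

lemma insert_ide_path:
  assumes "is_path C A ls" "p < length ls"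
  shows "is_path C A (insert_ide C p ls) \<and> composite C (A, insert_ide C p ls) = composite C (A, ls)"
  using assms
proof (induction p arbitrary: A ls)
  case 0
  then obtain x zs where ls: "ls = x # zs"
    by (cases ls) auto
  have 1: "is_path C A (x # zs)" and z: "is_path C (src C x) zs" and o: "src C x \<in> obj C"
    using 0 by (auto simp: ls src_obj)
  have 2: "is_path C (src C x) (ide C (src C x) # zs)"
    and 3: "is_path C A (x # ide C (src C x) # zs)"
    using 1 o by (auto simp: ide_arr src_ide tgt_ide)
  have i: "insert_ide C 0 ls = x # ide C (src C x) # zs" by (simp add: ls insert_ide_def)
  show ?case
    using 1 3 composite_Cons[OF 1] composite_Cons[OF 2] composite_Cons[OF 3] o
      cmp_ide_left[OF composite_arr[OF z]]
    unfolding i unfolding ls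
    by (simp add: src_ide tgt_composite[OF z] del: composite.simps)
next
  case (Suc i)
  then obtain l ks where ls: "ls = l # ks" by (cases ls) auto
  have p: "is_path C A (l # ks)" "is_path C (src C l) ks" "i < length ks"
    using Suc.prems by (auto simp: ls)
  have q: "is_path C A (l # insert_ide C i ks)" using Suc.IH[OF p(2,3)] p by simp
  show ?case
    using q p Suc.IH[OF p(2,3)] composite_Cons[OF p(1)] composite_Cons[OF q]
    by (simp add: ls insert_ide_Cons_Suc del: composite.simps)
qed

text \<open>For j < i the two compositions involve disjoint pairs of entries. Only for i = j, where
  three consecutive entries are composed, is associativity used.\<close>

lemma merge_list_merge_list:
  assumes "is_path C A ls" "j \<le> i" "Suc (Suc i) < length ls"
  shows "merge_list C i (merge_list C j ls) = merge_list C j (merge_list C (Suc i) ls)"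
proof (rule nth_equalityI)
  show "length (merge_list C i (merge_list C j ls)) = length (merge_list C j (merge_list C (Suc i) ls))"
    using assms by simp
next
  have facts: "ls ! j \<in> arr C" "ls ! Suc j \<in> arr C" "ls ! Suc (Suc j) \<in> arr C"
    "src C (ls ! j) = tgt C (ls ! Suc j)" "src C (ls ! Suc j) = tgt C (ls ! Suc (Suc j))"
    using assms path_nth_arr[OF assms(1)] path_nth_src_tgt[OF assms(1)] by auto
  fix k assume "k < length (merge_list C i (merge_list C j ls))"
  then have k: "k < length ls - 2" using assms by simp
  consider "k < j" | "k = j" "j < i" | "k = j" "j = i" | "j < k" "k < i" | "j < k" "k = i" | "i < k"
    using assms(2) by linarith
  then show "merge_list C i (merge_list C j ls) ! k = merge_list C j (merge_list C (Suc i) ls) ! k"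
    by cases (use k facts assms(2,3) in \<open>simp_all add: nth_merge_list cmp_assoc\<close>)
qed

lemma merge_list_insert_ide_same:
  assumes "is_path C A ls" "p < length ls"
  shows "merge_list C p (insert_ide C p ls) = ls"
proof (rule nth_equalityI)
  show "length (merge_list C p (insert_ide C p ls)) = length ls"
    using assms by simp
next
  fix k assume "k < length (merge_list C p (insert_ide C p ls))"
  then have k: "k < length ls" using assms by simp
  consider "k < p" | "k = p" | "p < k" by linarith
  then show "merge_list C p (insert_ide C p ls) ! k = ls ! k"
    by cases (use k assms path_nth_arr[OF assms] in \<open>simp_all add: nth_merge_list nth_insert_ide cmp_ide_right\<close>)
qed

lemma merge_list_Suc_insert_ide:
  assumes "is_path C A ls" "Suc p < length ls"
  shows "merge_list C (Suc p) (insert_ide C p ls) = ls"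
proof (rule nth_equalityI)
  show "length (merge_list C (Suc p) (insert_ide C p ls)) = length ls"
    using assms by simp
next
  fix k assume "k < length (merge_list C (Suc p) (insert_ide C p ls))"
  then have k: "k < length ls" using assms by simp
  consider "k \<le> p" | "k = Suc p" | "Suc p < k" by linarith
  then show "merge_list C (Suc p) (insert_ide C p ls) ! k = ls ! k"
    by cases (use k assms(2) path_nth_arr[OF assms] path_nth_src_tgt[OF assms]
      in \<open>simp_all add: nth_merge_list nth_insert_ide cmp_ide_left\<close>)
qed

text \<open>Face p absorbs the identity at position p + 1 into entry p, whose source is the object
  of that identity; the insertion then restores it. This is the term of \<sigma>\<partial> that
  reproduces the chain in the homotopy.\<close>

lemma insert_ide_merge_list_same:
  assumes "is_path C A ls" "Suc p < length ls" "ls ! Suc p \<in> ide C ` obj C"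
  shows "insert_ide C p (merge_list C p ls) = ls"
proof (rule nth_equalityI)
  show "length (insert_ide C p (merge_list C p ls)) = length ls"
    using assms by simp
next
  obtain B where B: "B \<in> obj C" "ls ! Suc p = ide C B" using assms by auto
  have "ls ! p \<in> arr C" "src C (ls ! p) = B"
    using assms path_nth_arr[OF assms(1)] path_nth_src_tgt[OF assms(1,2)] B by (auto simp: tgt_ide)
  then have facts: "cmp C (ls ! p) (ls ! Suc p) = ls ! p" "ide C (src C (ls ! p)) = ls ! Suc p"
    using cmp_ide_right[of "ls ! p"] B by auto
  fix k assume "k < length (insert_ide C p (merge_list C p ls))"
  then have k: "k < length ls" using assms by simp
  consider "k < p" | "k = p" | "k = Suc p" | d where "k = Suc (Suc (p + d))"
    using less_imp_Suc_add[of "Suc p" k] by fastforce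
  then show "insert_ide C p (merge_list C p ls) ! k = ls ! k"
    by cases (use k assms(2) facts in \<open>simp_all add: nth_merge_list nth_insert_ide\<close>)
qed

text \<open>An interior identity can be absorbed by its left or by its right neighbour, with the
  same result. The two faces occur in \<partial> with opposite signs and cancel.\<close>

lemma merge_list_around_ide:
  assumes "is_path C A ls" "Suc (Suc j) < length ls" "ls ! Suc j \<in> ide C ` obj C"
  shows "merge_list C j ls = merge_list C (Suc j) ls"
proof (rule nth_equalityI)
  show "length (merge_list C j ls) = length (merge_list C (Suc j) ls)"
    using assms by simp
next
  obtain B where B: "B \<in> obj C" "ls ! Suc j = ide C B" using assms by auto
  have "ls ! j \<in> arr C" "src C (ls ! j) = B" "ls ! Suc (Suc j) \<in> arr C" "tgt C (ls ! Suc (Suc j)) = B"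
    using assms path_nth_arr[OF assms(1)] path_nth_src_tgt[OF assms(1), of j] path_nth_src_tgt[OF assms(1,2)] B
    by (auto simp: tgt_ide src_ide)
  then have facts: "cmp C (ls ! j) (ls ! Suc j) = ls ! j"
    "cmp C (ls ! Suc j) (ls ! Suc (Suc j)) = ls ! Suc (Suc j)"
    using cmp_ide_right[of "ls ! j"] cmp_ide_left[of "ls ! Suc (Suc j)"] B by auto
  fix k assume "k < length (merge_list C j ls)"
  then have k: "k < length ls - 1" using assms by simp
  consider "k < j" | "k = j" | "k = Suc j" | "Suc j < k" by linarith
  then show "merge_list C j ls ! k = merge_list C (Suc j) ls ! k"
    by cases (use k assms(2) facts in \<open>simp_all add: nth_merge_list\<close>)
qed

text \<open>A list of length at least 3 still has two separate outer entries after a face. Inner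
  faces do not meet the action, and a face at either end commutes with it by associativity.\<close>

lemma act_list_merge_list:
  assumes "is_path C A ls" "Suc i < length ls" "3 \<le> length ls"
    "a \<in> arr C" "src C a = A" "b \<in> arr C" "tgt C b = src C (last ls)"
  shows "merge_list C i (act_list C a b ls) = act_list C a b (merge_list C i ls)"
proof (rule nth_equalityI)
  show "length (merge_list C i (act_list C a b ls)) = length (act_list C a b (merge_list C i ls))"
    using assms by simp
next
  have "A = tgt C (ls ! 0)" using assms by (cases ls) auto
  moreover have "ls ! i \<in> arr C" "ls ! Suc i \<in> arr C" "src C (ls ! i) = tgt C (ls ! Suc i)"
    using assms path_nth_arr[OF assms(1)] path_nth_src_tgt[OF assms(1)] by auto
  moreover have "last ls = ls ! (length ls - 1)" using assms by (intro last_conv_nth) auto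
  ultimately have facts: "A = tgt C (ls ! 0)" "ls ! i \<in> arr C" "ls ! Suc i \<in> arr C"
      "src C (ls ! i) = tgt C (ls ! Suc i)" "last ls = ls ! (length ls - 1)"
    by blast+
  obtain N where N: "length ls = Suc (Suc (Suc N))"
    using assms(3) that[of "length ls - 3"] by simp
  fix k assume "k < length (merge_list C i (act_list C a b ls))"
  then have k: "k < Suc (Suc N)" using assms N by simp
  have i: "i < Suc (Suc N)" using assms N by simp
  then consider "k < i" | "k = i" "i = 0" | "k = i" "0 < i" "i < Suc N" | "k = i" "i = Suc N" | "i < k"
    by linarith
  then show "merge_list C i (act_list C a b ls) ! k = act_list C a b (merge_list C i ls) ! k"
    by cases (use k i facts assms(4-7) N in \<open>simp_all add: nth_merge_list nth_act_list cmp_assoc\<close>)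
qed

text \<open>The bound on p keeps the new identity in front of the last entry, so the outer entries
  stay outer. For p = 0 the inserted object is the source of the first entry, which composition with
  a on the left preserves.\<close>

lemma act_list_insert_ide:
  assumes "is_path C A ls" "Suc p < length ls" "a \<in> arr C" "src C a = A"
  shows "insert_ide C p (act_list C a b ls) = act_list C a b (insert_ide C p ls)"
proof (rule nth_equalityI)
  show "length (insert_ide C p (act_list C a b ls)) = length (act_list C a b (insert_ide C p ls))"
    using assms by simp
next
  have "A = tgt C (ls ! 0)" using assms by (cases ls) auto
  moreover have "ls ! 0 \<in> arr C"
    using assms(2) by (intro path_nth_arr[OF assms(1)]) auto
  ultimately have facts: "src C (cmp C a (ls ! 0)) = src C (ls ! 0)"
    using assms by (simp add: src_cmp)
  obtain N where N: "length ls = Suc (Suc N)"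
    using assms(2) that[of "length ls - 2"] by simp
  fix k assume "k < length (insert_ide C p (act_list C a b ls))"
  then have k: "k < Suc (Suc (Suc N))" using assms(2) N by simp
  have "p < Suc N" using assms N by simp
  then consider "k = 0" | "0 < k" "k \<le> p" | "k = Suc p" "p = 0" | "k = Suc p" "0 < p"
    | d where "k = Suc (Suc (p + d))" "k < Suc (Suc N)" | "Suc p < k" "k = Suc (Suc N)"
    using k less_imp_Suc_add[of "Suc p" k] by fastforce
  then show "insert_ide C p (act_list C a b ls) ! k = act_list C a b (insert_ide C p ls) ! k"
    by cases (use facts N \<open>p < Suc N\<close> in \<open>simp_all add: nth_insert_ide nth_act_list\<close>)
qed

end

section \<open>The functors \<open>P\<^sub>n\<close>\<close>

definition P_chains :: "('o, 'm) cat \<Rightarrow> nat \<Rightarrow> 'm \<Rightarrow> ('o, 'm) chain set"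
  where "P_chains C n m = {s \<in> nchains C (n + 2). composite C s = m}"

text \<open>The universal element of the summand of \<open>P\<^sub>n\<close> indexed by s, at which
  \<open>yoneda\<close> evaluates. The object stored in the chain makes it meaningful for the empty
  list, too.\<close>

definition pad_ide :: "('o, 'm) cat \<Rightarrow> ('o, 'm) chain \<Rightarrow> ('o, 'm) chain"
  where "pad_ide C s = (fst s, ide C (fst s) # snd s @ [ide C (src C (composite C s))])"

definition boundary :: "('o, 'm) cat \<Rightarrow> nat \<Rightarrow> ('o, 'm) chain \<Rightarrow> ('o, 'm) chain \<Rightarrow>\<^sub>0 int"
  where "boundary C n s = (\<Sum>i = 0..n. frag_cmul ((-1) ^ i) (frag_of (merge C i s)))"

lemma P_grp_eq: "P_grp C n m = free_Abelian_group (P_chains C n m)"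
  by (simp add: P_grp_def P_chains_def)

lemma P_d_eq: "P_d C n = frag_extend (boundary C n)"
  by (simp add: P_d_def boundary_def[abs_def])

lemma P_act_of: "P_act C (l, a, b, m) (frag_of (A, ls)) = frag_of (tgt C a, act_list C a b ls)"
  by (simp add: P_act_def act_list_def)

lemma P_act_extend: "P_act C g = frag_extend (\<lambda>s. P_act C g (frag_of s))"
  by (cases g) (simp add: P_act_def case_prod_unfold)

lemma P_act_cmul: "P_act C g (frag_cmul k x) = frag_cmul k (P_act C g x)"
  by (cases g) (simp add: P_act_def frag_extend_cmul)

lemma P_act_sum: "finite I \<Longrightarrow> P_act C g (\<Sum>i\<in>I. x i) = (\<Sum>i\<in>I. P_act C g (x i))"
  by (cases g) (simp add: P_act_def frag_extend_sum o_def)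

lemma arr_FC: "(l, a, b, m) \<in> arr (FC C) \<longleftrightarrow> l \<in> arr C \<and> a \<in> arr C \<and> b \<in> arr C \<and> m \<in> arr C \<and>
    src C a = tgt C l \<and> tgt C a = tgt C m \<and> tgt C b = src C l \<and> src C b = src C m \<and>
    m = cmp C (cmp C a l) b"
  by (simp add: FC_def)

lemma boundary_act_list:
  assumes "\<And>i. i \<le> N \<Longrightarrow> merge_list C i (act_list C a b ls) = act_list C a b (merge_list C i ls)"
  shows "boundary C N (tgt C a, act_list C a b ls) = P_act C (l, a, b, m) (boundary C N (A, ls))"
  using assms by (simp add: boundary_def P_act_cmul P_act_sum P_act_of merge_eq)

lemma P_d_boundary_eq:
  "P_d C N (boundary C M (A, ls)) =
    (\<Sum>j=0..M. \<Sum>i=0..N. frag_cmul ((-1) ^ (i + j)) (frag_of (A, merge_list C i (merge_list C j ls))))"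
  by (simp add: P_d_eq boundary_def frag_extend_sum frag_extend_cmul o_def merge_eq frag_cmul_sum
      power_add mult.commute)

lemma FC_simps: "src (FC C) (l, a, b, m) = l" "tgt (FC C) (l, a, b, m) = m" "obj (FC C) = arr C"
    "ide (FC C) l = (l, ide C (tgt C l), ide C (src C l), l)"
    "cmp (FC C) (m, a', b', n) (l, a, b, m) = (l, cmp C a' a, cmp C b b', n)"
  by (simp_all add: FC_def)

context small_category
begin

lemma P_chains_iff:
  "(A, ls) \<in> P_chains C n m \<longleftrightarrow> length ls = n + 2 \<and> is_path C A ls \<and> composite C (A, ls) = m"
  by (auto simp: P_chains_def nchains_def)

lemma nchains_iff: "(A, ls) \<in> nchains C n \<longleftrightarrow> length ls = n \<and> is_path C A ls"
  by (auto simp: nchains_def)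

lemma composite_nchains: "s \<in> nchains C n \<Longrightarrow> composite C s \<in> arr C"
  by (auto simp: nchains_def composite_arr)

lemma P_chains_arr: "s \<in> P_chains C n m \<Longrightarrow> m \<in> arr C"
  by (auto simp: P_chains_def nchains_def composite_arr)

lemma path_outer:
  "is_path C A (x # ys @ [z]) \<longleftrightarrow> x \<in> arr C \<and> tgt C x = A \<and> is_path C (src C x) ys \<and>
     z \<in> arr C \<and> tgt C z = src C (composite C (src C x, ys))"
  using path_append1[of "src C x" ys z] by auto

lemma composite_outer:
  assumes "is_path C A (x # ys @ [z])"
  shows "composite C (A, x # ys @ [z]) = cmp C (cmp C x (composite C (src C x, ys))) z"
proof -
  have p: "x \<in> arr C" "is_path C (src C x) ys" "z \<in> arr C" "tgt C z = src C (composite C (src C x, ys))"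
    "is_path C (src C x) (ys @ [z])"
    using assms path_outer by auto
  have "composite C (A, x # ys @ [z]) = cmp C x (composite C (src C x, ys @ [z]))"
    by (rule composite_Cons[OF assms])
  also have "\<dots> = cmp C x (cmp C (composite C (src C x, ys)) z)"
    by (simp only: composite_append1[OF p(5)])
  also have "\<dots> = cmp C (cmp C x (composite C (src C x, ys))) z"
    by (rule cmp_assoc[symmetric]) (use p in \<open>simp_all add: composite_arr tgt_composite\<close>)
  finally show ?thesis .
qed

lemma P_chainsE:
  assumes "s \<in> P_chains C n m"
  obtains x ys z where "s = (tgt C x, x # ys @ [z])" "length ys = n" "x \<in> arr C" "z \<in> arr C"
    "is_path C (src C x) ys" "tgt C z = src C (composite C (src C x, ys))"
    "m = cmp C (cmp C x (composite C (src C x, ys))) z"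
    "is_path C (tgt C x) (x # ys @ [z])"
proof -
  obtain A ls where s: "s = (A, ls)" by (cases s)
  then have ls: "length ls = n + 2" "is_path C A ls" "composite C (A, ls) = m"
    using assms P_chains_iff by auto
  define x ys z where "x = hd ls" and "ys = butlast (tl ls)" and "z = last ls"
  have "ls = x # tl ls" "tl ls \<noteq> []" using ls by (cases ls; auto simp: x_def)+
  then have eq: "ls = x # ys @ [z]"
    unfolding ys_def z_def using append_butlast_last_id[of "tl ls"] last_tl[of ls] by simp
  have path: "is_path C A (x # ys @ [z])" using ls eq by simp
  then have A: "A = tgt C x" by simp
  have "m = cmp C (cmp C x (composite C (src C x, ys))) z"
    using ls(3) composite_outer[OF path] eq by simp
  then show ?thesis
    using path[unfolded path_outer] path ls(1) eq s by (intro that[of x ys z]) (simp_all add: A)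
qed

lemma P_chainsI:
  assumes "length ys = n" "x \<in> arr C" "z \<in> arr C"
    "is_path C (src C x) ys" "tgt C z = src C (composite C (src C x, ys))"
  shows "(tgt C x, x # ys @ [z]) \<in> P_chains C n (cmp C (cmp C x (composite C (src C x, ys))) z)"
proof -
  have "is_path C (tgt C x) (x # ys @ [z])" using assms path_outer by blast
  then show ?thesis unfolding P_chains_iff using assms(1) composite_outer by simp
qed

lemma middle_outer: "middle C (A, x # ys @ [z]) = (src C x, ys)"
  by (simp add: middle_def)

lemma outer_arr_FC:
  assumes "is_path C (src C x) ys" "x \<in> arr C" "z \<in> arr C" "tgt C z = src C (composite C (src C x, ys))"
  shows "(composite C (src C x, ys), x, z, cmp C (cmp C x (composite C (src C x, ys))) z) \<in> arr (FC C)"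
  using assms by (simp add: arr_FC composite_arr tgt_composite cmp_arr src_cmp tgt_cmp)

lemma pad_ide_P_chains:
  assumes "s \<in> nchains C n"
  shows "pad_ide C s \<in> P_chains C n (composite C s)"
proof -
  obtain A ls where s: "s = (A, ls)" by (cases s)
  let ?m = "composite C (A, ls)"
  have p: "is_path C A ls" "length ls = n" using assms by (simp_all add: s nchains_iff)
  have A: "A \<in> obj C" "?m \<in> arr C" "tgt C ?m = A" using p path_obj composite_arr tgt_composite by auto
  have "(tgt C (ide C A), ide C A # ls @ [ide C (src C ?m)])
      \<in> P_chains C n (cmp C (cmp C (ide C A) (composite C (src C (ide C A), ls))) (ide C (src C ?m)))"
    using p A by (intro P_chainsI) (simp_all add: ide_arr src_ide tgt_ide src_obj)
  then show ?thesis
    using p A cmp_ide_left[of ?m] cmp_ide_right[of ?m] by (simp add: pad_ide_def s src_ide tgt_ide)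
qed

lemma middle_pad_ide:
  assumes "s \<in> nchains C n"
  shows "middle C (pad_ide C s) = s"
proof -
  obtain A ls where s: "s = (A, ls)" by (cases s)
  have "A \<in> obj C" using assms path_obj by (auto simp: s nchains_iff)
  then show ?thesis by (simp add: pad_ide_def s middle_outer src_ide)
qed

lemma middle_nchains:
  assumes "s \<in> P_chains C n m"
  shows "middle C s \<in> nchains C n"
  using assms by (elim P_chainsE) (simp add: middle_outer nchains_iff)

text \<open>The two outer entries of a basis element of \<open>P\<^sub>n\<close> over m form an
  arrow from the composite of its middle to m, and D can be applied to it. This arrow is the Hom
  part of the summand.\<close>

lemma P_chain_arr_FC:
  assumes "s \<in> P_chains C n m"
  shows "(composite C (middle C s), hd (snd s), last (snd s), m) \<in> arr (FC C)"
  using assms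
proof (rule P_chainsE)
  fix x ys z
  assume "s = (tgt C x, x # ys @ [z])" "x \<in> arr C" "z \<in> arr C"
    "is_path C (src C x) ys" "tgt C z = src C (composite C (src C x, ys))"
    "m = cmp C (cmp C x (composite C (src C x, ys))) z"
  then show ?thesis using outer_arr_FC[of x ys z] by (simp add: middle_outer)
qed

text \<open>Acting on a padded chain replaces its outer identities by the given arrows, by the unit
  laws. So the padded chains generate everything under the action, which is the content of the
  Yoneda lemma here.\<close>

lemma P_act_pad_ide_middle:
  assumes "s \<in> P_chains C n m"
  shows "P_act C (composite C (middle C s), hd (snd s), last (snd s), m) (frag_of (pad_ide C (middle C s)))
    = frag_of s"
  using assms
proof (rule P_chainsE)
  fix x ys z
  assume *: "s = (tgt C x, x # ys @ [z])" "x \<in> arr C" "z \<in> arr C"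
    "is_path C (src C x) ys" "tgt C z = src C (composite C (src C x, ys))"
  show ?thesis
    using * cmp_ide_right[of x] cmp_ide_left[of z]
    by (simp add: middle_outer pad_ide_def P_act_of act_list_def)
qed

text \<open>The action changes only the outer entries. It therefore respects the decomposition into
  summands indexed by the middle, and in particular the degenerate part.\<close>

lemma act_list_P_chains:
  assumes "(l, a, b, m) \<in> arr (FC C)" "(A, ls) \<in> P_chains C n l"
  shows "(tgt C a, act_list C a b ls) \<in> P_chains C n m"
    and "middle C (tgt C a, act_list C a b ls) = middle C (A, ls)"
proof -
  obtain x ys z where *: "(A, ls) = (tgt C x, x # ys @ [z])" "length ys = n" "x \<in> arr C" "z \<in> arr C"
    "is_path C (src C x) ys" "tgt C z = src C (composite C (src C x, ys))"
    "l = cmp C (cmp C x (composite C (src C x, ys))) z"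
    by (rule P_chainsE[OF assms(2)])
  let ?c = "composite C (src C x, ys)"
  have c: "?c \<in> arr C" "tgt C ?c = src C x" using * composite_arr tgt_composite by auto
  have ax: "a \<in> arr C" "b \<in> arr C" "src C a = tgt C x" "tgt C b = src C z"
    using assms(1) * c by (simp_all add: arr_FC tgt_cmp src_cmp cmp_arr)
  have act_list: "act_list C a b ls = cmp C a x # ys @ [cmp C z b]" using * by (simp add: act_list_def)
  have "(tgt C (cmp C a x), cmp C a x # ys @ [cmp C z b]) \<in> P_chains C n
    (cmp C (cmp C (cmp C a x) (composite C (src C (cmp C a x), ys))) (cmp C z b))"
    using * ax by (intro P_chainsI) (simp_all add: cmp_arr src_cmp tgt_cmp)
  moreover have "cmp C (cmp C (cmp C a x) ?c) (cmp C z b) = m"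
    using assms(1) * c ax by (simp add: arr_FC cmp_assoc cmp_arr src_cmp tgt_cmp)
  ultimately show "(tgt C a, act_list C a b ls) \<in> P_chains C n m"
    unfolding act_list using * ax by (simp add: tgt_cmp src_cmp)
  show "middle C (tgt C a, act_list C a b ls) = middle C (A, ls)"
    unfolding act_list using * ax by (simp add: middle_outer src_cmp)
qed

lemma P_act_hom:
  assumes "(l, a, b, m) \<in> arr (FC C)"
  shows "P_act C (l, a, b, m) \<in> hom (P_grp C n l) (P_grp C n m)"
  unfolding P_grp_eq using act_list_P_chains(1)[OF assms(1)]
  by (subst P_act_extend, intro frag_extend_hom) (auto simp: P_act_of)

lemma merge_P_chains:
  assumes "s \<in> P_chains C (Suc n) m" "i \<le> Suc n"
  shows "merge C i s \<in> P_chains C n m"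
proof -
  obtain A ls where s: "s = (A, ls)" by (cases s)
  show ?thesis
    using assms merge_list_path[of A ls i] by (auto simp: s merge_eq P_chains_iff)
qed

lemma boundary_P_chains:
  assumes "s \<in> P_chains C (Suc n) m"
  shows "Poly_Mapping.keys (boundary C (Suc n) s) \<subseteq> P_chains C n m"
proof -
  have "boundary C (Suc n) s \<in> carrier (free_Abelian_group (P_chains C n m))"
    unfolding boundary_def
    using merge_P_chains[OF assms] by (intro sum_closed_free_Abelian_group) auto
  then show ?thesis by simp
qed

lemma P_d_hom: "P_d C (Suc n) \<in> hom (P_grp C (Suc n) m) (P_grp C n m)"
  unfolding P_d_eq P_grp_eq by (intro frag_extend_hom boundary_P_chains)

lemma P_d_natural:
  assumes "(l, a, b, m) \<in> arr (FC C)" "s \<in> P_chains C (Suc n) l"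
  shows "P_d C (Suc n) (P_act C (l, a, b, m) (frag_of s)) = P_act C (l, a, b, m) (boundary C (Suc n) s)"
proof -
  obtain A ls where s: "s = (A, ls)" by (cases s)
  have p: "is_path C A ls" "length ls = n + 3" "composite C (A, ls) = l"
    using assms(2) by (simp_all add: s P_chains_iff)
  obtain x ys z where *: "(A, ls) = (tgt C x, x # ys @ [z])" "x \<in> arr C" "z \<in> arr C"
    "is_path C (src C x) ys" "tgt C z = src C (composite C (src C x, ys))"
    "l = cmp C (cmp C x (composite C (src C x, ys))) z"
    by (rule P_chainsE[OF assms(2)[unfolded s]])
  let ?c = "composite C (src C x, ys)"
  have c: "?c \<in> arr C" "tgt C ?c = src C x" using * composite_arr tgt_composite by auto
  have ab: "a \<in> arr C" "src C a = A" "b \<in> arr C" "tgt C b = src C (last ls)"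
    using assms(1) * c by (simp_all add: arr_FC tgt_cmp src_cmp cmp_arr)
  have "merge_list C i (act_list C a b ls) = act_list C a b (merge_list C i ls)" if "i \<le> Suc n" for i
    using p ab that by (intro act_list_merge_list[where A = A]) simp_all
  then have "boundary C (Suc n) (tgt C a, act_list C a b ls) = P_act C (l, a, b, m) (boundary C (Suc n) (A, ls))"
    by (rule boundary_act_list)
  then show ?thesis
    by (simp add: s P_act_of P_d_eq)
qed

lemma P_d_boundary:
  assumes "s \<in> P_chains C (Suc (Suc n)) m"
  shows "P_d C (Suc n) (boundary C (Suc (Suc n)) s) = 0"
proof -
  obtain A ls where s: "s = (A, ls)" by (cases s)
  have p: "is_path C A ls" "length ls = n + 4"
    using assms by (simp_all add: s P_chains_iff)
  show ?thesis
    unfolding s P_d_boundary_eq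
    using p merge_list_merge_list[OF p(1)] by (intro simplicial_alternating_sum) simp
qed

end

section \<open>The Yoneda extension of a cochain\<close>

text \<open>The natural transformation \<open>P\<^sub>n \<rightarrow> D\<close> that corresponds to the cochain \<open>f\<close> under the Yoneda
  lemma; the choice is arbitrary unless \<open>f\<close> is a cochain.\<close>

definition cochain_ext :: "('o, 'm) cat \<Rightarrow> ('m, 'a) nat_system \<Rightarrow> nat \<Rightarrow> (('o, 'm) chain \<Rightarrow> 'a)
    \<Rightarrow> 'm \<Rightarrow> (('o, 'm) chain \<Rightarrow>\<^sub>0 int) \<Rightarrow> 'a"
  where "cochain_ext C D n f m = (SOME h. h \<in> hom (P_grp C n m) (on_obj D m) \<and>
    (\<forall>s \<in> P_chains C n m. h (frag_of s) =
      on_arr D (composite C (middle C s), hd (snd s), last (snd s), m) (f (middle C s))))"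

text \<open>For \<open>\<phi>\<close> the restriction to basis elements of a natural transformation \<open>P\<^sub>k \<rightarrow> P\<^sub>n\<close>, this is the map
  from \<open>n\<close>-cochains to \<open>k\<close>-cochains given by precomposition.\<close>

definition pullback :: "('o, 'm) cat \<Rightarrow> ('m, 'a) nat_system \<Rightarrow> nat \<Rightarrow> nat
    \<Rightarrow> (('o, 'm) chain \<Rightarrow> ('o, 'm) chain \<Rightarrow>\<^sub>0 int) \<Rightarrow> (('o, 'm) chain \<Rightarrow> 'a) \<Rightarrow> ('o, 'm) chain \<Rightarrow> 'a"
  where "pullback C D k n \<phi> f = (\<lambda>s \<in> nchains C k. cochain_ext C D n f (composite C s) (\<phi> (pad_ide C s)))"

text \<open>Natural transformations between the functors \<open>P\<^sub>k\<close> and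
  \<open>P\<^sub>n\<close>, recorded on basis elements: the first clause respects the components,
  the second one the action of arrows. The boundary and the insertion of an identity are the
  instances of interest.\<close>

definition natural_op :: "('o, 'm) cat \<Rightarrow> nat \<Rightarrow> nat \<Rightarrow> (('o, 'm) chain \<Rightarrow> ('o, 'm) chain \<Rightarrow>\<^sub>0 int) \<Rightarrow> bool"
  where "natural_op C k n \<phi> \<longleftrightarrow>
    (\<forall>m. \<forall>s \<in> P_chains C k m. Poly_Mapping.keys (\<phi> s) \<subseteq> P_chains C n m) \<and>
    (\<forall>l a b m. \<forall>s \<in> P_chains C k l. (l, a, b, m) \<in> arr (FC C) \<longrightarrow>
      frag_extend \<phi> (P_act C (l, a, b, m) (frag_of s)) = P_act C (l, a, b, m) (\<phi> s))"

lemma (in small_category) natural_op_boundary: "natural_op C (Suc n) n (boundary C (Suc n))"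
  using boundary_P_chains P_d_natural by (simp add: natural_op_def P_d_eq)

locale natural_coefficients = small_category C + D: ab_functor "FC C" D
  for C :: "('o, 'm) cat" and D :: "('m, 'a) nat_system"
begin

lemma D_comm_group: "m \<in> arr C \<Longrightarrow> comm_group (on_obj D m)"
  using D.ab[of m] by (simp add: FC_simps)

lemma D_group: "m \<in> arr C \<Longrightarrow> group (on_obj D m)"
  using D_comm_group comm_group.axioms by blast

lemma D_hom: "(l, a, b, m) \<in> arr (FC C) \<Longrightarrow> on_arr D (l, a, b, m) \<in> hom (on_obj D l) (on_obj D m)"
  using D.hom[of "(l, a, b, m)"] by (simp add: FC_simps)

lemma D_closed: "(l, a, b, m) \<in> arr (FC C) \<Longrightarrow> x \<in> carrier (on_obj D l) \<Longrightarrow>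
    on_arr D (l, a, b, m) x \<in> carrier (on_obj D m)"
  by (rule hom_in_carrier[OF D_hom])

lemma D_ide: "l \<in> arr C \<Longrightarrow> x \<in> carrier (on_obj D l) \<Longrightarrow>
    on_arr D (l, ide C (tgt C l), ide C (src C l), l) x = x"
  using D.map_ide[of l x] by (simp add: FC_simps)

lemma D_cmp:
  assumes "(l, a, b, m) \<in> arr (FC C)" "(m, a', b', n) \<in> arr (FC C)" "x \<in> carrier (on_obj D l)"
  shows "on_arr D (m, a', b', n) (on_arr D (l, a, b, m) x) = on_arr D (l, cmp C a' a, cmp C b b', n) x"
  using D.map_cmp[OF assms(2,1)] assms(3) by (simp add: FC_simps)

lemma BW_D: "f \<in> carrier (BW C D n) \<Longrightarrow> s \<in> nchains C n \<Longrightarrow> f s \<in> carrier (on_obj D (composite C s))"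
  by (auto simp: BW_def PiE_iff)

text \<open>Naturality forces the value on a basis element, because that element comes from the
  padded middle along an arrow. Freeness provides a homomorphism with these values, so the choice
  has a witness.\<close>

lemma cochain_ext_spec:
  assumes f: "f \<in> carrier (BW C D n)" and m: "m \<in> arr C"
  shows "cochain_ext C D n f m \<in> hom (P_grp C n m) (on_obj D m) \<and>
    (\<forall>s \<in> P_chains C n m. cochain_ext C D n f m (frag_of s) =
      on_arr D (composite C (middle C s), hd (snd s), last (snd s), m) (f (middle C s)))"
proof -
  let ?w = "\<lambda>s. on_arr D (composite C (middle C s), hd (snd s), last (snd s), m) (f (middle C s))"
  have w: "?w ` P_chains C n m \<subseteq> carrier (on_obj D m)"
    using D_closed[OF P_chain_arr_FC BW_D[OF f middle_nchains]] by blast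
  obtain h where h: "h \<in> hom (free_Abelian_group (P_chains C n m)) (on_obj D m)"
    "\<And>s. s \<in> P_chains C n m \<Longrightarrow> h (frag_of s) = ?w s"
    by (rule comm_group.free_Abelian_group_universal[OF D_comm_group[OF m] w]) (rule that)
  let ?Q = "\<lambda>h. h \<in> hom (P_grp C n m) (on_obj D m) \<and> (\<forall>s \<in> P_chains C n m. h (frag_of s) = ?w s)"
  have "?Q h" using h by (simp add: P_grp_eq)
  then have "?Q (SOME h. ?Q h)" by (rule someI[where P = "?Q"])
  then show ?thesis unfolding cochain_ext_def .
qed

lemma cochain_ext_hom:
  "f \<in> carrier (BW C D n) \<Longrightarrow> m \<in> arr C \<Longrightarrow>
    cochain_ext C D n f m \<in> hom (free_Abelian_group (P_chains C n m)) (on_obj D m)"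
  using cochain_ext_spec by (simp add: P_grp_eq)

lemma cochain_ext_closed:
  "f \<in> carrier (BW C D n) \<Longrightarrow> m \<in> arr C \<Longrightarrow> Poly_Mapping.keys x \<subseteq> P_chains C n m \<Longrightarrow>
    cochain_ext C D n f m x \<in> carrier (on_obj D m)"
  using hom_in_carrier[OF cochain_ext_hom] by simp

lemma cochain_ext_of:
  "f \<in> carrier (BW C D n) \<Longrightarrow> s \<in> P_chains C n m \<Longrightarrow> cochain_ext C D n f m (frag_of s) =
    on_arr D (composite C (middle C s), hd (snd s), last (snd s), m) (f (middle C s))"
  using cochain_ext_spec P_chains_arr by blast

text \<open>The arrow attached to a padded chain is an identity of the factorization category, on
  which D acts trivially.\<close>

lemma cochain_ext_pad_ide:
  assumes "f \<in> carrier (BW C D n)" "s \<in> nchains C n"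
  shows "cochain_ext C D n f (composite C s) (frag_of (pad_ide C s)) = f s"
proof -
  obtain A ls where s: "s = (A, ls)" by (cases s)
  have "composite C s \<in> arr C" "tgt C (composite C s) = A"
    using assms(2) by (simp_all add: s nchains_iff composite_arr tgt_composite)
  then show ?thesis
    using cochain_ext_of[OF assms(1) pad_ide_P_chains[OF assms(2)]] D_ide[OF _ BW_D[OF assms]]
    by (simp add: middle_pad_ide[OF assms(2)]) (simp add: pad_ide_def s)
qed

lemma cochain_ext_natural:
  assumes f: "f \<in> carrier (BW C D n)" and g: "(l, a, b, m) \<in> arr (FC C)"
    and x: "Poly_Mapping.keys x \<subseteq> P_chains C n l"
  shows "on_arr D (l, a, b, m) (cochain_ext C D n f l x) = cochain_ext C D n f m (P_act C (l, a, b, m) x)"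
proof -
  have lm: "l \<in> arr C" "m \<in> arr C" using g unfolding arr_FC by blast+
  let ?S = "P_chains C n l"
  have "(on_arr D (l, a, b, m) \<circ> cochain_ext C D n f l) x = (cochain_ext C D n f m \<circ> P_act C (l, a, b, m)) x"
  proof (rule hom_free_eqI[OF D_group[OF lm(2)] _ _ _ x])
    show "on_arr D (l, a, b, m) \<circ> cochain_ext C D n f l \<in> hom (free_Abelian_group ?S) (on_obj D m)"
      by (rule hom_compose[OF cochain_ext_hom[OF f lm(1)] D_hom[OF g]])
    show "cochain_ext C D n f m \<circ> P_act C (l, a, b, m) \<in> hom (free_Abelian_group ?S) (on_obj D m)"
      by (rule hom_compose[OF P_act_hom[OF g, of n, unfolded P_grp_eq] cochain_ext_hom[OF f lm(2)]])
    fix s assume s: "s \<in> ?S"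
    obtain A ls where sA: "s = (A, ls)" by (cases s)
    have s': "(tgt C a, act_list C a b ls) \<in> P_chains C n m"
      "middle C (tgt C a, act_list C a b ls) = middle C (A, ls)"
      using act_list_P_chains[OF g] s by (auto simp: sA)
    have "on_arr D (l, a, b, m) (cochain_ext C D n f l (frag_of s)) =
      on_arr D (composite C (middle C s), cmp C a (hd ls), cmp C (last ls) b, m) (f (middle C s))"
      unfolding cochain_ext_of[OF f s] 
      using D_cmp[OF P_chain_arr_FC[OF s] g BW_D[OF f middle_nchains[OF s]]] by (simp add: sA)
    also have "\<dots> = cochain_ext C D n f m (frag_of (tgt C a, act_list C a b ls))"
      unfolding cochain_ext_of[OF f s'(1)] s'(2) sA by (simp add: act_list_def)
    finally show "(on_arr D (l, a, b, m) \<circ> cochain_ext C D n f l) (frag_of s) =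
        (cochain_ext C D n f m \<circ> P_act C (l, a, b, m)) (frag_of s)"
      by (simp add: sA P_act_of)
  qed
  then show ?thesis by simp
qed

lemma pullback_closed:
  assumes "natural_op C k n \<phi>" "f \<in> carrier (BW C D n)"
  shows "pullback C D k n \<phi> f \<in> carrier (BW C D k)"
proof -
  have "Poly_Mapping.keys (\<phi> (pad_ide C s)) \<subseteq> P_chains C n (composite C s)" if "s \<in> nchains C k" for s
    using assms(1) pad_ide_P_chains[OF that] by (simp add: natural_op_def)
  then show ?thesis
    using cochain_ext_closed[OF assms(2) composite_nchains] by (simp add: BW_def pullback_def)
qed

text \<open>Every basis element comes from a padded chain along an arrow. Both the extension and
  \<phi> commute with that arrow, so the comparison reduces to padded chains, where it is the
  definition of \<open>pullback\<close>. Through this lemma an identity between chains becomes one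
  between cochains.\<close>

lemma cochain_ext_pullback:
  assumes \<phi>: "natural_op C k n \<phi>" and f: "f \<in> carrier (BW C D n)" and m: "m \<in> arr C"
    and x: "Poly_Mapping.keys x \<subseteq> P_chains C k m"
  shows "cochain_ext C D k (pullback C D k n \<phi> f) m x = cochain_ext C D n f m (frag_extend \<phi> x)"
proof -
  have keys: "Poly_Mapping.keys (\<phi> s) \<subseteq> P_chains C n m" if "s \<in> P_chains C k m" for s m
    using \<phi> that by (simp add: natural_op_def)
  have "cochain_ext C D k (pullback C D k n \<phi> f) m x = (cochain_ext C D n f m \<circ> frag_extend \<phi>) x"
  proof (rule hom_free_eqI[OF D_group[OF m] cochain_ext_hom[OF pullback_closed[OF \<phi> f] m] _ _ x])
    show "cochain_ext C D n f m \<circ> frag_extend \<phi> \<in> hom (free_Abelian_group (P_chains C k m)) (on_obj D m)"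
      by (rule hom_compose[OF frag_extend_hom cochain_ext_hom[OF f m]]) (rule keys)
    fix s assume s: "s \<in> P_chains C k m"
    let ?t = "middle C s" and ?g = "(composite C (middle C s), hd (snd s), last (snd s), m)"
    have t: "?t \<in> nchains C k" by (rule middle_nchains[OF s])
    have g: "?g \<in> arr (FC C)" by (rule P_chain_arr_FC[OF s])
    have h: "pad_ide C ?t \<in> P_chains C k (composite C ?t)" by (rule pad_ide_P_chains[OF t])
    have "cochain_ext C D k (pullback C D k n \<phi> f) m (frag_of s) =
      on_arr D ?g (cochain_ext C D n f (composite C ?t) (\<phi> (pad_ide C ?t)))"
      unfolding cochain_ext_of[OF pullback_closed[OF \<phi> f] s] using t by (simp add: pullback_def)
    also have "\<dots> = cochain_ext C D n f m (P_act C ?g (\<phi> (pad_ide C ?t)))"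
      by (rule cochain_ext_natural[OF f g keys[OF h]])
    also have "P_act C ?g (\<phi> (pad_ide C ?t)) = frag_extend \<phi> (P_act C ?g (frag_of (pad_ide C ?t)))"
      using \<phi> h g by (simp add: natural_op_def)
    also have "P_act C ?g (frag_of (pad_ide C ?t)) = frag_of s"
      by (rule P_act_pad_ide_middle[OF s])
    finally show "cochain_ext C D k (pullback C D k n \<phi> f) m (frag_of s) = (cochain_ext C D n f m \<circ> frag_extend \<phi>) (frag_of s)"
      by simp
  qed
  then show ?thesis by simp
qed

lemma cochain_ext_trivial:
  assumes f: "f \<in> carrier (BW C D n)" and "m \<in> arr C" and "T \<subseteq> P_chains C n m"
    and "\<And>s. s \<in> T \<Longrightarrow> f (middle C s) = \<one>\<^bsub>on_obj D (composite C (middle C s))\<^esub>"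
    and "Poly_Mapping.keys x \<subseteq> T"
  shows "cochain_ext C D n f m x = \<one>\<^bsub>on_obj D m\<^esub>"
proof (rule hom_free_trivial[OF D_group[OF assms(2)] cochain_ext_hom[OF f assms(2)] assms(3) _ assms(5)])
  fix s assume s: "s \<in> T"
  then have s': "s \<in> P_chains C n m" using assms(3) by auto
  show "cochain_ext C D n f m (frag_of s) = \<one>\<^bsub>on_obj D m\<^esub>"
    unfolding cochain_ext_of[OF f s'] assms(4)[OF s]
    by (rule hom_one[OF D_hom[OF P_chain_arr_FC[OF s']] D_group[OF composite_nchains[OF middle_nchains[OF s']]] D_group[OF assms(2)]])
qed

lemma BW_comm_group: "comm_group (BW C D n)"
proof -
  have g: "group (BW C D n)"
    unfolding BW_def using D_group composite_nchains by (intro product_group) auto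
  show ?thesis
  proof (rule group.group_comm_groupI[OF g])
    fix x y assume "x \<in> carrier (BW C D n)" "y \<in> carrier (BW C D n)"
    then show "x \<otimes>\<^bsub>BW C D n\<^esub> y = y \<otimes>\<^bsub>BW C D n\<^esub> x"
      using BW_D comm_group.axioms(1)[OF D_comm_group[OF composite_nchains]]
      by (auto simp: BW_def PiE_iff intro!: restrict_ext comm_monoid.m_comm)
  qed
qed

lemma BW_eqI:
  assumes "f \<in> carrier (BW C D n)" "g \<in> carrier (BW C D n)" "\<And>s. s \<in> nchains C n \<Longrightarrow> f s = g s"
  shows "f = g"
  using assms(1,2) unfolding BW_def carrier_product_group by (rule PiE_ext) (rule assms(3))

lemma mult_BW: "s \<in> nchains C n \<Longrightarrow> (f \<otimes>\<^bsub>BW C D n\<^esub> g) s = f s \<otimes>\<^bsub>on_obj D (composite C s)\<^esub> g s"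
  by (simp add: BW_def)

lemma one_BW: "s \<in> nchains C n \<Longrightarrow> \<one>\<^bsub>BW C D n\<^esub> s = \<one>\<^bsub>on_obj D (composite C s)\<^esub>"
  by (simp add: BW_def)

lemma BW_mult_closed: "f \<in> carrier (BW C D n) \<Longrightarrow> g \<in> carrier (BW C D n) \<Longrightarrow> f \<otimes>\<^bsub>BW C D n\<^esub> g \<in> carrier (BW C D n)"
  by (rule monoid.m_closed[OF group.is_monoid[OF comm_group.axioms(2)[OF BW_comm_group]]])

lemma cochain_ext_mult:
  assumes f: "f \<in> carrier (BW C D n)" and g: "g \<in> carrier (BW C D n)" and m: "m \<in> arr C"
    and x: "Poly_Mapping.keys x \<subseteq> P_chains C n m"
  shows "cochain_ext C D n (f \<otimes>\<^bsub>BW C D n\<^esub> g) m x = cochain_ext C D n f m x \<otimes>\<^bsub>on_obj D m\<^esub> cochain_ext C D n g m x"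
proof -
  show ?thesis
  proof (rule hom_free_eqI[OF D_group[OF m] cochain_ext_hom[OF BW_mult_closed[OF f g] m]
        hom_pointwise_mult[OF D_comm_group[OF m] cochain_ext_hom[OF f m] cochain_ext_hom[OF g m]] _ x])
    fix s assume s: "s \<in> P_chains C n m"
    note t = middle_nchains[OF s]
    show "cochain_ext C D n (f \<otimes>\<^bsub>BW C D n\<^esub> g) m (frag_of s) =
      cochain_ext C D n f m (frag_of s) \<otimes>\<^bsub>on_obj D m\<^esub> cochain_ext C D n g m (frag_of s)"
      unfolding cochain_ext_of[OF f s] cochain_ext_of[OF g s] cochain_ext_of[OF BW_mult_closed[OF f g] s] mult_BW[OF t]
      by (rule hom_mult[OF D_hom[OF P_chain_arr_FC[OF s]] BW_D[OF f t] BW_D[OF g t]])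
  qed
qed

end

section \<open>The Baues--Wirsching complex\<close>

context natural_coefficients
begin

text \<open>In the padded chain the first and the last face compose an outer identity with a
  neighbour and thereby promote that neighbour to an outer arrow; D turns this arrow into
  \<open>push\<close> or \<open>pull\<close>. The remaining faces commute with padding.\<close>

lemma BW_d_eq_pullback:
  assumes f: "f \<in> carrier (BW C D n)"
  shows "BW_d C D n f = pullback C D (Suc n) n (boundary C (Suc n)) f"
  unfolding BW_d_def pullback_def
proof (rule restrict_ext)
  fix s assume s: "s \<in> nchains C (Suc n)"
  obtain A ls where sA: "s = (A, ls)" by (cases s)
  define m where "m = composite C (A, ls)"
  interpret G: comm_group "on_obj D m"
    using D_comm_group[OF composite_nchains[OF s]] by (simp add: sA m_def)
  have len: "length ls = Suc n" and path: "is_path C A ls" using s by (simp_all add: sA nchains_iff)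
  have m: "m \<in> arr C" using path by (simp add: m_def composite_arr)
  have A: "A \<in> obj C" using path by (rule path_obj)
  have pad_ide: "pad_ide C s = (A, ide C A # ls @ [ide C (src C m)])" by (simp add: pad_ide_def sA m_def)
  have hatP: "pad_ide C s \<in> P_chains C (Suc n) m" using pad_ide_P_chains[OF s] by (simp add: sA m_def)
  note mergeP = merge_P_chains[OF hatP]
  define t where "t i = cochain_ext C D n f m (frag_of (merge C i (pad_ide C s)))" for i
  have t: "t i \<in> carrier (on_obj D m)" if "i \<le> Suc n" for i
    unfolding t_def using mergeP[OF that] by (intro cochain_ext_closed[OF f m]) simp
  have front_face: "t 0 = push C D (hd ls) (composite C (src C (hd ls), tl ls)) (f (src C (hd ls), tl ls))"
  proof -
    obtain l ks where ls: "ls = l # ks" using len by (cases ls) auto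
    have p: "is_path C A (l # ks)" using path ls by simp
    then have "cmp C (ide C A) l = l" using cmp_ide_left[of l] by auto
    then have merge_list: "merge C 0 (pad_ide C s) = (A, l # ks @ [ide C (src C m)])"
      by (simp add: pad_ide merge_eq merge_list_def ls)
    have c: "m = cmp C l (composite C (src C l, ks))" "src C m = src C (composite C (src C l, ks))"
      unfolding m_def ls by (rule composite_Cons[OF p], rule src_composite_Cons[OF p])
    have P: "(A, l # ks @ [ide C (src C m)]) \<in> P_chains C n m" using mergeP[of 0] by (simp add: merge_list)
    show ?thesis
      unfolding t_def merge_list cochain_ext_of[OF f P] middle_outer
      by (simp add: ls push_def c(2)) (simp add: c(1))
  qed
  have back_face: "t (Suc n) = pull C D (last ls) (composite C (A, butlast ls)) (f (A, butlast ls))"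
  proof -
    obtain ks l where ls: "ls = ks @ [l]" using len by (cases ls rule: rev_cases) auto
    have p: "is_path C A (ks @ [l])" using path ls by simp
    then have pk: "is_path C A ks" "l \<in> arr C" "tgt C l = src C (composite C (A, ks))"
      by (simp_all add: path_append1)
    have c: "m = cmp C (composite C (A, ks)) l"
      unfolding m_def ls by (rule composite_append1[OF p])
    have "src C m = src C l" unfolding c by (rule src_cmp) (use pk in \<open>simp_all add: composite_arr\<close>)
    then have "cmp C l (ide C (src C m)) = l" using cmp_ide_right[OF pk(2)] by simp
    then have merge_list: "merge C (Suc n) (pad_ide C s) = (A, ide C A # ks @ [l])"
      using merge_list_at_length[of C "ide C A # ks" l "ide C (src C m)" "[]"] len by (simp add: pad_ide merge_eq ls)
    have A': "tgt C (composite C (A, ks)) = A" by (rule tgt_composite[OF pk(1)])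
    have P: "(A, ide C A # ks @ [l]) \<in> P_chains C n m" using mergeP[of "Suc n"] by (simp add: merge_list)
    show ?thesis
      unfolding t_def merge_list cochain_ext_of[OF f P] middle_outer
      using A by (simp add: ls pull_def A' src_ide flip: c)
  qed
  \<comment> \<open>The leading identity shifts positions by one: face i of the padded chain is face
    i - 1 of the chain itself.\<close>
  have inner: "t i = f (merge C (i - 1) (A, ls))" if i: "i \<in> {1..n}" for i
  proof -
    obtain k where k: "i = Suc k" "Suc k < length ls" using i len by (cases i) auto
    have mp: "is_path C A (merge_list C k ls)" "composite C (A, merge_list C k ls) = m"
      using merge_list_path[OF path k(2)] by (auto simp: m_def)
    have nc: "(A, merge_list C k ls) \<in> nchains C n" using mp k len by (simp add: nchains_iff)
    have "merge C i (pad_ide C s) = pad_ide C (A, merge_list C k ls)"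
      using k by (simp add: pad_ide merge_eq merge_list_Cons_Suc merge_list_append) (simp add: pad_ide_def mp)
    then show ?thesis
      using cochain_ext_pad_ide[OF f nc] k by (simp add: t_def mp merge_eq)
  qed
  have pw: "f (merge C (i - 1) (A, ls)) [^]\<^bsub>on_obj D m\<^esub> ((-1) ^ i :: int) \<in> carrier (on_obj D m)"
    if i: "i \<in> {1..n}" for i
  proof -
    have "f (merge C (i - 1) (A, ls)) \<in> carrier (on_obj D m)"
      using t[of i] inner[OF i] i by simp
    then show ?thesis by (rule G.int_pow_closed)
  qed
  have "cochain_ext C D n f m (boundary C (Suc n) (pad_ide C s)) =
    finprod (on_obj D m) (\<lambda>i. cochain_ext C D n f m (frag_cmul ((-1) ^ i) (frag_of (merge C i (pad_ide C s))))) {0..Suc n}"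
    unfolding boundary_def using mergeP
    by (intro hom_free_sum[OF G.comm_group_axioms cochain_ext_hom[OF f m]]) auto
  also have "\<dots> = finprod (on_obj D m) (\<lambda>i. t i [^]\<^bsub>on_obj D m\<^esub> ((-1) ^ i :: int)) {0..Suc n}"
    using mergeP t
    by (intro G.finprod_cong') (auto simp: t_def hom_free_cmul[OF D_group[OF m] cochain_ext_hom[OF f m]])
  \<comment> \<open>Both end faces are split off, leaving the range of the inner sum in
    \<open>BW_d\<close>; it is empty for n = 0.\<close>
  also have "{0..Suc n} = insert 0 (insert (Suc n) {1..n})" by auto
  also have "finprod (on_obj D m) (\<lambda>i. t i [^]\<^bsub>on_obj D m\<^esub> ((-1) ^ i :: int)) (insert 0 (insert (Suc n) {1..n})) =
    t 0 \<otimes>\<^bsub>on_obj D m\<^esub> (t (Suc n) [^]\<^bsub>on_obj D m\<^esub> ((-1) ^ Suc n :: int) \<otimes>\<^bsub>on_obj D m\<^esub>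
      finprod (on_obj D m) (\<lambda>i. t i [^]\<^bsub>on_obj D m\<^esub> ((-1) ^ i :: int)) {1..n})"
    using t by (subst G.finprod_insert; simp add: Pi_def)+
  also have "finprod (on_obj D m) (\<lambda>i. t i [^]\<^bsub>on_obj D m\<^esub> ((-1) ^ i :: int)) {1..n} =
    finprod (on_obj D m) (\<lambda>i. f (merge C (i - 1) (A, ls)) [^]\<^bsub>on_obj D m\<^esub> ((-1) ^ i :: int)) {1..n}"
    using pw inner by (intro G.finprod_cong') (auto simp: Pi_def)
  finally have eq: "cochain_ext C D n f m (boundary C (Suc n) (pad_ide C s)) =
    t 0 \<otimes>\<^bsub>on_obj D m\<^esub> (t (Suc n) [^]\<^bsub>on_obj D m\<^esub> ((-1) ^ Suc n :: int) \<otimes>\<^bsub>on_obj D m\<^esub>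
      finprod (on_obj D m) (\<lambda>i. f (merge C (i - 1) (A, ls)) [^]\<^bsub>on_obj D m\<^esub> ((-1) ^ i :: int)) {1..n})" .
  have fin: "finprod (on_obj D m) (\<lambda>i. f (merge C (i - 1) (A, ls)) [^]\<^bsub>on_obj D m\<^esub> ((-1) ^ i :: int)) {1..n}
      \<in> carrier (on_obj D m)"
    by (rule G.finprod_closed, rule Pi_I) (rule pw)
  have "cochain_ext C D n f m (boundary C (Suc n) (pad_ide C s)) = t 0 \<otimes>\<^bsub>on_obj D m\<^esub>
      finprod (on_obj D m) (\<lambda>i. f (merge C (i - 1) (A, ls)) [^]\<^bsub>on_obj D m\<^esub> ((-1) ^ i :: int)) {1..n}
      \<otimes>\<^bsub>on_obj D m\<^esub> t (Suc n) [^]\<^bsub>on_obj D m\<^esub> ((-1) ^ Suc n :: int)"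
    unfolding eq using t fin by (simp add: G.m_ac)
  then show "(case s of (A, ls) \<Rightarrow>
      let G = on_obj D (composite C (A, ls));
        front = (src C (hd ls), tl ls);
        back = (A, butlast ls)
      in push C D (hd ls) (composite C front) (f front)
       \<otimes>\<^bsub>G\<^esub> finprod G (\<lambda>i. f (merge C (i - 1) (A, ls)) [^]\<^bsub>G\<^esub> ((-1) ^ i :: int)) {1..n}
       \<otimes>\<^bsub>G\<^esub> pull C D (last ls) (composite C back) (f back) [^]\<^bsub>G\<^esub> ((-1) ^ Suc n :: int)) =
    cochain_ext C D n f (composite C s) (boundary C (Suc n) (pad_ide C s))"
    unfolding sA prod.case Let_def m_def[symmetric] front_face back_face ..
qed

lemma BW_d_closed: "f \<in> carrier (BW C D n) \<Longrightarrow> BW_d C D n f \<in> carrier (BW C D (Suc n))"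
  unfolding BW_d_eq_pullback by (rule pullback_closed[OF natural_op_boundary])

lemma cochain_ext_BW_d:
  assumes "f \<in> carrier (BW C D n)" "m \<in> arr C" "Poly_Mapping.keys x \<subseteq> P_chains C (Suc n) m"
  shows "cochain_ext C D (Suc n) (BW_d C D n f) m x = cochain_ext C D n f m (P_d C (Suc n) x)"
  unfolding BW_d_eq_pullback[OF assms(1)] P_d_eq by (rule cochain_ext_pullback[OF natural_op_boundary assms])

lemma BW_d_apply:
  assumes "f \<in> carrier (BW C D n)" "s \<in> nchains C (Suc n)"
  shows "BW_d C D n f s = cochain_ext C D n f (composite C s) (boundary C (Suc n) (pad_ide C s))"
  using assms by (simp add: BW_d_eq_pullback pullback_def)

lemma BW_d_hom: "BW_d C D n \<in> hom (BW C D n) (BW C D (Suc n))"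
proof (rule homI)
  fix f g assume fg: "f \<in> carrier (BW C D n)" "g \<in> carrier (BW C D n)"
  show "BW_d C D n (f \<otimes>\<^bsub>BW C D n\<^esub> g) = BW_d C D n f \<otimes>\<^bsub>BW C D (Suc n)\<^esub> BW_d C D n g"
  proof (rule BW_eqI[of _ "Suc n"])
    fix s assume s: "s \<in> nchains C (Suc n)"
    show "BW_d C D n (f \<otimes>\<^bsub>BW C D n\<^esub> g) s = (BW_d C D n f \<otimes>\<^bsub>BW C D (Suc n)\<^esub> BW_d C D n g) s"
      unfolding mult_BW[OF s] BW_d_apply[OF fg(1) s] BW_d_apply[OF fg(2) s]
        BW_d_apply[OF BW_mult_closed[OF fg] s]
      by (rule cochain_ext_mult[OF fg composite_nchains[OF s] boundary_P_chains[OF pad_ide_P_chains[OF s]]])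
  qed (use fg BW_d_closed BW_mult_closed in auto)
qed (rule BW_d_closed)

lemma BW_one_closed: "\<one>\<^bsub>BW C D n\<^esub> \<in> carrier (BW C D n)"
  by (rule monoid.one_closed[OF group.is_monoid[OF comm_group.axioms(2)[OF BW_comm_group]]])

text \<open>Two coboundaries of f amount to its extension evaluated at the boundary of a boundary,
  which is zero already in the free group.\<close>

lemma BW_d_BW_d:
  assumes f: "f \<in> carrier (BW C D n)"
  shows "BW_d C D (Suc n) (BW_d C D n f) = \<one>\<^bsub>BW C D (Suc (Suc n))\<^esub>"
proof (rule BW_eqI[OF BW_d_closed[OF BW_d_closed[OF f]] BW_one_closed])
  fix s assume s: "s \<in> nchains C (Suc (Suc n))"
  note m = composite_nchains[OF s] and h = pad_ide_P_chains[OF s]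
  have "BW_d C D (Suc n) (BW_d C D n f) s =
      cochain_ext C D n f (composite C s) (P_d C (Suc n) (boundary C (Suc (Suc n)) (pad_ide C s)))"
    unfolding BW_d_apply[OF BW_d_closed[OF f] s] by (rule cochain_ext_BW_d[OF f m boundary_P_chains[OF h]])
  also have "\<dots> = cochain_ext C D n f (composite C s) 0" by (simp only: P_d_boundary[OF h])
  also have "\<dots> = \<one>\<^bsub>on_obj D (composite C s)\<^esub>"
    using hom_one[OF cochain_ext_hom[OF f m] _ D_group[OF m]] by simp
  finally show "BW_d C D (Suc n) (BW_d C D n f) s = \<one>\<^bsub>BW C D (Suc (Suc n))\<^esub> s"
    by (simp only: one_BW[OF s])
qed

lemma BW_complex: "cochain_complex (BW C D) (BW_d C D)"
  unfolding cochain_complex_def using BW_comm_group BW_d_hom BW_d_BW_d by blast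

end

section \<open>Normalization\<close>

text \<open>The chains \<open>(\<lambda>\<^sub>0, \<dots>, \<lambda>\<^bsub>n+1\<^esub>)\<close> in which some \<open>\<lambda>\<^sub>j\<close> with \<open>1 \<le> j \<le> min p n\<close> is an identity; for
  \<open>p = n\<close> they span \<open>P\<^sub>n'\<close>.\<close>

definition degenerate_upto :: "('o, 'm) cat \<Rightarrow> nat \<Rightarrow> nat \<Rightarrow> 'm \<Rightarrow> ('o, 'm) chain set"
  where "degenerate_upto C p n m = {s \<in> P_chains C n m. \<exists>j. 1 \<le> j \<and> j \<le> p \<and> j \<le> n \<and> snd s ! j \<in> ide C ` obj C}"

text \<open>The scalar absorbs the sign of the correction: with c equal to minus the p-th power of
  -1, the coboundary that the overview subtracts becomes one that is added.\<close>

definition insert_ide_op :: "('o, 'm) cat \<Rightarrow> int \<Rightarrow> nat \<Rightarrow> ('o, 'm) chain \<Rightarrow> ('o, 'm) chain \<Rightarrow>\<^sub>0 int"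
  where "insert_ide_op C c p s = frag_cmul c (frag_of (fst s, insert_ide C p (snd s)))"

lemma degenerate_upto_subset: "degenerate_upto C p n m \<subseteq> P_chains C n m"
  by (auto simp: degenerate_upto_def)

lemma degenerate_upto_le_eq: "n \<le> p \<Longrightarrow> degenerate_upto C p n m = degenerate_upto C n n m"
  by (auto simp: degenerate_upto_def)

lemma DgI: "(A, ls) \<in> P_chains C n m \<Longrightarrow> 1 \<le> j \<Longrightarrow> j \<le> p \<Longrightarrow> j \<le> n \<Longrightarrow> ls ! j \<in> ide C ` obj C \<Longrightarrow>
    (A, ls) \<in> degenerate_upto C p n m"
  by (auto simp: degenerate_upto_def)

lemma boundary_eq: "boundary C N (A, ls) = (\<Sum>i=0..N. frag_cmul ((-1) ^ i) (frag_of (A, merge_list C i ls)))"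
  by (simp add: boundary_def merge_eq)

lemma insert_ide_op_boundary:
  "frag_extend (insert_ide_op C c p) (boundary C N (A, ls)) =
    (\<Sum>i=0..N. frag_cmul (c * (-1) ^ i) (frag_of (A, insert_ide C p (merge_list C i ls))))"
  by (simp add: boundary_eq frag_extend_sum frag_extend_cmul o_def insert_ide_op_def mult.commute)

lemma P_act_insert_ide_op:
  assumes "insert_ide C p (act_list C a b ls) = act_list C a b (insert_ide C p ls)"
  shows "frag_extend (insert_ide_op C c p) (P_act C (l, a, b, m) (frag_of (A, ls))) =
    P_act C (l, a, b, m) (insert_ide_op C c p (A, ls))"
  using assms by (simp add: P_act_of insert_ide_op_def P_act_cmul)

context small_category
begin

text \<open>Entry k of the middle is entry k + 1 of the whole chain, because position 0 holds an
  outer arrow. An identity in an outer position does not count as degenerate.\<close>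

lemma degenerate_middle_iff:
  assumes "s \<in> P_chains C n m"
  shows "degenerate C (middle C s) \<longleftrightarrow> s \<in> degenerate_upto C n n m"
  using assms
proof (rule P_chainsE)
  fix x ys z assume s: "s = (tgt C x, x # ys @ [z])" "length ys = n"
  have "degenerate C (middle C s) \<longleftrightarrow> (\<exists>l \<in> set ys. l \<in> ide C ` obj C)"
    by (auto simp: s(1) middle_outer degenerate_def)
  also have "\<dots> \<longleftrightarrow> (\<exists>k<n. ys ! k \<in> ide C ` obj C)"
    by (metis in_set_conv_nth s(2))
  also have "\<dots> \<longleftrightarrow> (\<exists>j. 1 \<le> j \<and> j \<le> n \<and> snd s ! j \<in> ide C ` obj C)"
  proof
    assume "\<exists>k<n. ys ! k \<in> ide C ` obj C"
    then obtain k where "k < n" "ys ! k \<in> ide C ` obj C" by blast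
    then show "\<exists>j. 1 \<le> j \<and> j \<le> n \<and> snd s ! j \<in> ide C ` obj C"
      using s by (intro exI[of _ "Suc k"]) (simp add: nth_append)
  next
    assume "\<exists>j. 1 \<le> j \<and> j \<le> n \<and> snd s ! j \<in> ide C ` obj C"
    then obtain j where j: "1 \<le> j" "j \<le> n" "snd s ! j \<in> ide C ` obj C" by blast
    then have "ys ! (j - 1) \<in> ide C ` obj C" using s by (cases j) (simp_all add: nth_append)
    then show "\<exists>k<n. ys ! k \<in> ide C ` obj C" using j by (intro exI[of _ "j - 1"]) simp
  qed
  also have "\<dots> \<longleftrightarrow> s \<in> degenerate_upto C n n m"
    using assms by (auto simp: degenerate_upto_def)
  finally show ?thesis .
qed

lemma insert_ide_P_chains:
  assumes "(A, ls) \<in> P_chains C n m" "p \<le> n"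
  shows "(A, insert_ide C p ls) \<in> P_chains C (Suc n) m"
  using assms insert_ide_path[of A ls p] by (simp add: P_chains_iff)

lemma merge_list_P_chains:
  "(A, ls) \<in> P_chains C (Suc n) m \<Longrightarrow> i \<le> Suc n \<Longrightarrow> (A, merge_list C i ls) \<in> P_chains C n m"
  using merge_P_chains by (metis merge_eq)

lemma natural_op_insert_ide_op:
  assumes "p \<le> n"
  shows "natural_op C n (Suc n) (insert_ide_op C c p)"
  unfolding natural_op_def
proof (intro conjI allI ballI impI)
  fix m s assume "s \<in> P_chains C n m"
  then show "Poly_Mapping.keys (insert_ide_op C c p s) \<subseteq> P_chains C (Suc n) m"
    unfolding insert_ide_op_def using insert_ide_P_chains[of "fst s" "snd s"] assms by (intro keys_cmul_of) simp
next
  fix l a b m s assume s: "s \<in> P_chains C n l" and g: "(l, a, b, m) \<in> arr (FC C)"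
  obtain A ls where sA: "s = (A, ls)" by (cases s)
  have p: "is_path C A ls" "length ls = n + 2" "composite C (A, ls) = l"
    using s by (simp_all add: sA P_chains_iff)
  have "a \<in> arr C" "src C a = A"
    using g tgt_composite[OF p(1)] p(3) unfolding arr_FC by auto
  then have "insert_ide C p (act_list C a b ls) = act_list C a b (insert_ide C p ls)"
    using p assms by (intro act_list_insert_ide) auto
  then show "frag_extend (insert_ide_op C c p) (P_act C (l, a, b, m) (frag_of s)) =
      P_act C (l, a, b, m) (insert_ide_op C c p s)"
    unfolding sA by (rule P_act_insert_ide_op)
qed

text \<open>The insertion takes place to the right of position p, so an identity at or before p
  keeps its place.\<close>

lemma insert_ide_degenerate_upto:
  assumes "(A, ls) \<in> degenerate_upto C p n m" "p \<le> n"
  shows "(A, insert_ide C p ls) \<in> degenerate_upto C p (Suc n) m"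
proof -
  obtain j where j: "(A, ls) \<in> P_chains C n m" "1 \<le> j" "j \<le> p" "j \<le> n" "ls ! j \<in> ide C ` obj C"
    using assms(1) by (auto simp: degenerate_upto_def)
  moreover have "length ls = n + 2" using j(1) by (simp add: P_chains_iff)
  ultimately show ?thesis
    using assms(2) insert_ide_P_chains by (intro DgI[of _ _ _ _ _ j]) (simp_all add: nth_insert_ide)
qed

text \<open>The two faces that absorb the given identity cancel. Every other face keeps it, at its
  old position or one place further left, so the bound p survives.\<close>

lemma boundary_degenerate_upto:
  assumes "s \<in> degenerate_upto C p (Suc n) m"
  shows "Poly_Mapping.keys (boundary C (Suc n) s) \<subseteq> degenerate_upto C p n m"
proof -
  obtain A ls where sA: "s = (A, ls)" by (cases s)
  obtain j' where "1 \<le> j'" "j' \<le> p" "j' \<le> Suc n" "ls ! j' \<in> ide C ` obj C"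
    using assms by (auto simp: sA degenerate_upto_def)
  \<comment> \<open>With the identity at position j + 1, the faces that involve it are j and j +
    1.\<close>
  then obtain j where j: "Suc j \<le> p" "j \<le> n" "ls ! Suc j \<in> ide C ` obj C"
    by (cases j') auto
  have s: "(A, ls) \<in> P_chains C (Suc n) m" using assms by (simp add: sA degenerate_upto_def)
  then have p: "is_path C A ls" "length ls = n + 3" by (simp_all add: P_chains_iff)
  let ?t = "\<lambda>i. frag_cmul ((-1) ^ i) (frag_of (A, merge_list C i ls))"
  have "merge_list C j ls = merge_list C (Suc j) ls" using p j by (intro merge_list_around_ide) auto
  then have cancel: "?t j + ?t (Suc j) = 0" by (simp add: frag_cmul_add_neg)
  have split: "{0..Suc n} = {0..Suc n} - {j, Suc j} \<union> {j, Suc j}" using j by auto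
  have "boundary C (Suc n) s = sum ?t ({0..Suc n} - {j, Suc j} \<union> {j, Suc j})"
    unfolding sA boundary_eq using split by simp
  also have "\<dots> = sum ?t ({0..Suc n} - {j, Suc j}) + sum ?t {j, Suc j}"
    by (rule sum.union_disjoint) auto
  also have "sum ?t {j, Suc j} = 0" using cancel by simp
  finally have "boundary C (Suc n) s = sum ?t ({0..Suc n} - {j, Suc j})" by simp
  also have "Poly_Mapping.keys \<dots> \<subseteq> degenerate_upto C p n m"
  proof (rule keys_sum_subset, rule keys_cmul_of)
    fix i assume i: "i \<in> {0..Suc n} - {j, Suc j}"
    then have P: "(A, merge_list C i ls) \<in> P_chains C n m" using merge_list_P_chains[OF s] by simp
    consider "i < j" | "Suc j < i" using i by fastforce
    then show "(A, merge_list C i ls) \<in> degenerate_upto C p n m"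
    proof cases
      case 1
      then show ?thesis using P j p by (intro DgI[of _ _ _ _ _ j]) (simp_all add: nth_merge_list)
    next
      case 2
      then show ?thesis using P j p i by (intro DgI[of _ _ _ _ _ "Suc j"]) (simp_all add: nth_merge_list)
    qed
  qed
  finally show ?thesis .
qed

text \<open>On chains with an identity at position \<open>p + 1\<close>, the insertion \<open>\<sigma>\<close> of an identity after position
  \<open>p\<close> satisfies \<open>\<partial>\<sigma> + \<sigma>\<partial> = (-1)\<^sup>p\<close> modulo chains with an identity among the positions \<open>1, \<dots>, p\<close>: the
  faces \<open>p\<close> and \<open>p + 1\<close> of \<open>\<sigma>w\<close> cancel, higher faces of \<open>\<sigma>w\<close> cancel against those of \<open>w\<close>, and the face
  \<open>p\<close> of \<open>w\<close> gives back \<open>w\<close>.\<close>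

lemma homotopy_mod_degenerate_upto:
  assumes s: "(A, ls) \<in> P_chains C (Suc k) m" and "p \<le> k" and w: "ls ! Suc p \<in> ide C ` obj C"
  defines "c \<equiv> - ((-1) ^ p)"
  shows "Poly_Mapping.keys (frag_extend (insert_ide_op C c p) (boundary C (Suc k) (A, ls)) + frag_of (A, ls)
      - frag_cmul ((-1) ^ p) (boundary C (Suc (Suc k)) (A, insert_ide C p ls))) \<subseteq> degenerate_upto C p (Suc k) m"
proof -
  have p: "is_path C A ls" "length ls = k + 3" using s by (simp_all add: P_chains_iff)
  have sq: "(-1) ^ p * (-1) ^ p = (1::int)" by (simp flip: power_add)
  let ?U = "\<lambda>i. frag_cmul (c * (-1) ^ i) (frag_of (A, insert_ide C p (merge_list C i ls)))"
  let ?T = "\<lambda>i. frag_cmul ((-1) ^ i) (frag_of (A, merge_list C i (insert_ide C p ls)))"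
  let ?V = "\<lambda>i. frag_cmul ((-1) ^ p) (?T i)"
  have U: "frag_extend (insert_ide_op C c p) (boundary C (Suc k) (A, ls)) =
      sum ?U {..<p} + (?U p + (\<Sum>i=Suc p..Suc k. ?U i))"
    unfolding insert_ide_op_boundary using assms(2) by (intro sum_split_at) simp
  have Up: "?U p = - frag_of (A, ls)"
    using insert_ide_merge_list_same[OF p(1) _ w] p assms(2) sq by (simp add: c_def)
  have cancel: "?T p + ?T (Suc p) = 0"
    using merge_list_insert_ide_same[OF p(1), of p] merge_list_Suc_insert_ide[OF p(1), of p] p(2) assms(2)
    by (simp add: frag_cmul_add_neg)
  have T1: "boundary C (Suc (Suc k)) (A, insert_ide C p ls) =
      sum ?T {..<p} + (?T p + (\<Sum>i=Suc p..Suc (Suc k). ?T i))"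
    unfolding boundary_eq using assms(2) by (intro sum_split_at) simp
  have T2: "(\<Sum>i=Suc p..Suc (Suc k). ?T i) = ?T (Suc p) + (\<Sum>i=Suc (Suc p)..Suc (Suc k). ?T i)"
    using assms(2) by (intro sum.atLeast_Suc_atMost) simp
  have T3: "(\<Sum>i=Suc (Suc p)..Suc (Suc k). ?T i) = (\<Sum>i=Suc p..Suc k. ?T (Suc i))"
    by (rule sum.shift_bounds_cl_Suc_ivl)
  have "boundary C (Suc (Suc k)) (A, insert_ide C p ls) =
      sum ?T {..<p} + ((?T p + ?T (Suc p)) + (\<Sum>i=Suc p..Suc k. ?T (Suc i)))"
    unfolding T1 T2 T3 by (simp only: add.assoc)
  then have V: "frag_cmul ((-1) ^ p) (boundary C (Suc (Suc k)) (A, insert_ide C p ls)) =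
      sum ?V {..<p} + (\<Sum>i=Suc p..Suc k. ?V (Suc i))"
    by (simp only: cancel add_0_left frag_cmul_distrib2 frag_cmul_sum)
  \<comment> \<open>Face i + 1 of the longer chain meets face i of the shorter one. The shift by one
    costs a sign, and the minus in c makes up for it.\<close>
  have UV: "(\<Sum>i=Suc p..Suc k. ?V (Suc i)) = (\<Sum>i=Suc p..Suc k. ?U i)"
  proof (rule sum.cong)
    fix i assume "i \<in> {Suc p..Suc k}"
    then have "merge_list C (Suc i) (insert_ide C p ls) = insert_ide C p (merge_list C i ls)"
      using p(2) by (intro merge_list_insert_ide_higher) auto
    then show "?V (Suc i) = ?U i" by (simp add: c_def)
  qed simp
  have collect: "(a + (- w + b)) + w - (v + b) = a - v" for a b v w :: "('o, 'm) chain \<Rightarrow>\<^sub>0 int"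
    by simp
  have eq: "frag_extend (insert_ide_op C c p) (boundary C (Suc k) (A, ls)) + frag_of (A, ls)
      - frag_cmul ((-1) ^ p) (boundary C (Suc (Suc k)) (A, insert_ide C p ls)) = (\<Sum>i<p. ?U i - ?V i)"
    unfolding U V UV Up sum_subtractf by (rule collect)
  show ?thesis
    unfolding eq
  proof (rule keys_sum_subset)
    \<comment> \<open>For i < p both leftover terms have an identity at position p. In the first,
      the face moves the identity of the chain from p + 1 to p and the later insertion leaves it
      there; in the second, the face moves the inserted identity from p + 1 to p.\<close>
    fix i assume "i \<in> {..<p}"
    then have i: "i < p" by simp
    have "(A, insert_ide C p (merge_list C i ls)) \<in> degenerate_upto C p (Suc k) m"
      using insert_ide_P_chains[OF merge_list_P_chains[OF s]] i p assms(2) w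
      by (intro DgI[of _ _ _ _ _ p]) (simp_all add: nth_insert_ide nth_merge_list)
    moreover have "(A, merge_list C i (insert_ide C p ls)) \<in> degenerate_upto C p (Suc k) m"
    proof (rule DgI[of _ _ _ _ _ p])
      show "(A, merge_list C i (insert_ide C p ls)) \<in> P_chains C (Suc k) m"
        using i assms(2) by (intro merge_list_P_chains insert_ide_P_chains[OF s]) auto
      have "ls ! p \<in> arr C" using p assms(2) by (intro path_nth_arr[OF p(1)]) simp
      then show "merge_list C i (insert_ide C p ls) ! p \<in> ide C ` obj C"
        using i p assms(2) by (simp add: nth_insert_ide nth_merge_list src_obj)
    qed (use i assms(2) in auto)
    ultimately show "Poly_Mapping.keys (?U i - ?V i) \<subseteq> degenerate_upto C p (Suc k) m"
      using keys_diff[of "?U i" "?V i"] by (meson Un_least keys_cmul_of keys_cmul_subset order_trans)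
  qed
qed

end

section \<open>Making cochains vanish on degenerate chains, one position at a time\<close>

context natural_coefficients
begin

text \<open>Phrased through the extension, so that it applies directly to the terms of the homotopy.
  For p = n it describes the reduced cochains, as \<open>reduced_iff\<close> shows.\<close>

definition normalized :: "nat \<Rightarrow> nat \<Rightarrow> (('o, 'm) chain \<Rightarrow> 'a) \<Rightarrow> bool"
  where "normalized p n f \<longleftrightarrow> (\<forall>m. \<forall>s \<in> degenerate_upto C p n m. cochain_ext C D n f m (frag_of s) = \<one>\<^bsub>on_obj D m\<^esub>)"

lemma cochain_ext_normalized:
  assumes "f \<in> carrier (BW C D n)" "normalized p n f" "m \<in> arr C" "Poly_Mapping.keys x \<subseteq> degenerate_upto C p n m"
  shows "cochain_ext C D n f m x = \<one>\<^bsub>on_obj D m\<^esub>"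
  using assms(2)
  by (intro hom_free_trivial[OF D_group[OF assms(3)] cochain_ext_hom[OF assms(1,3)] degenerate_upto_subset _ assms(4)])
    (simp add: normalized_def)

text \<open>On padded chains the extension takes the values of f. All other basis elements arise
  from these along homomorphisms of D, which preserve the unit.\<close>

lemma reduced_iff: "f \<in> carrier (reduced C D n) \<longleftrightarrow> f \<in> carrier (BW C D n) \<and> normalized n n f"
proof -
  have "(\<forall>s \<in> nchains C n. degenerate C s \<longrightarrow> f s = \<one>\<^bsub>on_obj D (composite C s)\<^esub>) \<longleftrightarrow> normalized n n f"
    if f: "f \<in> carrier (BW C D n)"
  proof
    assume *: "\<forall>s \<in> nchains C n. degenerate C s \<longrightarrow> f s = \<one>\<^bsub>on_obj D (composite C s)\<^esub>"
    show "normalized n n f"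
      unfolding normalized_def
    proof (intro allI ballI)
      fix m s assume s: "s \<in> degenerate_upto C n n m"
      then have P: "s \<in> P_chains C n m" by (rule subsetD[OF degenerate_upto_subset])
      have "f (middle C s) = \<one>\<^bsub>on_obj D (composite C (middle C s))\<^esub>"
        using * middle_nchains[OF P] degenerate_middle_iff[OF P] s by blast
      then show "cochain_ext C D n f m (frag_of s) = \<one>\<^bsub>on_obj D m\<^esub>"
        using P by (intro cochain_ext_trivial[OF f P_chains_arr[OF P], of "{s}"]) auto
    qed
  next
    assume *: "normalized n n f"
    show "\<forall>s \<in> nchains C n. degenerate C s \<longrightarrow> f s = \<one>\<^bsub>on_obj D (composite C s)\<^esub>"
    proof (intro ballI impI)
      fix s assume s: "s \<in> nchains C n" "degenerate C s"
      have "pad_ide C s \<in> degenerate_upto C n n (composite C s)"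
        using degenerate_middle_iff[OF pad_ide_P_chains[OF s(1)]] s middle_pad_ide[OF s(1)] by simp
      then show "f s = \<one>\<^bsub>on_obj D (composite C s)\<^esub>"
        using * cochain_ext_pad_ide[OF f s(1)] by (simp add: normalized_def)
    qed
  qed
  then show ?thesis by (auto simp: reduced_def)
qed

lemma reduced_BW: "f \<in> carrier (reduced C D n) \<Longrightarrow> f \<in> carrier (BW C D n)"
  by (simp add: reduced_iff)

lemma normalized_mult:
  assumes "f \<in> carrier (BW C D n)" "g \<in> carrier (BW C D n)" "normalized p n f" "normalized p n g"
  shows "normalized p n (f \<otimes>\<^bsub>BW C D n\<^esub> g)"
  unfolding normalized_def
proof (intro allI ballI)
  fix m s assume s: "s \<in> degenerate_upto C p n m"
  then have P: "s \<in> P_chains C n m" by (rule subsetD[OF degenerate_upto_subset])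
  show "cochain_ext C D n (f \<otimes>\<^bsub>BW C D n\<^esub> g) m (frag_of s) = \<one>\<^bsub>on_obj D m\<^esub>"
    using P assms(3,4) s cochain_ext_mult[OF assms(1,2) P_chains_arr[OF P], of "frag_of s"]
      monoid.l_one[OF group.is_monoid[OF D_group[OF P_chains_arr[OF P]]] monoid.one_closed[OF group.is_monoid[OF D_group[OF P_chains_arr[OF P]]]]]
    by (simp add: normalized_def)
qed

lemma normalized_BW_d:
  assumes f: "f \<in> carrier (BW C D n)" and "normalized p n f"
  shows "normalized p (Suc n) (BW_d C D n f)"
  unfolding normalized_def
proof (intro allI ballI)
  fix m s assume s: "s \<in> degenerate_upto C p (Suc n) m"
  then have P: "s \<in> P_chains C (Suc n) m" by (rule subsetD[OF degenerate_upto_subset])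
  have "cochain_ext C D (Suc n) (BW_d C D n f) m (frag_of s) = cochain_ext C D n f m (boundary C (Suc n) s)"
    using cochain_ext_BW_d[OF f P_chains_arr[OF P], of "frag_of s"] P by (simp add: P_d_eq)
  also have "\<dots> = \<one>\<^bsub>on_obj D m\<^esub>"
    by (rule cochain_ext_normalized[OF assms P_chains_arr[OF P] boundary_degenerate_upto[OF s]])
  finally show "cochain_ext C D (Suc n) (BW_d C D n f) m (frag_of s) = \<one>\<^bsub>on_obj D m\<^esub>" .
qed

lemma normalized_le: "n \<le> p \<Longrightarrow> normalized p n f \<longleftrightarrow> normalized n n f"
  by (simp add: normalized_def degenerate_upto_le_eq[of n p])

lemma BW_d_reduced:
  assumes "f \<in> carrier (reduced C D n)"
  shows "BW_d C D n f \<in> carrier (reduced C D (Suc n))"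
proof -
  have f: "f \<in> carrier (BW C D n)" "normalized n n f" using assms reduced_iff by blast+
  \<comment> \<open>Degree n has only n inner positions, so the bound may be raised to n + 1, which
    is what reducedness of the coboundary requires.\<close>
  have "normalized (Suc n) n f" using f(2) by (simp only: normalized_le[of n "Suc n" f] le_SucI order_refl)
  then have "normalized (Suc n) (Suc n) (BW_d C D n f)" by (rule normalized_BW_d[OF f(1)])
  then show ?thesis by (simp only: reduced_iff BW_d_closed[OF f(1)] simp_thms)
qed

text \<open>With h the pullback of f along the signed insertion, the value of
  \<open>BW_d C D k h\<close> at a basis element s is that of f at \<open>?E\<close>. The new
  cochain thus takes at s the value of f at \<open>?E + frag_of s\<close>. If s has an identity
  among the positions up to p, both summands lie where f already vanishes; otherwise the homotopy
  applies.\<close>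

lemma normalization_step:
  assumes f: "f \<in> carrier (BW C D (Suc k))" and nf: "normalized p (Suc k) f" and pk: "p \<le> k"
    and df: "BW_d C D (Suc k) f \<in> carrier (reduced C D (Suc (Suc k)))"
  obtains h where "h \<in> carrier (BW C D k)"
    "normalized (Suc p) (Suc k) (BW_d C D k h \<otimes>\<^bsub>BW C D (Suc k)\<^esub> f)"
proof
  let ?c = "- ((-1) ^ p) :: int"
  define h where "h = pullback C D k (Suc k) (insert_ide_op C ?c p) f"
  note op = natural_op_insert_ide_op[OF pk, of ?c]
  show h: "h \<in> carrier (BW C D k)" unfolding h_def by (rule pullback_closed[OF op f])
  note dh = BW_d_closed[OF h]
  show "normalized (Suc p) (Suc k) (BW_d C D k h \<otimes>\<^bsub>BW C D (Suc k)\<^esub> f)"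
    unfolding normalized_def
  proof (intro allI ballI)
    fix m s assume s: "s \<in> degenerate_upto C (Suc p) (Suc k) m"
    then have P: "s \<in> P_chains C (Suc k) m" by (rule subsetD[OF degenerate_upto_subset])
    note m = P_chains_arr[OF P]
    interpret G: comm_group "on_obj D m" by (rule D_comm_group[OF m])
    obtain A ls where sA: "s = (A, ls)" by (cases s)
    have PA: "(A, ls) \<in> P_chains C (Suc k) m" using P by (simp add: sA)
    let ?E = "frag_extend (insert_ide_op C ?c p) (boundary C (Suc k) s)"
    have kE: "Poly_Mapping.keys ?E \<subseteq> P_chains C (Suc k) m"
      using op by (intro keys_frag_extend_subset[OF _ boundary_P_chains[OF P]]) (simp add: natural_op_def)
    have "cochain_ext C D (Suc k) (BW_d C D k h) m (frag_of s) = cochain_ext C D k h m (boundary C (Suc k) s)"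
      using cochain_ext_BW_d[OF h m, of "frag_of s"] P by (simp add: P_d_eq)
    also have "\<dots> = cochain_ext C D (Suc k) f m ?E"
      unfolding h_def by (rule cochain_ext_pullback[OF op f m boundary_P_chains[OF P]])
    finally have "cochain_ext C D (Suc k) (BW_d C D k h \<otimes>\<^bsub>BW C D (Suc k)\<^esub> f) m (frag_of s) =
        cochain_ext C D (Suc k) f m ?E \<otimes>\<^bsub>on_obj D m\<^esub> cochain_ext C D (Suc k) f m (frag_of s)"
      using cochain_ext_mult[OF dh f m, of "frag_of s"] P by simp
    also have "\<dots> = \<one>\<^bsub>on_obj D m\<^esub>"
    proof (cases "s \<in> degenerate_upto C p (Suc k) m")
      case True
      have "Poly_Mapping.keys ?E \<subseteq> degenerate_upto C p (Suc k) m"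
      proof (rule keys_frag_extend_subset[OF _ boundary_degenerate_upto[OF True]])
        fix t assume "t \<in> degenerate_upto C p k m"
        then show "Poly_Mapping.keys (insert_ide_op C ?c p t) \<subseteq> degenerate_upto C p (Suc k) m"
          unfolding insert_ide_op_def using insert_ide_degenerate_upto[of "fst t" "snd t"] pk by (intro keys_cmul_of) simp
      qed
      then have "cochain_ext C D (Suc k) f m ?E = \<one>\<^bsub>on_obj D m\<^esub>"
        by (rule cochain_ext_normalized[OF f nf m])
      moreover have "cochain_ext C D (Suc k) f m (frag_of s) = \<one>\<^bsub>on_obj D m\<^esub>"
        using nf True by (simp add: normalized_def)
      ultimately show ?thesis by simp
    next
      case False
      have w: "ls ! Suc p \<in> ide C ` obj C"
      proof -
        obtain j where j: "1 \<le> j" "j \<le> Suc p" "j \<le> Suc k" "ls ! j \<in> ide C ` obj C"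
          using s by (auto simp: sA degenerate_upto_def)
        have "\<not> j \<le> p" using False DgI[OF PA j(1) _ j(3,4)] sA by blast
        then have "j = Suc p" using j(2) by simp
        then show ?thesis using j(4) by simp
      qed
      let ?B = "boundary C (Suc (Suc k)) (A, insert_ide C p ls)"
      \<comment> \<open>The value in question splits into two parts: f kills r, which is supported
        on chains with an early identity, and it kills the multiple of \<open>?B\<close>, because
        \<open>?B\<close> is the boundary of a degenerate chain and the coboundary of f is
        reduced.\<close>
      define r where "r = ?E + frag_of s - frag_cmul ((-1) ^ p) ?B"
      have r: "Poly_Mapping.keys r \<subseteq> degenerate_upto C p (Suc k) m"
        unfolding r_def sA by (rule homotopy_mod_degenerate_upto[OF PA pk w])
      have insP: "(A, insert_ide C p ls) \<in> P_chains C (Suc (Suc k)) m"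
        using insert_ide_P_chains[OF PA] pk by simp
      have "length ls = k + 3" "is_path C A ls" using PA by (simp_all add: P_chains_iff)
      then have "insert_ide C p ls ! Suc p \<in> ide C ` obj C"
        using pk path_nth_arr[of A ls p] by (simp add: nth_insert_ide src_obj)
      then have insD: "(A, insert_ide C p ls) \<in> degenerate_upto C (Suc (Suc k)) (Suc (Suc k)) m"
        using insP pk by (intro DgI[of _ _ _ _ _ "Suc p"]) auto
      have B: "Poly_Mapping.keys ?B \<subseteq> P_chains C (Suc k) m" by (rule boundary_P_chains[OF insP])
      have "cochain_ext C D (Suc k) f m ?B = cochain_ext C D (Suc (Suc k)) (BW_d C D (Suc k) f) m (frag_of (A, insert_ide C p ls))"
        using cochain_ext_BW_d[OF f m, of "frag_of (A, insert_ide C p ls)"] insP by (simp add: P_d_eq)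
      also have "\<dots> = \<one>\<^bsub>on_obj D m\<^esub>"
      proof -
        have "normalized (Suc (Suc k)) (Suc (Suc k)) (BW_d C D (Suc k) f)"
          using df reduced_iff by blast
        then show ?thesis using insD unfolding normalized_def by blast
      qed
      finally have evB: "cochain_ext C D (Suc k) f m (frag_cmul ((-1) ^ p) ?B) = \<one>\<^bsub>on_obj D m\<^esub>"
        using hom_free_cmul[OF D_group[OF m] cochain_ext_hom[OF f m] B] by simp
      define Y where "Y = frag_cmul ((-1) ^ p) ?B"
      have Y: "Poly_Mapping.keys Y \<subseteq> P_chains C (Suc k) m"
        unfolding Y_def by (rule keys_cmul_subset[OF B])
      have Er: "?E + frag_of s = r + Y" by (simp add: r_def Y_def)
      have "cochain_ext C D (Suc k) f m ?E \<otimes>\<^bsub>on_obj D m\<^esub> cochain_ext C D (Suc k) f m (frag_of s) =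
          cochain_ext C D (Suc k) f m (?E + frag_of s)"
        using hom_mult[OF cochain_ext_hom[OF f m], of ?E "frag_of s"] kE P by simp
      also have "\<dots> = cochain_ext C D (Suc k) f m r \<otimes>\<^bsub>on_obj D m\<^esub> cochain_ext C D (Suc k) f m Y"
        unfolding Er using hom_mult[OF cochain_ext_hom[OF f m], of r Y] subset_trans[OF r degenerate_upto_subset] Y by simp
      also have "\<dots> = \<one>\<^bsub>on_obj D m\<^esub>"
        unfolding evB[folded Y_def] cochain_ext_normalized[OF f nf m r] by simp
      finally show ?thesis .
    qed
    finally show "cochain_ext C D (Suc k) (BW_d C D k h \<otimes>\<^bsub>BW C D (Suc k)\<^esub> f) m (frag_of s) = \<one>\<^bsub>on_obj D m\<^esub>" .
  qed
qed

lemma BW_l_one: "f \<in> carrier (BW C D n) \<Longrightarrow> \<one>\<^bsub>BW C D n\<^esub> \<otimes>\<^bsub>BW C D n\<^esub> f = f"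
  by (rule monoid.l_one[OF group.is_monoid[OF comm_group.axioms(2)[OF BW_comm_group]]])

lemma coboundaries_BW:
  assumes "c \<in> coboundaries (BW C D) (BW_d C D) n"
  shows "c \<in> carrier (BW C D n)" and "BW_d C D n c = \<one>\<^bsub>BW C D (Suc n)\<^esub>"
  using subgroup.subset[OF subgroup_coboundaries[OF BW_complex]] assms by (auto simp: kernel_def)

lemma coboundaries_BW_mult:
  assumes "c \<in> coboundaries (BW C D) (BW_d C D) n" "c' \<in> coboundaries (BW C D) (BW_d C D) n"
  shows "c \<otimes>\<^bsub>BW C D n\<^esub> c' \<in> coboundaries (BW C D) (BW_d C D) n"
  using subgroup.m_closed[OF subgroup_coboundaries[OF BW_complex] assms] by simp

lemma normalized_0: "normalized 0 n f"
  by (simp add: normalized_def degenerate_upto_def)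

text \<open>Induction on the number of treated positions, collecting the corrections in one
  coboundary c. The condition for p = 0 is empty, which also settles n = 0 with a trivial
  correction.\<close>

lemma normalization:
  assumes f: "f \<in> carrier (BW C D n)"
    and df: "BW_d C D n f \<in> carrier (reduced C D (Suc n))"
  obtains c where "c \<in> coboundaries (BW C D) (BW_d C D) n" "c \<otimes>\<^bsub>BW C D n\<^esub> f \<in> carrier (reduced C D n)"
proof -
  have "\<exists>c \<in> coboundaries (BW C D) (BW_d C D) n. normalized p n (c \<otimes>\<^bsub>BW C D n\<^esub> f)" if "p \<le> n" for p
    using that
  proof (induction p)
    case 0
    have "\<one>\<^bsub>BW C D n\<^esub> \<in> coboundaries (BW C D) (BW_d C D) n"
      using subgroup.one_closed[OF subgroup_coboundaries[OF BW_complex]] by simp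
    then show ?case using normalized_0 by blast
  next
    case (Suc p)
    then obtain c where c: "c \<in> coboundaries (BW C D) (BW_d C D) n"
        "normalized p n (c \<otimes>\<^bsub>BW C D n\<^esub> f)"
      by auto
    obtain k where k: "n = Suc k" "p \<le> k" using Suc.prems by (cases n) auto
    note cB = coboundaries_BW[OF c(1)]
    \<comment> \<open>Coboundaries are cocycles, so the corrected cochain still has the reduced
      coboundary that the next step demands.\<close>
    have "BW_d C D n (c \<otimes>\<^bsub>BW C D n\<^esub> f) = BW_d C D n f"
      using hom_mult[OF BW_d_hom cB(1) f] cB(2) BW_l_one[OF BW_d_closed[OF f]] by simp
    then obtain h where h: "h \<in> carrier (BW C D k)"
        "normalized (Suc p) n (BW_d C D k h \<otimes>\<^bsub>BW C D n\<^esub> (c \<otimes>\<^bsub>BW C D n\<^esub> f))"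
      using normalization_step[of "c \<otimes>\<^bsub>BW C D n\<^esub> f" k p] BW_mult_closed[OF cB(1) f] c(2) k df by auto
    have "BW_d C D k h \<in> coboundaries (BW C D) (BW_d C D) n" using h(1) k by simp
    moreover have "BW_d C D k h \<otimes>\<^bsub>BW C D n\<^esub> (c \<otimes>\<^bsub>BW C D n\<^esub> f) = (BW_d C D k h \<otimes>\<^bsub>BW C D n\<^esub> c) \<otimes>\<^bsub>BW C D n\<^esub> f"
      using monoid.m_assoc[OF group.is_monoid[OF comm_group.axioms(2)[OF BW_comm_group]] _ cB(1) f]
        BW_d_closed[OF h(1)] k by simp
    ultimately show ?case
      using coboundaries_BW_mult[OF _ c(1)] h(2) by auto
  qed
  then obtain c where "c \<in> coboundaries (BW C D) (BW_d C D) n" "normalized n n (c \<otimes>\<^bsub>BW C D n\<^esub> f)"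
    by blast
  then show ?thesis
    using that BW_mult_closed[OF coboundaries_BW(1) f] reduced_iff by blast
qed

section \<open>The reduced complex and its inclusion into the Baues--Wirsching complex\<close>

lemma subgroup_reduced: "subgroup (carrier (reduced C D n)) (BW C D n)"
proof (rule subgroup.intro)
  interpret B: comm_group "BW C D n" by (rule BW_comm_group)
  show "carrier (reduced C D n) \<subseteq> carrier (BW C D n)" using reduced_BW by blast
  show "x \<otimes>\<^bsub>BW C D n\<^esub> y \<in> carrier (reduced C D n)"
    if "x \<in> carrier (reduced C D n)" "y \<in> carrier (reduced C D n)" for x y
    using that normalized_mult[of x n y n] BW_mult_closed[of x n y] by (simp only: reduced_iff simp_thms)
  show "\<one>\<^bsub>BW C D n\<^esub> \<in> carrier (reduced C D n)"
    using BW_one_closed by (simp add: reduced_def one_BW)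
  show "inv\<^bsub>BW C D n\<^esub> x \<in> carrier (reduced C D n)" if x: "x \<in> carrier (reduced C D n)" for x
  proof -
    have xB: "x \<in> carrier (BW C D n)" by (rule reduced_BW[OF x])
    have "(inv\<^bsub>BW C D n\<^esub> x) s = \<one>\<^bsub>on_obj D (composite C s)\<^esub>" if "s \<in> nchains C n" "degenerate C s" for s
    proof -
      interpret G: group "on_obj D (composite C s)" by (rule D_group[OF composite_nchains[OF that(1)]])
      have inv: "inv\<^bsub>BW C D n\<^esub> x = (\<lambda>s \<in> nchains C n. inv\<^bsub>on_obj D (composite C s)\<^esub> x s)"
        using xB unfolding BW_def carrier_product_group
        by (rule inv_product_group) (rule D_group[OF composite_nchains])
      have "x s = \<one>\<^bsub>on_obj D (composite C s)\<^esub>" using x that by (simp add: reduced_def)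
      then show ?thesis unfolding inv using that(1) by simp
    qed
    then show ?thesis using B.inv_closed[OF xB] by (simp add: reduced_def)
  qed
qed

lemma mult_reduced: "(\<otimes>\<^bsub>reduced C D n\<^esub>) = (\<otimes>\<^bsub>BW C D n\<^esub>)" and one_reduced: "\<one>\<^bsub>reduced C D n\<^esub> = \<one>\<^bsub>BW C D n\<^esub>"
  by (simp_all add: reduced_def)

lemma reduced_comm_group: "comm_group (reduced C D n)"
proof -
  interpret B: comm_group "BW C D n" by (rule BW_comm_group)
  have "reduced C D n = (BW C D n)\<lparr>carrier := carrier (reduced C D n)\<rparr>" by (simp add: reduced_def)
  then have g: "group (reduced C D n)"
    using subgroup.subgroup_is_group[OF subgroup_reduced B.is_group] by metis
  show ?thesis
    by (rule group.group_comm_groupI[OF g]) (simp add: mult_reduced B.m_comm reduced_BW)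
qed

lemma reduced_complex: "cochain_complex (reduced C D) (BW_d C D)"
  unfolding cochain_complex_def
proof (intro allI conjI ballI)
  fix n
  show "comm_group (reduced C D n)" by (rule reduced_comm_group)
  show "BW_d C D n \<in> hom (reduced C D n) (reduced C D (Suc n))"
    by (rule homI) (simp_all add: BW_d_reduced mult_reduced hom_mult[OF BW_d_hom] reduced_BW)
  show "BW_d C D (Suc n) (BW_d C D n x) = \<one>\<^bsub>reduced C D (Suc (Suc n))\<^esub>"
    if "x \<in> carrier (reduced C D n)" for x
    using BW_d_BW_d[OF reduced_BW[OF that]] by (simp add: one_reduced)
qed

text \<open>Normalization is used twice. For surjectivity it is applied to a cocycle. For
  injectivity it is applied to some g whose coboundary x is reduced but need not vanish; the
  normalized g has the same coboundary, so x bounds in the reduced complex. This second use is the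
  reason for assuming only a reduced coboundary.\<close>

lemma cohomology_reduced: "cohomology (reduced C D) (BW_d C D) n \<cong> cohomology (BW C D) (BW_d C D) n"
proof (rule cohomology_isoI[OF reduced_complex BW_complex, where h = "\<lambda>_ x. x"])
  show "(\<lambda>x. x) \<in> hom (reduced C D n) (BW C D n)" for n
    by (rule homI) (simp_all add: reduced_BW mult_reduced)
next
  interpret B: comm_group "BW C D n" by (rule BW_comm_group)
  fix z assume z: "z \<in> carrier (BW C D n)" "BW_d C D n z = \<one>\<^bsub>BW C D (Suc n)\<^esub>"
  then have "BW_d C D n z \<in> carrier (reduced C D (Suc n))"
    using subgroup.one_closed[OF subgroup_reduced] by simp
  then obtain c where c: "c \<in> coboundaries (BW C D) (BW_d C D) n"
      "c \<otimes>\<^bsub>BW C D n\<^esub> z \<in> carrier (reduced C D n)"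
    by (rule normalization[OF z(1)])
  note cB = coboundaries_BW[OF c(1)]
  \<comment> \<open>Coboundaries are known to form a subgroup of the group of cocycles. Inverses
    there have to be identified with inverses in \<open>BW C D n\<close>.\<close>
  have ker: "subgroup (kernel (BW C D n) (BW C D (Suc n)) (BW_d C D n)) (BW C D n)"
    using BW_d_hom comm_group.axioms(2)[OF BW_comm_group]
    by (intro group_hom.subgroup_kernel) (simp add: group_hom_def group_hom_axioms_def)
  have "c \<in> kernel (BW C D n) (BW C D (Suc n)) (BW_d C D n)" using cB by (simp add: kernel_def)
  then have ic: "inv\<^bsub>BW C D n\<^esub> c \<in> coboundaries (BW C D) (BW_d C D) n"
    using subgroup.m_inv_closed[OF subgroup_coboundaries[OF BW_complex] c(1)] B.m_inv_consistent[OF ker] by simp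
  have "BW_d C D n (c \<otimes>\<^bsub>BW C D n\<^esub> z) = \<one>\<^bsub>BW C D (Suc n)\<^esub>"
    using hom_mult[OF BW_d_hom cB(1) z(1)] cB(2) z(2) BW_l_one[OF BW_one_closed] by simp
  moreover have "z = inv\<^bsub>BW C D n\<^esub> c \<otimes>\<^bsub>BW C D n\<^esub> (c \<otimes>\<^bsub>BW C D n\<^esub> z)"
    using cB(1) z(1) by (simp add: B.inv_solve_left)
  ultimately show "\<exists>x \<in> carrier (reduced C D n). \<exists>c \<in> coboundaries (BW C D) (BW_d C D) n.
      BW_d C D n x = \<one>\<^bsub>reduced C D (Suc n)\<^esub> \<and> z = c \<otimes>\<^bsub>BW C D n\<^esub> x"
    using c(2) ic by (auto simp: one_reduced)
next
  fix x assume x: "x \<in> carrier (reduced C D n)" "x \<in> coboundaries (BW C D) (BW_d C D) n"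
  show "x \<in> coboundaries (reduced C D) (BW_d C D) n"
  proof (cases n)
    case 0
    then show ?thesis using x by (simp add: one_reduced)
  next
    case (Suc k)
    then obtain g where g: "g \<in> carrier (BW C D k)" "x = BW_d C D k g" using x by auto
    then obtain c where c: "c \<in> coboundaries (BW C D) (BW_d C D) k"
        "c \<otimes>\<^bsub>BW C D k\<^esub> g \<in> carrier (reduced C D k)"
      using normalization[OF g(1)] x(1) Suc by blast
    note cB = coboundaries_BW[OF c(1)]
    have "BW_d C D k (c \<otimes>\<^bsub>BW C D k\<^esub> g) = x"
      using hom_mult[OF BW_d_hom cB(1) g(1)] cB(2) g(2) BW_l_one[OF BW_d_closed[OF g(1)]] by simp
    then show ?thesis using c(2) Suc by auto
  qed
qed simp

end

section \<open>Natural transformations out of the quotients\<close>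

definition P_class :: "('o, 'm) cat \<Rightarrow> nat \<Rightarrow> 'm \<Rightarrow> (('o, 'm) chain \<Rightarrow>\<^sub>0 int) \<Rightarrow> (('o, 'm) chain \<Rightarrow>\<^sub>0 int) set"
  where "P_class C n m x = P_deg C n m #>\<^bsub>P_grp C n m\<^esub> x"

lemma carrier_Pt: "carrier (on_obj (Pt C n) m) = P_class C n m ` carrier (P_grp C n m)"
  by (simp add: Pt_def carrier_FactGroup P_class_def[abs_def])

lemma P_grp_comm_group: "comm_group (P_grp C n m)"
  unfolding P_grp_def by (rule abelian_free_Abelian_group)

lemma P_grp_group: "group (P_grp C n m)"
  unfolding P_grp_def by simp

lemma yoneda_eq: "yoneda C n \<eta> = (\<lambda>s \<in> nchains C n. \<eta> (composite C s) (P_class C n (composite C s) (frag_of (pad_ide C s))))"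
  unfolding yoneda_def P_class_def pad_ide_def Let_def by (rule restrict_ext) auto

context small_category
begin

lemma P_deg_eq: "P_deg C n m = carrier (free_Abelian_group (degenerate_upto C n n m))"
proof -
  have "{s \<in> nchains C (n + 2). composite C s = m \<and> degenerate C (middle C s)} = degenerate_upto C n n m"
  proof
    show "{s \<in> nchains C (n + 2). composite C s = m \<and> degenerate C (middle C s)} \<subseteq> degenerate_upto C n n m"
    proof
      fix s assume "s \<in> {s \<in> nchains C (n + 2). composite C s = m \<and> degenerate C (middle C s)}"
      then have "s \<in> P_chains C n m" "degenerate C (middle C s)" by (simp_all add: P_chains_def)
      then show "s \<in> degenerate_upto C n n m" using degenerate_middle_iff by blast
    qed
    show "degenerate_upto C n n m \<subseteq> {s \<in> nchains C (n + 2). composite C s = m \<and> degenerate C (middle C s)}"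
    proof
      fix s assume s: "s \<in> degenerate_upto C n n m"
      have P: "s \<in> P_chains C n m" by (rule subsetD[OF degenerate_upto_subset s])
      then show "s \<in> {s \<in> nchains C (n + 2). composite C s = m \<and> degenerate C (middle C s)}"
        using degenerate_middle_iff[OF P] s by (simp add: P_chains_def)
    qed
  qed
  then show ?thesis by (simp add: P_deg_def)
qed

lemma P_deg_subgroup: "subgroup (P_deg C n m) (P_grp C n m)"
proof -
  have "subgroup (carrier (free_Abelian_group T)) (free_Abelian_group S)" if "T \<subseteq> S" for S T :: "('o, 'm) chain set"
  proof (rule group.subgroupI)
    have "0 \<in> carrier (free_Abelian_group T)" by simp
    then show "carrier (free_Abelian_group T) \<noteq> {}" by blast
    fix x assume "x \<in> carrier (free_Abelian_group T)"
    then have x: "Poly_Mapping.keys x \<subseteq> T" by simp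
    then have "Poly_Mapping.keys x \<subseteq> S" using that by blast
    then show "inv\<^bsub>free_Abelian_group S\<^esub> x \<in> carrier (free_Abelian_group T)" using x by simp
    fix y assume "y \<in> carrier (free_Abelian_group T)"
    then show "x \<otimes>\<^bsub>free_Abelian_group S\<^esub> y \<in> carrier (free_Abelian_group T)"
      using x keys_add_subset[of x T y] by simp
  qed (use that in auto)
  from this[OF degenerate_upto_subset] show ?thesis
    unfolding P_deg_eq P_grp_eq .
qed

lemma P_deg_normal: "P_deg C n m \<lhd> P_grp C n m"
  by (simp add: comm_group.normal_iff_subgroup[OF P_grp_comm_group] P_deg_subgroup)

lemma Pt_group: "group (on_obj (Pt C n) m)"
  unfolding Pt_def by (simp add: normal.factorgroup_is_group[OF P_deg_normal])

lemma P_class_hom: "P_class C n m \<in> hom (P_grp C n m) (on_obj (Pt C n) m)"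
  unfolding Pt_def P_class_def[abs_def] using normal.r_coset_hom_Mod[OF P_deg_normal] by simp

lemma P_act_degenerate_upto:
  assumes g: "(l, a, b, m) \<in> arr (FC C)" and s: "(A, ls) \<in> degenerate_upto C n n l"
  shows "(tgt C a, act_list C a b ls) \<in> degenerate_upto C n n m"
proof -
  have P: "(A, ls) \<in> P_chains C n l" by (rule subsetD[OF degenerate_upto_subset s])
  show ?thesis
    using degenerate_middle_iff[OF P] degenerate_middle_iff[OF act_list_P_chains(1)[OF g P]] s
    by (simp add: act_list_P_chains(2)[OF g P])
qed

lemma Pt_on_arr:
  assumes g: "(l, a, b, m) \<in> arr (FC C)" and x: "x \<in> carrier (P_grp C n l)"
  shows "on_arr (Pt C n) (l, a, b, m) (P_class C n l x) = P_class C n m (P_act C (l, a, b, m) x)"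
proof -
  have "P_act C (l, a, b, m) ` P_deg C n l \<subseteq> P_deg C n m"
  proof
    fix y assume "y \<in> P_act C (l, a, b, m) ` P_deg C n l"
    then obtain z where z: "Poly_Mapping.keys z \<subseteq> degenerate_upto C n n l" "y = P_act C (l, a, b, m) z"
      by (auto simp: P_deg_eq)
    have "Poly_Mapping.keys (frag_extend (\<lambda>s. P_act C (l, a, b, m) (frag_of s)) z) \<subseteq> degenerate_upto C n n m"
      using P_act_degenerate_upto[OF g] by (intro keys_frag_extend_subset[OF _ z(1)]) (auto simp: P_act_of)
    then have "Poly_Mapping.keys y \<subseteq> degenerate_upto C n n m"
      unfolding z(2) by (subst P_act_extend)
    then show "y \<in> P_deg C n m" by (simp add: P_deg_eq)
  qed
  then have "quot_map (P_grp C n m) (P_deg C n m) (P_act C (l, a, b, m)) (P_deg C n l #>\<^bsub>P_grp C n l\<^esub> x) =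
      P_deg C n m #>\<^bsub>P_grp C n m\<^esub> P_act C (l, a, b, m) x"
    by (rule quot_map_coset[OF P_grp_group P_grp_group P_deg_subgroup P_deg_subgroup P_act_hom[OF g] _ x])
  then show ?thesis by (simp add: Pt_def P_class_def FC_simps)
qed

lemma Pt_d_P_class:
  assumes x: "x \<in> carrier (P_grp C (Suc n) m)"
  shows "Pt_d C n m (P_class C (Suc n) m x) = P_class C n m (P_d C (Suc n) x)"
proof -
  have "P_d C (Suc n) ` P_deg C (Suc n) m \<subseteq> P_deg C n m"
  proof
    fix y assume "y \<in> P_d C (Suc n) ` P_deg C (Suc n) m"
    then obtain z where z: "Poly_Mapping.keys z \<subseteq> degenerate_upto C (Suc n) (Suc n) m" "y = frag_extend (boundary C (Suc n)) z"
      by (auto simp: P_deg_eq P_d_eq)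
    \<comment> \<open>The boundary keeps the bound n + 1 of the higher degree; in degree n it means
      the same as n.\<close>
    have "Poly_Mapping.keys y \<subseteq> degenerate_upto C (Suc n) n m"
      unfolding z(2) by (rule keys_frag_extend_subset[OF boundary_degenerate_upto z(1)])
    then show "y \<in> P_deg C n m" by (simp add: P_deg_eq degenerate_upto_le_eq[of n "Suc n"])
  qed
  then show ?thesis
    unfolding Pt_d_def P_class_def
    by (rule quot_map_coset[OF P_grp_group P_grp_group P_deg_subgroup P_deg_subgroup P_d_hom _ x])
qed

end

section \<open>The Yoneda lemma for the quotient functors\<close>

context natural_coefficients
begin

lemma NatP_iff:
  "\<eta> \<in> carrier (NatP C D n) \<longleftrightarrow>
    \<eta> \<in> (\<Pi>\<^sub>E m \<in> arr C. hom (on_obj (Pt C n) m) (on_obj D m) \<inter> extensional (carrier (on_obj (Pt C n) m))) \<and>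
    (\<forall>l a b m. (l, a, b, m) \<in> arr (FC C) \<longrightarrow> (\<forall>X \<in> carrier (on_obj (Pt C n) l).
      \<eta> m (on_arr (Pt C n) (l, a, b, m) X) = on_arr D (l, a, b, m) (\<eta> l X)))"
  unfolding NatP_def Nat_group_def by (auto simp: FC_simps)

lemma NatP_hom: "\<eta> \<in> carrier (NatP C D n) \<Longrightarrow> m \<in> arr C \<Longrightarrow> \<eta> m \<in> hom (on_obj (Pt C n) m) (on_obj D m)"
  unfolding NatP_iff by blast

lemma NatP_eqI:
  assumes "\<eta> \<in> carrier (NatP C D n)"
    and "\<theta> \<in> extensional (arr C)" "\<And>m. m \<in> arr C \<Longrightarrow> \<theta> m \<in> extensional (carrier (on_obj (Pt C n) m))"
    and "\<And>m x. m \<in> arr C \<Longrightarrow> x \<in> carrier (P_grp C n m) \<Longrightarrow> \<eta> m (P_class C n m x) = \<theta> m (P_class C n m x)"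
  shows "\<eta> = \<theta>"
proof (rule extensionalityI)
  have *: "\<eta> \<in> (\<Pi>\<^sub>E m \<in> arr C. hom (on_obj (Pt C n) m) (on_obj D m) \<inter> extensional (carrier (on_obj (Pt C n) m)))"
    using assms(1) unfolding NatP_iff by blast
  then show "\<eta> \<in> extensional (arr C)" by (simp add: PiE_def)
  show "\<theta> \<in> extensional (arr C)" by fact
  fix m assume m: "m \<in> arr C"
  show "\<eta> m = \<theta> m"
  proof (rule extensionalityI)
    show "\<eta> m \<in> extensional (carrier (on_obj (Pt C n) m))" using PiE_mem[OF * m] by blast
    show "\<theta> m \<in> extensional (carrier (on_obj (Pt C n) m))" by (rule assms(3)[OF m])
    fix X assume "X \<in> carrier (on_obj (Pt C n) m)"
    then show "\<eta> m X = \<theta> m X" using assms(4)[OF m] by (auto simp: carrier_Pt)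
  qed
qed

lemma pad_ide_P_grp: "s \<in> nchains C n \<Longrightarrow> frag_of (pad_ide C s) \<in> carrier (P_grp C n (composite C s))"
  using pad_ide_P_chains by (simp add: P_grp_eq)

lemma yoneda_BW:
  assumes "\<eta> \<in> carrier (NatP C D n)"
  shows "yoneda C n \<eta> \<in> carrier (BW C D n)"
proof -
  have "\<eta> (composite C s) (P_class C n (composite C s) (frag_of (pad_ide C s))) \<in> carrier (on_obj D (composite C s))"
    if s: "s \<in> nchains C n" for s
    by (rule hom_in_carrier[OF NatP_hom[OF assms composite_nchains[OF s]] hom_in_carrier[OF P_class_hom pad_ide_P_grp[OF s]]])
  then show ?thesis unfolding yoneda_eq BW_def by simp
qed

text \<open>On a basis element both sides carry the value at the padded middle along the same arrow,
  by naturality of \<eta> on the left and by construction of the extension on the right. Freeness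
  does the rest, and \<eta> is recovered from its Yoneda cochain.\<close>

lemma NatP_P_class:
  assumes \<eta>: "\<eta> \<in> carrier (NatP C D n)" and m: "m \<in> arr C" and x: "x \<in> carrier (P_grp C n m)"
  shows "\<eta> m (P_class C n m x) = cochain_ext C D n (yoneda C n \<eta>) m x"
proof -
  have "(\<eta> m \<circ> P_class C n m) x = cochain_ext C D n (yoneda C n \<eta>) m x"
  proof (rule hom_free_eqI[OF D_group[OF m] _ cochain_ext_hom[OF yoneda_BW[OF \<eta>] m]])
    show "\<eta> m \<circ> P_class C n m \<in> hom (free_Abelian_group (P_chains C n m)) (on_obj D m)"
      by (rule hom_compose[OF P_class_hom[of n m, unfolded P_grp_eq] NatP_hom[OF \<eta> m]])
    show "Poly_Mapping.keys x \<subseteq> P_chains C n m" using x by (simp add: P_grp_eq)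
    fix s assume s: "s \<in> P_chains C n m"
    let ?t = "middle C s" and ?g = "(composite C (middle C s), hd (snd s), last (snd s), m)"
    have t: "?t \<in> nchains C n" by (rule middle_nchains[OF s])
    have g: "?g \<in> arr (FC C)" by (rule P_chain_arr_FC[OF s])
    have "P_class C n m (frag_of s) = on_arr (Pt C n) ?g (P_class C n (composite C ?t) (frag_of (pad_ide C ?t)))"
      unfolding Pt_on_arr[OF g pad_ide_P_grp[OF t]] P_act_pad_ide_middle[OF s] ..
    then have "\<eta> m (P_class C n m (frag_of s)) = on_arr D ?g (\<eta> (composite C ?t) (P_class C n (composite C ?t) (frag_of (pad_ide C ?t))))"
      using \<eta>[unfolded NatP_iff] g hom_in_carrier[OF P_class_hom pad_ide_P_grp[OF t]] by simp
    then show "(\<eta> m \<circ> P_class C n m) (frag_of s) = cochain_ext C D n (yoneda C n \<eta>) m (frag_of s)"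
      unfolding cochain_ext_of[OF yoneda_BW[OF \<eta>] s] using t by (simp add: yoneda_eq)
  qed
  then show ?thesis by simp
qed

text \<open>A degenerate basis element represents the unit of the quotient, which \<eta> has to
  preserve.\<close>

lemma yoneda_reduced:
  assumes \<eta>: "\<eta> \<in> carrier (NatP C D n)"
  shows "yoneda C n \<eta> \<in> carrier (reduced C D n)"
proof -
  have "normalized n n (yoneda C n \<eta>)"
    unfolding normalized_def
  proof (intro allI ballI)
    fix m s assume s: "s \<in> degenerate_upto C n n m"
    have P: "s \<in> P_chains C n m" by (rule subsetD[OF degenerate_upto_subset s])
    note m = P_chains_arr[OF P]
    have x: "frag_of s \<in> carrier (P_grp C n m)" using P by (simp add: P_grp_eq)
    have "frag_of s \<in> P_deg C n m" using s by (simp add: P_deg_eq)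
    then have "P_class C n m (frag_of s) = P_deg C n m"
      unfolding P_class_def by (rule group.coset_join2[OF P_grp_group x P_deg_subgroup])
    then have "P_class C n m (frag_of s) = \<one>\<^bsub>on_obj (Pt C n) m\<^esub>" by (simp add: Pt_def)
    then have "\<eta> m (P_class C n m (frag_of s)) = \<one>\<^bsub>on_obj D m\<^esub>"
      using hom_one[OF NatP_hom[OF \<eta> m] Pt_group D_group[OF m]] by simp
    then show "cochain_ext C D n (yoneda C n \<eta>) m (frag_of s) = \<one>\<^bsub>on_obj D m\<^esub>"
      by (simp only: NatP_P_class[OF \<eta> m x])
  qed
  then show ?thesis using yoneda_BW[OF \<eta>] by (simp only: reduced_iff simp_thms)
qed

lemma yoneda_inject:
  assumes "\<eta> \<in> carrier (NatP C D n)" "\<theta> \<in> carrier (NatP C D n)" "yoneda C n \<eta> = yoneda C n \<theta>"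
  shows "\<eta> = \<theta>"
proof (rule NatP_eqI[OF assms(1)])
  have *: "\<theta> \<in> (\<Pi>\<^sub>E m \<in> arr C. hom (on_obj (Pt C n) m) (on_obj D m) \<inter> extensional (carrier (on_obj (Pt C n) m)))"
    using assms(2) unfolding NatP_iff by blast
  then show "\<theta> \<in> extensional (arr C)" by (simp add: PiE_def)
  show "\<theta> m \<in> extensional (carrier (on_obj (Pt C n) m))" if "m \<in> arr C" for m
    using PiE_mem[OF * that] by blast
  show "\<eta> m (P_class C n m x) = \<theta> m (P_class C n m x)" if "m \<in> arr C" "x \<in> carrier (P_grp C n m)" for m x
    unfolding NatP_P_class[OF assms(1) that] NatP_P_class[OF assms(2) that] assms(3) ..
qed

text \<open>Sums, units and differentials of natural transformations are all shown to be natural by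
  comparing them with the transformation that a reduced cochain induces.\<close>

lemma NatP_of_reduced:
  assumes f: "f \<in> carrier (reduced C D n)"
    and \<phi>: "\<And>m x. m \<in> arr C \<Longrightarrow> x \<in> carrier (P_grp C n m) \<Longrightarrow> \<phi> m (P_class C n m x) = cochain_ext C D n f m x"
  defines "\<eta> \<equiv> \<lambda>m \<in> arr C. \<lambda>X \<in> carrier (on_obj (Pt C n) m). \<phi> m X"
  shows "\<eta> \<in> carrier (NatP C D n)" and "yoneda C n \<eta> = f"
proof -
  have fB: "f \<in> carrier (BW C D n)" by (rule reduced_BW[OF f])
  have \<eta>_P_class: "\<eta> m (P_class C n m x) = cochain_ext C D n f m x" if "m \<in> arr C" "x \<in> carrier (P_grp C n m)" for m x
    using that \<phi>[OF that] hom_in_carrier[OF P_class_hom that(2)] by (simp add: \<eta>_def)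
  have hom: "\<eta> m \<in> hom (on_obj (Pt C n) m) (on_obj D m)" if m: "m \<in> arr C" for m
  proof (rule homI)
    fix X assume "X \<in> carrier (on_obj (Pt C n) m)"
    then obtain x where x: "x \<in> carrier (P_grp C n m)" "X = P_class C n m x" by (auto simp: carrier_Pt)
    then show "\<eta> m X \<in> carrier (on_obj D m)"
      using \<eta>_P_class[OF m x(1)] cochain_ext_closed[OF fB m] by (simp add: P_grp_eq)
    fix Y assume "Y \<in> carrier (on_obj (Pt C n) m)"
    then obtain y where y: "y \<in> carrier (P_grp C n m)" "Y = P_class C n m y" by (auto simp: carrier_Pt)
    have xy: "x \<otimes>\<^bsub>P_grp C n m\<^esub> y \<in> carrier (P_grp C n m)"
      by (rule monoid.m_closed[OF group.is_monoid[OF P_grp_group] x(1) y(1)])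
    have "\<eta> m (X \<otimes>\<^bsub>on_obj (Pt C n) m\<^esub> Y) = \<eta> m (P_class C n m (x \<otimes>\<^bsub>P_grp C n m\<^esub> y))"
      unfolding x(2) y(2) hom_mult[OF P_class_hom x(1) y(1)] ..
    also have "\<dots> = cochain_ext C D n f m x \<otimes>\<^bsub>on_obj D m\<^esub> cochain_ext C D n f m y"
      unfolding \<eta>_P_class[OF m xy]
      by (rule hom_mult[OF cochain_ext_hom[OF fB m, folded P_grp_eq] x(1) y(1)])
    also have "\<dots> = \<eta> m X \<otimes>\<^bsub>on_obj D m\<^esub> \<eta> m Y"
      unfolding x(2) y(2) \<eta>_P_class[OF m x(1)] \<eta>_P_class[OF m y(1)] ..
    finally show "\<eta> m (X \<otimes>\<^bsub>on_obj (Pt C n) m\<^esub> Y) = \<eta> m X \<otimes>\<^bsub>on_obj D m\<^esub> \<eta> m Y" .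
  qed
  have nat: "\<eta> m (on_arr (Pt C n) (l, a, b, m) X) = on_arr D (l, a, b, m) (\<eta> l X)"
    if g: "(l, a, b, m) \<in> arr (FC C)" and X: "X \<in> carrier (on_obj (Pt C n) l)" for l a b m X
  proof -
    obtain x where x: "x \<in> carrier (P_grp C n l)" "X = P_class C n l x" using X by (auto simp: carrier_Pt)
    have lm: "l \<in> arr C" "m \<in> arr C" using g unfolding arr_FC by blast+
    have kx: "Poly_Mapping.keys x \<subseteq> P_chains C n l" using x(1) by (simp add: P_grp_eq)
    show ?thesis
      unfolding x(2) Pt_on_arr[OF g x(1)] \<eta>_P_class[OF lm(1) x(1)]
        \<eta>_P_class[OF lm(2) hom_in_carrier[OF P_act_hom[OF g] x(1)]] cochain_ext_natural[OF fB g kx] ..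
  qed
  have "\<eta> m \<in> extensional (carrier (on_obj (Pt C n) m))" if "m \<in> arr C" for m
    using that by (simp add: \<eta>_def)
  then have "\<eta> \<in> (\<Pi>\<^sub>E m \<in> arr C. hom (on_obj (Pt C n) m) (on_obj D m) \<inter> extensional (carrier (on_obj (Pt C n) m)))"
    using hom by (intro PiE_I) (simp_all add: \<eta>_def)
  then show \<eta>: "\<eta> \<in> carrier (NatP C D n)"
    unfolding NatP_iff using nat by blast
  show "yoneda C n \<eta> = f"
  proof (rule BW_eqI[OF yoneda_BW[OF \<eta>] fB])
    fix s assume s: "s \<in> nchains C n"
    show "yoneda C n \<eta> s = f s"
      unfolding yoneda_eq using s \<eta>_P_class[OF composite_nchains[OF s] pad_ide_P_grp[OF s]] cochain_ext_pad_ide[OF fB s] by simp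
  qed
qed

text \<open>The extension of a reduced cochain vanishes on \<open>P_deg\<close> and so factors
  through the quotient. The factors may be chosen separately for each m, since naturality is
  inherited from the extensions.\<close>

lemma yoneda_surj:
  assumes f: "f \<in> carrier (reduced C D n)"
  shows "\<exists>\<eta> \<in> carrier (NatP C D n). yoneda C n \<eta> = f"
proof -
  have fB: "f \<in> carrier (BW C D n)" and nf: "normalized n n f" using f reduced_iff by blast+
  have "\<exists>g. \<forall>x \<in> carrier (P_grp C n m). g (P_class C n m x) = cochain_ext C D n f m x" if m: "m \<in> arr C" for m
  proof -
    interpret e: group_hom "P_grp C n m" "on_obj D m" "cochain_ext C D n f m"
      using P_grp_group D_group[OF m] cochain_ext_hom[OF fB m]
      by (simp add: group_hom_def group_hom_axioms_def P_grp_eq)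
    have "P_deg C n m \<subseteq> kernel (P_grp C n m) (on_obj D m) (cochain_ext C D n f m)"
      using subgroup.subset[OF P_deg_subgroup] cochain_ext_normalized[OF fB nf m]
      by (auto simp: kernel_def P_deg_eq)
    then obtain g where "\<And>x. x \<in> carrier (P_grp C n m) \<Longrightarrow> g (P_deg C n m #>\<^bsub>P_grp C n m\<^esub> x) = cochain_ext C D n f m x"
      by (rule e.FactGroup_universal_kernel[OF P_deg_normal]) (rule that)
    then show ?thesis unfolding P_class_def by blast
  qed
  then obtain \<phi> where "\<And>m x. m \<in> arr C \<Longrightarrow> x \<in> carrier (P_grp C n m) \<Longrightarrow> \<phi> m (P_class C n m x) = cochain_ext C D n f m x"
    by metis
  then show ?thesis using NatP_of_reduced[OF f, of \<phi>] by blast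
qed

section \<open>Transport of the complex structure along the Yoneda map\<close>

lemma mult_NatP:
  "\<eta> \<otimes>\<^bsub>NatP C D n\<^esub> \<theta> =
    (\<lambda>m \<in> arr C. \<lambda>X \<in> carrier (on_obj (Pt C n) m). \<eta> m X \<otimes>\<^bsub>on_obj D m\<^esub> \<theta> m X)"
  by (simp add: NatP_def Nat_group_def FC_simps)

lemma one_NatP: "\<one>\<^bsub>NatP C D n\<^esub> = (\<lambda>m \<in> arr C. \<lambda>X \<in> carrier (on_obj (Pt C n) m). \<one>\<^bsub>on_obj D m\<^esub>)"
  by (simp add: NatP_def Nat_group_def FC_simps)

lemma yoneda_mult:
  assumes \<eta>: "\<eta> \<in> carrier (NatP C D n)" and \<theta>: "\<theta> \<in> carrier (NatP C D n)"
  shows "\<eta> \<otimes>\<^bsub>NatP C D n\<^esub> \<theta> \<in> carrier (NatP C D n)"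
    and "yoneda C n (\<eta> \<otimes>\<^bsub>NatP C D n\<^esub> \<theta>) = yoneda C n \<eta> \<otimes>\<^bsub>reduced C D n\<^esub> yoneda C n \<theta>"
proof -
  have r: "yoneda C n \<eta> \<otimes>\<^bsub>reduced C D n\<^esub> yoneda C n \<theta> \<in> carrier (reduced C D n)"
    unfolding mult_reduced
    by (rule subgroup.m_closed[OF subgroup_reduced yoneda_reduced[OF \<eta>] yoneda_reduced[OF \<theta>]])
  have "\<eta> m (P_class C n m x) \<otimes>\<^bsub>on_obj D m\<^esub> \<theta> m (P_class C n m x) =
      cochain_ext C D n (yoneda C n \<eta> \<otimes>\<^bsub>reduced C D n\<^esub> yoneda C n \<theta>) m x"
    if m: "m \<in> arr C" and x: "x \<in> carrier (P_grp C n m)" for m x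
    unfolding mult_reduced NatP_P_class[OF \<eta> m x] NatP_P_class[OF \<theta> m x]
    using x by (intro cochain_ext_mult[OF yoneda_BW[OF \<eta>] yoneda_BW[OF \<theta>] m, symmetric]) (simp add: P_grp_eq)
  note * = NatP_of_reduced[OF r, of "\<lambda>m X. \<eta> m X \<otimes>\<^bsub>on_obj D m\<^esub> \<theta> m X", OF this]
  show "\<eta> \<otimes>\<^bsub>NatP C D n\<^esub> \<theta> \<in> carrier (NatP C D n)"
    unfolding mult_NatP by (rule *(1))
  show "yoneda C n (\<eta> \<otimes>\<^bsub>NatP C D n\<^esub> \<theta>) = yoneda C n \<eta> \<otimes>\<^bsub>reduced C D n\<^esub> yoneda C n \<theta>"
    unfolding mult_NatP by (rule *(2))
qed

lemma yoneda_one: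
  shows "\<one>\<^bsub>NatP C D n\<^esub> \<in> carrier (NatP C D n)" and "yoneda C n \<one>\<^bsub>NatP C D n\<^esub> = \<one>\<^bsub>reduced C D n\<^esub>"
proof -
  have r: "\<one>\<^bsub>reduced C D n\<^esub> \<in> carrier (reduced C D n)"
    unfolding one_reduced by (rule subgroup.one_closed[OF subgroup_reduced])
  have "\<one>\<^bsub>on_obj D m\<^esub> = cochain_ext C D n \<one>\<^bsub>reduced C D n\<^esub> m x"
    if m: "m \<in> arr C" and x: "x \<in> carrier (P_grp C n m)" for m x
    unfolding one_reduced using x one_BW[OF middle_nchains]
    by (intro cochain_ext_trivial[OF BW_one_closed m order_refl, symmetric]) (simp_all add: P_grp_eq)
  note * = NatP_of_reduced[OF r, of "\<lambda>m X. \<one>\<^bsub>on_obj D m\<^esub>", OF this]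
  show "\<one>\<^bsub>NatP C D n\<^esub> \<in> carrier (NatP C D n)"
    unfolding one_NatP by (rule *(1))
  show "yoneda C n \<one>\<^bsub>NatP C D n\<^esub> = \<one>\<^bsub>reduced C D n\<^esub>"
    unfolding one_NatP by (rule *(2))
qed

lemma yoneda_NatP_d:
  assumes \<eta>: "\<eta> \<in> carrier (NatP C D n)"
  shows "NatP_d C n \<eta> \<in> carrier (NatP C D (Suc n))"
    and "yoneda C (Suc n) (NatP_d C n \<eta>) = BW_d C D n (yoneda C n \<eta>)"
proof -
  have r: "BW_d C D n (yoneda C n \<eta>) \<in> carrier (reduced C D (Suc n))"
    by (rule BW_d_reduced[OF yoneda_reduced[OF \<eta>]])
  have "\<eta> m (Pt_d C n m (P_class C (Suc n) m x)) = cochain_ext C D (Suc n) (BW_d C D n (yoneda C n \<eta>)) m x"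
    if m: "m \<in> arr C" and x: "x \<in> carrier (P_grp C (Suc n) m)" for m x
    unfolding Pt_d_P_class[OF x] NatP_P_class[OF \<eta> m hom_in_carrier[OF P_d_hom x]]
    using x by (intro cochain_ext_BW_d[OF yoneda_BW[OF \<eta>] m, symmetric]) (simp add: P_grp_eq)
  note * = NatP_of_reduced[OF r, of "\<lambda>m X. \<eta> m (Pt_d C n m X)", OF this]
  show "NatP_d C n \<eta> \<in> carrier (NatP C D (Suc n))"
    unfolding NatP_d_def FC_simps by (rule *(1))
  show "yoneda C (Suc n) (NatP_d C n \<eta>) = BW_d C D n (yoneda C n \<eta>)"
    unfolding NatP_d_def FC_simps by (rule *(2))
qed

text \<open>Injectivity of \<open>yoneda\<close> reflects the group laws from the reduced cochains,
  and surjectivity supplies the inverse, so no formula for inverses of transformations has to be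
  shown natural.\<close>

lemma NatP_comm_group: "comm_group (NatP C D n)"
proof -
  interpret R: comm_group "reduced C D n" by (rule reduced_comm_group)
  note mult = yoneda_mult and one = yoneda_one and inj = yoneda_inject and red = yoneda_reduced
  show ?thesis
  proof (rule comm_groupI)
    fix x y assume x: "x \<in> carrier (NatP C D n)" and y: "y \<in> carrier (NatP C D n)"
    show xy: "x \<otimes>\<^bsub>NatP C D n\<^esub> y \<in> carrier (NatP C D n)" by (rule mult(1)[OF x y])
    show "x \<otimes>\<^bsub>NatP C D n\<^esub> y = y \<otimes>\<^bsub>NatP C D n\<^esub> x"
      by (rule inj[OF xy mult(1)[OF y x]]) (simp only: mult(2)[OF x y] mult(2)[OF y x] R.m_comm[OF red[OF x] red[OF y]])
    fix z assume z: "z \<in> carrier (NatP C D n)"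
    have yz: "y \<otimes>\<^bsub>NatP C D n\<^esub> z \<in> carrier (NatP C D n)" by (rule mult(1)[OF y z])
    show "x \<otimes>\<^bsub>NatP C D n\<^esub> y \<otimes>\<^bsub>NatP C D n\<^esub> z = x \<otimes>\<^bsub>NatP C D n\<^esub> (y \<otimes>\<^bsub>NatP C D n\<^esub> z)"
      by (rule inj[OF mult(1)[OF xy z] mult(1)[OF x yz]])
        (simp only: mult(2)[OF xy z] mult(2)[OF x yz] mult(2)[OF x y] mult(2)[OF y z] R.m_assoc[OF red[OF x] red[OF y] red[OF z]])
  next
    show "\<one>\<^bsub>NatP C D n\<^esub> \<in> carrier (NatP C D n)" by (rule one(1))
  next
    fix x assume x: "x \<in> carrier (NatP C D n)"
    show "\<one>\<^bsub>NatP C D n\<^esub> \<otimes>\<^bsub>NatP C D n\<^esub> x = x"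
      by (rule inj[OF mult(1)[OF one(1) x] x]) (simp only: mult(2)[OF one(1) x] one(2) R.l_one[OF red[OF x]])
    obtain y where y: "y \<in> carrier (NatP C D n)" "yoneda C n y = inv\<^bsub>reduced C D n\<^esub> (yoneda C n x)"
      using yoneda_surj[OF R.inv_closed[OF red[OF x]]] by blast
    have "y \<otimes>\<^bsub>NatP C D n\<^esub> x = \<one>\<^bsub>NatP C D n\<^esub>"
      by (rule inj[OF mult(1)[OF y(1) x] one(1)]) (simp only: mult(2)[OF y(1) x] one(2) y(2) R.l_inv[OF red[OF x]])
    then show "\<exists>y \<in> carrier (NatP C D n). y \<otimes>\<^bsub>NatP C D n\<^esub> x = \<one>\<^bsub>NatP C D n\<^esub>" using y(1) by blast
  qed
qed

text \<open>Additivity of the differential and the vanishing of its square become statements about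
  \<open>BW_d\<close> after applying \<open>yoneda\<close>; injectivity brings them back.\<close>

lemma NatP_complex: "cochain_complex (NatP C D) (NatP_d C)"
  unfolding cochain_complex_def
proof (intro allI conjI ballI)
  fix n
  show "comm_group (NatP C D n)" by (rule NatP_comm_group)
  show "NatP_d C n \<in> hom (NatP C D n) (NatP C D (Suc n))"
  proof (rule homI)
    fix x y assume x: "x \<in> carrier (NatP C D n)" and y: "y \<in> carrier (NatP C D n)"
    note dx = yoneda_NatP_d[OF x] and dy = yoneda_NatP_d[OF y] and xy = yoneda_mult[OF x y]
    show "NatP_d C n (x \<otimes>\<^bsub>NatP C D n\<^esub> y) = NatP_d C n x \<otimes>\<^bsub>NatP C D (Suc n)\<^esub> NatP_d C n y"
    proof (rule yoneda_inject[OF yoneda_NatP_d(1)[OF xy(1)] yoneda_mult(1)[OF dx(1) dy(1)]])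
      show "yoneda C (Suc n) (NatP_d C n (x \<otimes>\<^bsub>NatP C D n\<^esub> y)) =
          yoneda C (Suc n) (NatP_d C n x \<otimes>\<^bsub>NatP C D (Suc n)\<^esub> NatP_d C n y)"
        unfolding yoneda_NatP_d(2)[OF xy(1)] yoneda_mult(2)[OF dx(1) dy(1)] xy(2) dx(2) dy(2) mult_reduced
        by (rule hom_mult[OF BW_d_hom yoneda_BW[OF x] yoneda_BW[OF y]])
    qed
  qed (rule yoneda_NatP_d(1))
  fix x assume x: "x \<in> carrier (NatP C D n)"
  note dx = yoneda_NatP_d[OF x]
  show "NatP_d C (Suc n) (NatP_d C n x) = \<one>\<^bsub>NatP C D (Suc (Suc n))\<^esub>"
    by (rule yoneda_inject[OF yoneda_NatP_d(1)[OF dx(1)] yoneda_one(1)])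
      (simp only: yoneda_NatP_d(2)[OF dx(1)] dx(2) yoneda_one(2) BW_d_BW_d[OF yoneda_BW[OF x]] one_reduced)
qed

lemma yoneda_cochain_iso: "cochain_iso (NatP C D) (NatP_d C) (reduced C D) (BW_d C D) (yoneda C)"
  unfolding cochain_iso_def
proof (intro allI conjI ballI)
  fix n
  have "yoneda C n \<in> hom (NatP C D n) (reduced C D n)"
    by (rule homI) (rule yoneda_reduced, assumption, rule yoneda_mult(2))
  moreover have "bij_betw (yoneda C n) (carrier (NatP C D n)) (carrier (reduced C D n))"
    unfolding bij_betw_def
  proof
    show "inj_on (yoneda C n) (carrier (NatP C D n))"
      by (rule inj_onI) (rule yoneda_inject)
    show "yoneda C n ` carrier (NatP C D n) = carrier (reduced C D n)"
      using yoneda_reduced yoneda_surj by blast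
  qed
  ultimately show "yoneda C n \<in> iso (NatP C D n) (reduced C D n)" by (simp add: iso_def)
qed (rule yoneda_NatP_d(2))

end

theorem corollary1p32:
  fixes C :: "('o, 'm) cat" and D :: "('m, 'a) nat_system"
  assumes "small_category C" and "natural_system C D"
  shows "cochain_complex (NatP C D) (NatP_d C)
    \<and> cochain_complex (reduced C D) (BW_d C D)
    \<and> cochain_complex (BW C D) (BW_d C D)
    \<and> cochain_iso (NatP C D) (NatP_d C) (reduced C D) (BW_d C D) (yoneda C)
    \<and> (\<forall>n. cohomology (NatP C D) (NatP_d C) n \<cong> cohomology (BW C D) (BW_d C D) n)
    \<and> (\<forall>n. cohomology (reduced C D) (BW_d C D) n \<cong> cohomology (BW C D) (BW_d C D) n)"
proof -
  interpret natural_coefficients C D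
    using assms by (simp add: natural_coefficients_def natural_system_def)
  show ?thesis
    using NatP_complex reduced_complex BW_complex yoneda_cochain_iso cohomology_reduced
      iso_trans[OF cohomology_cochain_iso[OF NatP_complex reduced_complex yoneda_cochain_iso] cohomology_reduced]
    by blast
qed

end
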